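(* Let $(E,[\cdot,\cdot]_E,\rho)$ be a Lie algebroid over an $n$-dimensional manifold $M$, let $S$ be a spray on the prolongation $\pounds^\pi E$, let $\mathcal H$ be the Berwald connection of $S$, and let $\eta\in\Gamma(E)$ be a Lie symmetry of $S$, i.e. $\llbracket S,\eta^C\rrbracket=0$. Then $\eta^C$ is a curvature collineation of the Douglas curvature $\mathcal D$ of $S$, i.e. $\widetilde{\mathcal L}_{\eta^C}\mathcal D=0$.
   Context: **Lie algebroid and prolongation.** $\pi:E\to M$ is a smooth vector bundle with a Lie algebroid structure $([\cdot,\cdot]_E,\rho)$: a Lie bracket on $\Gamma(E)$ and a bundle map (anchor) $\rho:E\to TM$ with $[\xi,f\eta]_E=f[\xi,\eta]_E+(\rho(\xi)f)\eta$. The prolongation is $\pounds^\pi E=\{(u,z)\in E\times TE:\rho(u)=\pi_*(z)\}$, a vector bundle over $E$ with projection $\pi_\pounds(u,z)=v$ for $z\in T_vE$. It is a Lie algebroid over $E$ with anchor $\rho_\pounds(u,z)=z$ and the bracket $\llbracket\cdot,\cdot\rrbracket$ determined by the Leibniz rule and, for sections of the form $(X\circ\pi,U)$, $(Y\circ\pi,W)$ with $X,Y\in\Gamma(E)$ and $U,W$ vector fields on $E$ that are $\pi$-related to $\rho(X),\rho(Y)$, by $\llbracket (X\circ\pi,U),(Y\circ\pi,W)\rrbracket=([X,Y]_E\circ\pi,[U,W])$. **Pullback bundle, $i$, $j$.** $\pi^*E=E\times_ME\to E$ is the pullback bundle (projection to the first factor); its $C^\infty(E)$-module of sections is written $\Gamma(\pi^*\pi)$.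 For $\eta\in\Gamma(E)$, $\widehat\eta(u)=(u,\eta(\pi(u)))$; $\delta(u)=(u,u)$. The bundle maps $i:\pi^*E\to\pounds^\pi E$, $i(u,v)=(0,\frac{d}{dt}|_{t=0}(u+tv))$, and $j:\pounds^\pi E\to\pi^*E$, $j(u,z)=(v,u)$ for $z\in T_vE$, form a short exact sequence $0\to\pi^*E\to\pounds^\pi E\to\pi^*E\to0$. Put $J=i\circ j$ and $C=i\circ\delta$ (Liouville section). **Lifts.** For $\eta\in\Gamma(E)$: the vertical lift is $\eta^V=i(\widehat\eta)$; the complete lift is $\eta^C(u)=(\eta(\pi(u)),\eta^c(u))$, where $\eta^c$ is the unique vector field on $E$ that is $\pi$-projectable onto $\rho(\eta)$ and satisfies $\eta^c(\widehat\theta)=\widehat{\pounds^E_\eta\theta}$ for all $\theta\in\Gamma(E^* )$, with $\widehat\theta(u)=\theta_{\pi(u)}(u)$ and $(\pounds^E_\eta\theta)(\xi)=\rho(\eta)(\theta(\xi))-\theta([\eta,\xi]_E)$. **Spray and Berwald connection.** A semispray is a section $S$ of $\pounds^\pi E$ with $J(S)=C$; it is a spray if moreover $\llbracket C,S\rrbracket=S$. An Ehresmann connection is a $C^\infty(E)$-linear map $\mathcal H:\Gamma(\pi^*\pi)\to\Gamma(\pounds^\pi E)$ with $j\circ\mathcal H=\mathrm{id}$; its vertical map $\mathcal V:\Gamma(\pounds^\pi E)\to\Gamma(\pi^*\pi)$ is the $C^\infty(E)$-linear map with $\mathcal V\circ i=\mathrm{id}$ and $\ker\mathcal V=\operatorname{Im}\mathcal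 H$. The Berwald connection of a spray $S$ is the Ehresmann connection with $\mathcal H(\widehat\eta)=\tfrac12(\eta^C+\llbracket\eta^V,S\rrbracket)$ for all $\eta\in\Gamma(E)$. **Vertical and $h$-Berwald differentials.** For $\bar\xi\in\Gamma(\pi^*\pi)$ and $F\in C^\infty(E)$: $\nabla^v_{\bar\xi}F=\rho_\pounds(i\bar\xi)F$, and $\nabla^v_{\bar\xi}\bar\eta=j\llbracket i\bar\xi,\widetilde\sigma\rrbracket$ for any $\widetilde\sigma$ with $j\widetilde\sigma=\bar\eta$; $\nabla^h_{\bar\xi}F=\rho_\pounds(\mathcal H\bar\xi)F$, and $\nabla^h_{\bar\xi}\bar\eta=\mathcal V\llbracket\mathcal H\bar\xi,i\bar\eta\rrbracket$. These are extended to all tensors on $\pi^*\pi$ as tensor derivations (commuting with contractions); $(\nabla^vA)(\bar\xi,\dots)=(\nabla^v_{\bar\xi}A)(\dots)$, and similarly for $\nabla^h$. **Lie derivation.** A section $\widetilde\xi$ of $\pounds^\pi E$ is projectable if its first component is $X\circ\pi$ for some $X\in\Gamma(E)$ ($\eta^C$ and $\eta^V$ are projectable). For projectable $\widetilde\xi$, $\widetilde{\mathcal L}_{\widetilde\xi}$ is the tensor derivation on tensors of $\pi^*\pi$ with $\widetilde{\mathcal L}_{\widetilde\xi}F=\rho_\pounds(\widetilde\xi)F$ and $\widetilde{\mathcal L}_{\widetilde\xi}\bar\eta=i^{-1}\llbracket\widetilde\xi,i\bar\eta\rrbracket$. A projectable section $\widetilde\xi$ is a curvature collineation of a tensor $A$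 of type $(1,k)$, $k\in\{1,2,3\}$, on $\pi^*\pi$ if $\widetilde{\mathcal L}_{\widetilde\xi}A=0$. **Berwald and Douglas curvatures.** $\mathcal B$ is the $(1,3)$-tensor on $\pi^*\pi$ determined by $\mathcal B(\widehat\eta,\widehat\xi)\widehat\sigma=(\nabla^v\nabla^h\widehat\sigma)(\widehat\eta,\widehat\xi)=\nabla^v_{\widehat\eta}\nabla^h_{\widehat\xi}\widehat\sigma$ for $\eta,\xi,\sigma\in\Gamma(E)$, extended $C^\infty(E)$-linearly, where $\mathcal H$ is the Berwald connection of $S$; write $\mathcal B(\bar\eta,\bar\xi,\bar\sigma)=\mathcal B(\bar\eta,\bar\xi)\bar\sigma$. Its trace $\operatorname{tr}\mathcal B$ is the $(0,2)$-tensor with $(\operatorname{tr}\mathcal B)(X_1,X_2)$ equal to the trace of $Z\mapsto\mathcal B(Z,X_1,X_2)$. The Douglas curvature is $$\mathcal D=\mathcal B-\frac1{n+1}\big\{(\operatorname{tr}\mathcal B)\odot\mathrm{Id}_{\Gamma(\pi^*\pi)}+(\nabla^v\operatorname{tr}\mathcal B)\otimes\delta\big\},$$ where $\odot$ is the symmetric product without numerical factor: $\big((\operatorname{tr}\mathcal B)\odot\mathrm{Id}\big)(X,Y,Z)=(\operatorname{tr}\mathcal B)(X,Y)Z+(\operatorname{tr}\mathcal B)(Y,Z)X+(\operatorname{tr}\mathcal B)(Z,X)Y$. *)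

theory Defs
  imports "HOL-Analysis.Analysis"
begin

section \<open>Smooth manifolds\<close>

text \<open>
  Model spaces are finite-dimensional inner product spaces. The library class
  \<^class>\<open>euclidean_space\<close> excludes dimension 0 and would thereby exclude Lie algebras
  (Lie algebroids over a point) and bundles of rank 0.
\<close>

class finite_dim_inner = real_inner +
  assumes finite_dim: "\<exists>B. finite B \<and> (\<forall>x. \<exists>c. x = (\<Sum>b\<in>B. c b *\<^sub>R b))"

lemma finite_spanning: "\<exists>B :: 'a::finite_dim_inner set. finite B \<and> span B = UNIV"
proof -
  obtain B :: "'a set" where "finite B" "\<forall>x. \<exists>c. x = (\<Sum>b\<in>B. c b *\<^sub>R b)"
    using finite_dim by blast
  then have "x \<in> span B" for x
  proof -
    obtain c where "x = (\<Sum>b\<in>B. c b *\<^sub>R b)"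
      using \<open>\<forall>x. \<exists>c. x = (\<Sum>b\<in>B. c b *\<^sub>R b)\<close> by blast
    then show ?thesis by (auto intro: span_sum span_scale span_base)
  qed
  with \<open>finite B\<close> show ?thesis by blast
qed

instance euclidean_space \<subseteq> finite_dim_inner
proof
  have "\<forall>x::'a. \<exists>c. x = (\<Sum>b\<in>Basis. c b *\<^sub>R b)"
  proof
    fix x :: 'a
    have "x = (\<Sum>b\<in>Basis. (x \<bullet> b) *\<^sub>R b)" by (simp add: euclidean_representation)
    then show "\<exists>c. x = (\<Sum>b\<in>Basis. c b *\<^sub>R b)" by (rule exI[of _ "\<lambda>b. x \<bullet> b"])
  qed
  then show "\<exists>B :: 'a set. finite B \<and> (\<forall>x. \<exists>c. x = (\<Sum>b\<in>B. c b *\<^sub>R b))"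
    using finite_Basis by blast
qed

instance prod :: (finite_dim_inner, finite_dim_inner) finite_dim_inner
proof
  obtain A :: "'a set" where A: "finite A" "span A = UNIV" using finite_spanning by blast
  obtain B :: "'b set" where B: "finite B" "span B = UNIV" using finite_spanning by blast
  let ?C = "(\<lambda>a. (a, 0)) ` A \<union> (\<lambda>b. (0, b)) ` B :: ('a \<times> 'b) set"
  have l1: "linear (\<lambda>a::'a. (a, 0::'b))" and l2: "linear (\<lambda>b::'b. (0::'a, b))"
    by (auto intro!: linearI)
  have "x \<in> span ?C" for x
  proof -
    have "(fst x, 0) \<in> span ((\<lambda>a. (a, 0::'b)) ` A)"
      using A by (simp add: linear_span_image[OF l1])
    moreover have "(0, snd x) \<in> span ((\<lambda>b. (0::'a, b)) ` B)"
      using B by (simp add: linear_span_image[OF l2])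
    ultimately have "(fst x, 0) + (0, snd x) \<in> span ?C"
      by (meson span_add span_mono subsetD sup_ge1 sup_ge2)
    then show ?thesis by simp
  qed
  moreover have C: "finite ?C" using A(1) B(1) by auto
  ultimately have "\<forall>x. \<exists>c. x = (\<Sum>b\<in>?C. c b *\<^sub>R b)"
    using span_finite[OF C] by auto
  then show "\<exists>B :: ('a \<times> 'b) set. finite B \<and> (\<forall>x. \<exists>c. x = (\<Sum>b\<in>B. c b *\<^sub>R b))"
    using C by blast
qed

text \<open>
  On an open subset of a finite-dimensional space, continuity of the derivative may be tested on
  each direction \<open>v\<close> separately.
\<close>

primrec Ck_on :: "nat \<Rightarrow> 'a::real_normed_vector set \<Rightarrow> ('a \<Rightarrow> 'b::real_normed_vector) \<Rightarrow> bool" where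
  "Ck_on 0 U f \<longleftrightarrow> continuous_on U f"
| "Ck_on (Suc k) U f \<longleftrightarrow> (\<forall>x\<in>U. f differentiable (at x)) \<and>
     (\<forall>v. Ck_on k U (\<lambda>x. frechet_derivative f (at x) v))"

definition smooth_on :: "'a::real_normed_vector set \<Rightarrow> ('a \<Rightarrow> 'b::real_normed_vector) \<Rightarrow> bool" where
  "smooth_on U f \<longleftrightarrow> (\<forall>k. Ck_on k U f)"

text \<open>
  A chart is a pair of its domain and its coordinate map; values of the coordinate map off the
  domain are irrelevant. An atlas is not required to be maximal.
\<close>

type_synonym ('m, 'a) atlas = "('m set \<times> ('m \<Rightarrow> 'a)) set"

definition smooth_atlas ::
  "('m::{t2_space, second_countable_topology}, 'a::finite_dim_inner) atlas \<Rightarrow> bool" where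
  "smooth_atlas A \<longleftrightarrow>
     (\<Union>(U, \<phi>)\<in>A. U) = UNIV \<and>
     (\<forall>(U, \<phi>)\<in>A. open U \<and> open (\<phi> ` U) \<and> homeomorphism U (\<phi> ` U) \<phi> (inv_into U \<phi>)) \<and>
     (\<forall>(U, \<phi>)\<in>A. \<forall>(V, \<psi>)\<in>A. smooth_on (\<phi> ` (U \<inter> V)) (\<psi> \<circ> inv_into U \<phi>))"

definition Cinf :: "('m, 'a::finite_dim_inner) atlas \<Rightarrow> ('m \<Rightarrow> real) set" where
  "Cinf A = {f. \<forall>(U, \<phi>)\<in>A. smooth_on (\<phi> ` U) (f \<circ> inv_into U \<phi>)}"

definition smooth_map :: "('m::topological_space, 'a::finite_dim_inner) atlas \<Rightarrow>
    ('n::topological_space, 'b::finite_dim_inner) atlas \<Rightarrow> ('m \<Rightarrow> 'n) \<Rightarrow> bool" where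
  "smooth_map A B F \<longleftrightarrow> continuous_on UNIV F \<and>
     (\<forall>(U, \<phi>)\<in>A. \<forall>(V, \<psi>)\<in>B.
        smooth_on (\<phi> ` (U \<inter> F -` V)) (\<psi> \<circ> F \<circ> inv_into U \<phi>))"

text \<open>
  Tangent vectors at \<open>p\<close> are derivations at \<open>p\<close> of the algebra of smooth functions, tagged with
  \<open>p\<close> (the zero derivations at different points are the same functional). On functions that are
  not smooth a tangent vector is 0 by convention, so that it is determined by its values on
  smooth functions.
\<close>

type_synonym 'm tvec = "'m \<times> (('m \<Rightarrow> real) \<Rightarrow> real)"

definition tangent_space :: "('m, 'a::finite_dim_inner) atlas \<Rightarrow> 'm \<Rightarrow> 'm tvec set" where
  "tangent_space A p = {(q, D) | q D. q = p \<and>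
     (\<forall>f\<in>Cinf A. \<forall>g\<in>Cinf A. D (\<lambda>x. f x + g x) = D f + D g) \<and>
     (\<forall>c. \<forall>f\<in>Cinf A. D (\<lambda>x. c * f x) = c * D f) \<and>
     (\<forall>f\<in>Cinf A. \<forall>g\<in>Cinf A. D (\<lambda>x. f x * g x) = f p * D g + g p * D f) \<and>
     (\<forall>f. f \<notin> Cinf A \<longrightarrow> D f = 0)}"

definition tadd :: "'m tvec \<Rightarrow> 'm tvec \<Rightarrow> 'm tvec" where
  "tadd z w = (fst z, \<lambda>f. snd z f + snd w f)"

definition tscale :: "real \<Rightarrow> 'm tvec \<Rightarrow> 'm tvec" where
  "tscale c z = (fst z, \<lambda>f. c * snd z f)"

definition tzero :: "'m \<Rightarrow> 'm tvec" where
  "tzero p = (p, \<lambda>f. 0)"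

definition pushforward :: "('m, 'a::finite_dim_inner) atlas \<Rightarrow> ('m \<Rightarrow> 'n) \<Rightarrow>
    ('n, 'b::finite_dim_inner) atlas \<Rightarrow> 'm tvec \<Rightarrow> 'n tvec" where
  "pushforward A F B z = (F (fst z), \<lambda>f. if f \<in> Cinf B then snd z (f \<circ> F) else 0)"

definition vf_act :: "('m \<Rightarrow> 'm tvec) \<Rightarrow> ('m \<Rightarrow> real) \<Rightarrow> 'm \<Rightarrow> real" where
  "vf_act Z f = (\<lambda>p. snd (Z p) f)"

definition vector_fields :: "('m, 'a::finite_dim_inner) atlas \<Rightarrow> ('m \<Rightarrow> 'm tvec) set" where
  "vector_fields A = {Z. (\<forall>p. Z p \<in> tangent_space A p) \<and> (\<forall>f\<in>Cinf A. vf_act Z f \<in> Cinf A)}"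

definition vf_bracket :: "('m, 'a::finite_dim_inner) atlas \<Rightarrow>
    ('m \<Rightarrow> 'm tvec) \<Rightarrow> ('m \<Rightarrow> 'm tvec) \<Rightarrow> ('m \<Rightarrow> 'm tvec)" where
  "vf_bracket A U W = (\<lambda>p. (p, \<lambda>f. if f \<in> Cinf A
      then snd (U p) (vf_act W f) - snd (W p) (vf_act U f) else 0))"


section \<open>Modules over smooth functions and Lie brackets on them\<close>

text \<open>
  In the next three definitions a module over the function algebra \<open>R\<close> is given by its set
  \<open>\<Gamma>\<close> of elements, its addition, and its multiplication by functions; multiplication by a real
  number is multiplication by the constant function.
\<close>

definition module_linear :: "('p \<Rightarrow> real) set \<Rightarrow>
    's set \<Rightarrow> ('s \<Rightarrow> 's \<Rightarrow> 's) \<Rightarrow> (('p \<Rightarrow> real) \<Rightarrow> 's \<Rightarrow> 's) \<Rightarrow>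
    't set \<Rightarrow> ('t \<Rightarrow> 't \<Rightarrow> 't) \<Rightarrow> (('p \<Rightarrow> real) \<Rightarrow> 't \<Rightarrow> 't) \<Rightarrow> ('s \<Rightarrow> 't) \<Rightarrow> bool" where
  "module_linear R \<Gamma> add smul \<Gamma>' add' smul' L \<longleftrightarrow>
     (\<forall>X\<in>\<Gamma>. L X \<in> \<Gamma>') \<and>
     (\<forall>X\<in>\<Gamma>. \<forall>Y\<in>\<Gamma>. L (add X Y) = add' (L X) (L Y)) \<and>
     (\<forall>f\<in>R. \<forall>X\<in>\<Gamma>. L (smul f X) = smul' f (L X))"

definition lie_bracket_on :: "'s set \<Rightarrow> ('s \<Rightarrow> 's \<Rightarrow> 's) \<Rightarrow> (('p \<Rightarrow> real) \<Rightarrow> 's \<Rightarrow> 's) \<Rightarrow> 's \<Rightarrow>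
    ('s \<Rightarrow> 's \<Rightarrow> 's) \<Rightarrow> bool" where
  "lie_bracket_on \<Gamma> add smul zero br \<longleftrightarrow>
     (\<forall>X\<in>\<Gamma>. \<forall>Y\<in>\<Gamma>. br X Y \<in> \<Gamma>) \<and>
     (\<forall>X\<in>\<Gamma>. \<forall>Y\<in>\<Gamma>. \<forall>Z\<in>\<Gamma>. br (add X Y) Z = add (br X Z) (br Y Z)) \<and>
     (\<forall>X\<in>\<Gamma>. \<forall>Y\<in>\<Gamma>. \<forall>Z\<in>\<Gamma>. br X (add Y Z) = add (br X Y) (br X Z)) \<and>
     (\<forall>c. \<forall>X\<in>\<Gamma>. \<forall>Y\<in>\<Gamma>. br (smul (\<lambda>_. c) X) Y = smul (\<lambda>_. c) (br X Y)) \<and>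
     (\<forall>c. \<forall>X\<in>\<Gamma>. \<forall>Y\<in>\<Gamma>. br X (smul (\<lambda>_. c) Y) = smul (\<lambda>_. c) (br X Y)) \<and>
     (\<forall>X\<in>\<Gamma>. br X X = zero) \<and>
     (\<forall>X\<in>\<Gamma>. \<forall>Y\<in>\<Gamma>. \<forall>Z\<in>\<Gamma>.
        add (br X (br Y Z)) (add (br Y (br Z X)) (br Z (br X Y))) = zero)"

definition leibniz_on :: "('p \<Rightarrow> real) set \<Rightarrow>
    's set \<Rightarrow> ('s \<Rightarrow> 's \<Rightarrow> 's) \<Rightarrow> (('p \<Rightarrow> real) \<Rightarrow> 's \<Rightarrow> 's) \<Rightarrow>
    ('s \<Rightarrow> ('p \<Rightarrow> real) \<Rightarrow> ('p \<Rightarrow> real)) \<Rightarrow> ('s \<Rightarrow> 's \<Rightarrow> 's) \<Rightarrow> bool" where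
  "leibniz_on R \<Gamma> add smul act br \<longleftrightarrow>
     (\<forall>f\<in>R. \<forall>X\<in>\<Gamma>. \<forall>Y\<in>\<Gamma>. br X (smul f Y) = add (smul f (br X Y)) (smul (act X f) Y))"


section \<open>Vector bundles and Lie algebroids\<close>

text \<open>
  A trivialization over \<open>V\<close> is stored as \<open>(V, \<Phi>)\<close>, where \<open>\<Phi>\<close> is the second component of the
  fibrewise linear diffeomorphism from the part of the total space over \<open>V\<close> to \<open>V \<times> 'f\<close>.
  The smooth structure of the total space is the one generated by the bundle charts
  \<open>e \<mapsto> (\<phi> (\<pi> e), \<Phi> e)\<close>; it is exactly the one for which the trivializations are diffeomorphisms.
  Fibre addition is only meaningful on vectors of the same fibre.
\<close>

record ('m, 'a, 'e, 'f) bundle_data =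
  base_atlas :: "('m, 'a) atlas"
  bproj :: "'e \<Rightarrow> 'm"
  fadd :: "'e \<Rightarrow> 'e \<Rightarrow> 'e"
  fscale :: "real \<Rightarrow> 'e \<Rightarrow> 'e"
  trivs :: "('m set \<times> ('e \<Rightarrow> 'f)) set"

record ('m, 'a, 'e, 'f) algebroid_data = "('m, 'a, 'e, 'f) bundle_data" +
  bracket :: "('m \<Rightarrow> 'e) \<Rightarrow> ('m \<Rightarrow> 'e) \<Rightarrow> ('m \<Rightarrow> 'e)"
  anchor :: "'e \<Rightarrow> 'm tvec"

definition E_atlas :: "('m, 'a, 'e, 'f, 'z) bundle_data_scheme \<Rightarrow> ('e, 'a \<times> 'f) atlas" where
  "E_atlas G = {(bproj G -` (U \<inter> V), \<lambda>e. (\<phi> (bproj G e), \<Phi> e)) | U \<phi> V \<Phi>.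
     (U, \<phi>) \<in> base_atlas G \<and> (V, \<Phi>) \<in> trivs G}"

definition vector_bundle ::
  "('m::{t2_space, second_countable_topology}, 'a::finite_dim_inner,
    'e::{t2_space, second_countable_topology}, 'f::finite_dim_inner, 'z) bundle_data_scheme \<Rightarrow> bool" where
  "vector_bundle G \<longleftrightarrow>
     smooth_atlas (base_atlas G) \<and> smooth_atlas (E_atlas G) \<and>
     (\<forall>u v. bproj G u = bproj G v \<longrightarrow> bproj G (fadd G u v) = bproj G u) \<and>
     (\<forall>c u. bproj G (fscale G c u) = bproj G u) \<and>
     (\<Union>(V, \<Phi>)\<in>trivs G. V) = UNIV \<and>
     (\<forall>(V, \<Phi>)\<in>trivs G. open V \<and>
        (\<forall>p\<in>V. bij_betw \<Phi> (bproj G -` {p}) UNIV \<and>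
          (\<forall>u v. bproj G u = p \<and> bproj G v = p \<longrightarrow> \<Phi> (fadd G u v) = \<Phi> u + \<Phi> v) \<and>
          (\<forall>c u. bproj G u = p \<longrightarrow> \<Phi> (fscale G c u) = c *\<^sub>R \<Phi> u)))"

definition fzero :: "('m, 'a, 'e, 'f, 'z) bundle_data_scheme \<Rightarrow> 'm \<Rightarrow> 'e" where
  "fzero G p = (THE z. bproj G z = p \<and> (\<forall>u. bproj G u = p \<longrightarrow> fadd G z u = u))"

definition sections ::
  "('m::topological_space, 'a::finite_dim_inner, 'e::topological_space, 'f::finite_dim_inner, 'z)
    bundle_data_scheme \<Rightarrow> ('m \<Rightarrow> 'e) set" where
  "sections G = {s. (\<forall>p. bproj G (s p) = p) \<and> smooth_map (base_atlas G) (E_atlas G) s}"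

definition sadd where
  "sadd G s t = (\<lambda>p. fadd G (s p) (t p))"

definition smul where
  "smul G f s = (\<lambda>p. fscale G (f p) (s p))"

definition szero where
  "szero G = (\<lambda>p. fzero G p)"

text \<open>
  Smoothness of the anchor as a map into the tangent bundle of the base amounts to smoothness of
  \<open>u \<mapsto> df (\<rho> u)\<close> for all smooth \<open>f\<close> on the base.
\<close>

definition lie_algebroid ::
  "('m::{t2_space, second_countable_topology}, 'a::finite_dim_inner,
    'e::{t2_space, second_countable_topology}, 'f::finite_dim_inner) algebroid_data \<Rightarrow> bool" where
  "lie_algebroid G \<longleftrightarrow> vector_bundle G \<and>
     (\<forall>u. anchor G u \<in> tangent_space (base_atlas G) (bproj G u)) \<and>
     (\<forall>u v. bproj G u = bproj G v \<longrightarrow> anchor G (fadd G u v) = tadd (anchor G u) (anchor G v)) \<and>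
     (\<forall>c u. anchor G (fscale G c u) = tscale c (anchor G u)) \<and>
     (\<forall>f\<in>Cinf (base_atlas G). (\<lambda>u. snd (anchor G u) f) \<in> Cinf (E_atlas G)) \<and>
     lie_bracket_on (sections G) (sadd G) (smul G) (szero G) (bracket G) \<and>
     leibniz_on (Cinf (base_atlas G)) (sections G) (sadd G) (smul G)
       (\<lambda>\<xi>. vf_act (anchor G \<circ> \<xi>)) (bracket G)"


section \<open>Pullback bundle and prolongation\<close>

definition pb_sections ::
  "('m, 'a::finite_dim_inner, 'e::topological_space, 'f::finite_dim_inner, 'z)
    bundle_data_scheme \<Rightarrow> ('e \<Rightarrow> 'e \<times> 'e) set" where
  "pb_sections G = {X. (\<forall>u. fst (X u) = u \<and> bproj G (snd (X u)) = bproj G u) \<and>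
     smooth_map (E_atlas G) (E_atlas G) (snd \<circ> X)}"

definition padd where
  "padd G X Y = (\<lambda>u. (u, fadd G (snd (X u)) (snd (Y u))))"

definition pmul where
  "pmul G f X = (\<lambda>u. (u, fscale G (f u) (snd (X u))))"

definition pzero where
  "pzero G = (\<lambda>u. (u, fzero G (bproj G u)))"

definition prolongation ::
  "('m, 'a::finite_dim_inner, 'e, 'f::finite_dim_inner) algebroid_data \<Rightarrow> ('e \<times> 'e tvec) set" where
  "prolongation G = {(u, z). z \<in> tangent_space (E_atlas G) (fst z) \<and>
     anchor G u = pushforward (E_atlas G) (bproj G) (base_atlas G) z}"

definition prol_sections ::
  "('m, 'a::finite_dim_inner, 'e::topological_space, 'f::finite_dim_inner) algebroid_data \<Rightarrow>
    ('e \<Rightarrow> 'e \<times> 'e tvec) set" where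
  "prol_sections G = {\<zeta>. (\<forall>v. \<zeta> v \<in> prolongation G \<and> fst (snd (\<zeta> v)) = v) \<and>
     smooth_map (E_atlas G) (E_atlas G) (fst \<circ> \<zeta>) \<and> snd \<circ> \<zeta> \<in> vector_fields (E_atlas G)}"

definition ladd where
  "ladd G \<zeta> \<omega> = (\<lambda>v. (fadd G (fst (\<zeta> v)) (fst (\<omega> v)), tadd (snd (\<zeta> v)) (snd (\<omega> v))))"

definition lmul where
  "lmul G f \<zeta> = (\<lambda>v. (fscale G (f v) (fst (\<zeta> v)), tscale (f v) (snd (\<zeta> v))))"

definition lzero where
  "lzero G = (\<lambda>v. (fzero G (bproj G v), tzero v))"

text \<open>The derivation by the image of a section of the prolongation under its anchor.\<close>

definition lact :: "('e \<Rightarrow> 'e \<times> 'e tvec) \<Rightarrow> ('e \<Rightarrow> real) \<Rightarrow> ('e \<Rightarrow> real)" where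
  "lact \<zeta> = vf_act (snd \<circ> \<zeta>)"

definition related_to_anchor where
  "related_to_anchor G U X \<longleftrightarrow>
     (\<forall>v. pushforward (E_atlas G) (bproj G) (base_atlas G) (U v) = anchor G (X (bproj G v)))"

definition prolongation_bracket ::
  "('m::topological_space, 'a::finite_dim_inner, 'e::topological_space, 'f::finite_dim_inner)
    algebroid_data \<Rightarrow>
    (('e \<Rightarrow> 'e \<times> 'e tvec) \<Rightarrow> ('e \<Rightarrow> 'e \<times> 'e tvec) \<Rightarrow> ('e \<Rightarrow> 'e \<times> 'e tvec)) \<Rightarrow> bool" where
  "prolongation_bracket G br \<longleftrightarrow>
     lie_bracket_on (prol_sections G) (ladd G) (lmul G) (lzero G) br \<and>
     leibniz_on (Cinf (E_atlas G)) (prol_sections G) (ladd G) (lmul G) lact br \<and>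
     (\<forall>X\<in>sections G. \<forall>Y\<in>sections G.
       \<forall>U\<in>vector_fields (E_atlas G). \<forall>W\<in>vector_fields (E_atlas G).
         related_to_anchor G U X \<and> related_to_anchor G W Y \<longrightarrow>
         br (\<lambda>v. (X (bproj G v), U v)) (\<lambda>v. (Y (bproj G v), W v)) =
           (\<lambda>v. (bracket G X Y (bproj G v), vf_bracket (E_atlas G) U W v)))"

definition imap ::
  "('m, 'a::finite_dim_inner, 'e, 'f::finite_dim_inner, 'z) bundle_data_scheme \<Rightarrow>
    'e \<times> 'e \<Rightarrow> 'e \<times> 'e tvec" where
  "imap G = (\<lambda>(u, v). (fzero G (bproj G u),
     (u, \<lambda>f. if f \<in> Cinf (E_atlas G) then deriv (\<lambda>t. f (fadd G u (fscale G t v))) 0 else 0)))"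

definition jmap :: "'e \<times> 'e tvec \<Rightarrow> 'e \<times> 'e" where
  "jmap = (\<lambda>(u, z). (fst z, u))"

definition imap_inv where
  "imap_inv G \<zeta> = (THE X. X \<in> pb_sections G \<and> imap G \<circ> X = \<zeta>)"

definition hat :: "('m, 'a, 'e, 'f, 'z) bundle_data_scheme \<Rightarrow> ('m \<Rightarrow> 'e) \<Rightarrow> 'e \<Rightarrow> 'e \<times> 'e" where
  "hat G \<eta> = (\<lambda>u. (u, \<eta> (bproj G u)))"

definition delta :: "'e \<Rightarrow> 'e \<times> 'e" where
  "delta = (\<lambda>u. (u, u))"

definition liouville where
  "liouville G = imap G \<circ> delta"

definition Jmap where
  "Jmap G = imap G \<circ> jmap"


section \<open>Lifts\<close>

text \<open>
  A section \<open>\<theta>\<close> of the dual bundle assigns to \<open>p\<close> a linear form \<open>\<theta> p\<close> on the fibre over \<open>p\<close>,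
  set to 0 off that fibre so that it is determined by its values on the fibre. It is smooth iff
  its pairing with every smooth section is smooth.
\<close>

definition dual_pair :: "('m \<Rightarrow> 'e \<Rightarrow> real) \<Rightarrow> ('m \<Rightarrow> 'e) \<Rightarrow> 'm \<Rightarrow> real" where
  "dual_pair \<theta> \<xi> = (\<lambda>p. \<theta> p (\<xi> p))"

definition dual_sections ::
  "('m::topological_space, 'a::finite_dim_inner, 'e::topological_space, 'f::finite_dim_inner, 'z)
    bundle_data_scheme \<Rightarrow> ('m \<Rightarrow> 'e \<Rightarrow> real) set" where
  "dual_sections G = {\<theta>.
     (\<forall>u v. bproj G u = bproj G v \<longrightarrow>
        \<theta> (bproj G u) (fadd G u v) = \<theta> (bproj G u) u + \<theta> (bproj G u) v) \<and>
     (\<forall>c u. \<theta> (bproj G u) (fscale G c u) = c * \<theta> (bproj G u) u) \<and>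
     (\<forall>p u. bproj G u \<noteq> p \<longrightarrow> \<theta> p u = 0) \<and>
     (\<forall>\<xi>\<in>sections G. dual_pair \<theta> \<xi> \<in> Cinf (base_atlas G))}"

definition dual_hat where
  "dual_hat G \<theta> = (\<lambda>u. \<theta> (bproj G u) u)"

definition lie_dual where
  "lie_dual G \<eta> \<theta> = (THE \<theta>'. \<theta>' \<in> dual_sections G \<and>
     (\<forall>\<xi>\<in>sections G. dual_pair \<theta>' \<xi> =
        (\<lambda>p. vf_act (anchor G \<circ> \<eta>) (dual_pair \<theta> \<xi>) p - dual_pair \<theta> (bracket G \<eta> \<xi>) p)))"

definition vertical_lift where
  "vertical_lift G \<eta> = imap G \<circ> hat G \<eta>"

definition complete_lift_vf where
  "complete_lift_vf G \<eta> = (THE Z. Z \<in> vector_fields (E_atlas G) \<and> related_to_anchor G Z \<eta> \<and>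
     (\<forall>\<theta>\<in>dual_sections G. vf_act Z (dual_hat G \<theta>) = dual_hat G (lie_dual G \<eta> \<theta>)))"

definition complete_lift where
  "complete_lift G \<eta> = (\<lambda>u. (\<eta> (bproj G u), complete_lift_vf G \<eta> u))"


section \<open>Sprays and the Berwald connection\<close>

text \<open>Throughout, \<open>br\<close> stands for the bracket of the prolongation.\<close>

definition semispray where
  "semispray G S \<longleftrightarrow> S \<in> prol_sections G \<and> Jmap G \<circ> S = liouville G"

definition spray where
  "spray G br S \<longleftrightarrow> semispray G S \<and> br (liouville G) S = S"

definition ehresmann_connection where
  "ehresmann_connection G H \<longleftrightarrow>
     module_linear (Cinf (E_atlas G)) (pb_sections G) (padd G) (pmul G)
       (prol_sections G) (ladd G) (lmul G) H \<and>
     (\<forall>X\<in>pb_sections G. jmap \<circ> H X = X)"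

definition vertical_map where
  "vertical_map G H V \<longleftrightarrow>
     module_linear (Cinf (E_atlas G)) (prol_sections G) (ladd G) (lmul G)
       (pb_sections G) (padd G) (pmul G) V \<and>
     (\<forall>X\<in>pb_sections G. V (imap G \<circ> X) = X) \<and>
     {\<zeta> \<in> prol_sections G. V \<zeta> = pzero G} = H ` pb_sections G"

definition berwald_connection where
  "berwald_connection G br S H \<longleftrightarrow> ehresmann_connection G H \<and>
     (\<forall>\<eta>\<in>sections G. H (hat G \<eta>) =
        lmul G (\<lambda>_. 1/2) (ladd G (complete_lift G \<eta>) (br (vertical_lift G \<eta>) S)))"

definition nabla_v_fun where
  "nabla_v_fun G X F = lact (imap G \<circ> X) F"

definition nabla_v where
  "nabla_v G br X Y = jmap \<circ> br (imap G \<circ> X) (SOME \<sigma>. \<sigma> \<in> prol_sections G \<and> jmap \<circ> \<sigma> = Y)"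

definition nabla_h where
  "nabla_h G br H V X Y = V (br (H X) (imap G \<circ> Y))"

text \<open>The differential of a (0,2)-tensor, by the product rule for tensor derivations.\<close>

definition nabla_v_02 where
  "nabla_v_02 G br A X Y Z = (\<lambda>u. nabla_v_fun G X (A Y Z) u
     - A (nabla_v G br X Y) Z u - A Y (nabla_v G br X Z) u)"


section \<open>Lie derivation\<close>

definition projectable where
  "projectable G \<zeta> \<longleftrightarrow> \<zeta> \<in> prol_sections G \<and> (\<exists>X\<in>sections G. \<forall>v. fst (\<zeta> v) = X (bproj G v))"

definition lie_der where
  "lie_der G br \<zeta> Y = imap_inv G (br \<zeta> (imap G \<circ> Y))"

text \<open>The product rule for tensor derivations on tensors of type (1,3).\<close>

definition lie_der_13 where
  "lie_der_13 G br \<zeta> A X Y Z =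
     padd G (lie_der G br \<zeta> (A X Y Z))
       (pmul G (\<lambda>_. -1)
         (padd G (A (lie_der G br \<zeta> X) Y Z)
           (padd G (A X (lie_der G br \<zeta> Y) Z) (A X Y (lie_der G br \<zeta> Z)))))"

definition curvature_collineation where
  "curvature_collineation G br A \<zeta> \<longleftrightarrow> projectable G \<zeta> \<and>
     (\<forall>X\<in>pb_sections G. \<forall>Y\<in>pb_sections G. \<forall>Z\<in>pb_sections G.
        lie_der_13 G br \<zeta> A X Y Z = pzero G)"

definition lie_symmetry where
  "lie_symmetry G br S \<eta> \<longleftrightarrow> \<eta> \<in> sections G \<and> br S (complete_lift G \<eta>) = lzero G"


section \<open>Berwald and Douglas curvatures\<close>

definition tensor_13 where
  "tensor_13 G A \<longleftrightarrow>
     (\<forall>X\<in>pb_sections G. \<forall>Y\<in>pb_sections G.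
        module_linear (Cinf (E_atlas G)) (pb_sections G) (padd G) (pmul G)
          (pb_sections G) (padd G) (pmul G) (\<lambda>Z. A Z X Y) \<and>
        module_linear (Cinf (E_atlas G)) (pb_sections G) (padd G) (pmul G)
          (pb_sections G) (padd G) (pmul G) (\<lambda>Z. A X Z Y) \<and>
        module_linear (Cinf (E_atlas G)) (pb_sections G) (padd G) (pmul G)
          (pb_sections G) (padd G) (pmul G) (\<lambda>Z. A X Y Z))"

definition berwald_curvature where
  "berwald_curvature G br H V B \<longleftrightarrow> tensor_13 G B \<and>
     (\<forall>\<eta>\<in>sections G. \<forall>\<xi>\<in>sections G. \<forall>\<sigma>\<in>sections G.
        B (hat G \<eta>) (hat G \<xi>) (hat G \<sigma>) =
          nabla_v G br (hat G \<eta>) (nabla_h G br H V (hat G \<xi>) (hat G \<sigma>)))"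

text \<open>
  The trace of an endomorphism \<open>T\<close> of the module of sections of the pullback bundle is taken
  pointwise: \<open>fibre_value G T u\<close> is the endomorphism induced by \<open>T\<close> on the fibre of the bundle over
  \<open>bproj G u\<close>, and it is transported to the model fibre by any trivialization.
\<close>

definition lin_trace :: "('f::finite_dim_inner \<Rightarrow> 'f) \<Rightarrow> real" where
  "lin_trace T = (let B = (SOME B. independent B \<and> span B = UNIV)
     in \<Sum>b\<in>B. representation B (T b) b)"

definition fibre_value where
  "fibre_value G T u w = snd (T (SOME X. X \<in> pb_sections G \<and> X u = (u, w)) u)"

definition endo_trace where
  "endo_trace G T u = (let \<Phi> = (SOME \<Phi>. \<exists>V. (V, \<Phi>) \<in> trivs G \<and> bproj G u \<in> V)
     in lin_trace (\<lambda>y. \<Phi> (fibre_value G T u (inv_into (bproj G -` {bproj G u}) \<Phi> y))))"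

definition tr_13 where
  "tr_13 G A X1 X2 = (\<lambda>u. endo_trace G (\<lambda>Z. A Z X1 X2) u)"

definition sym_prod_Id where
  "sym_prod_Id G A X Y Z =
     padd G (pmul G (A X Y) Z) (padd G (pmul G (A Y Z) X) (pmul G (A Z X) Y))"

text \<open>The parameter \<open>n\<close> is the dimension of the base manifold, not the rank of the bundle.\<close>

definition douglas where
  "douglas G n br B X Y Z =
     padd G (B X Y Z)
       (pmul G (\<lambda>_. - 1 / (real n + 1))
         (padd G (sym_prod_Id G (tr_13 G B) X Y Z)
           (pmul G (nabla_v_02 G br (tr_13 G B) X Y Z) delta)))"

end

theory Submission
  imports Defs
begin

text \<open>
  Write \<open>L\<close> for the Lie derivation along \<open>\<eta>\<^sup>C\<close>. A section \<open>X\<close> of the pullback bundle is determined by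
  the functions \<open>\<theta>(X)\<close>, for \<open>\<theta>\<close> a section of the dual bundle, and in these terms both \<open>L\<close> and the
  vertical derivative are explicit: \<open>\<theta>(\<nabla>\<^sup>v\<^sub>X Y) = iX(\<theta>(Y))\<close> and \<open>\<theta>(L X) = \<eta>\<^sup>C(\<theta>(X)) - (\<L>\<^sub>\<eta> \<theta>)(X)\<close>. Hence \<open>L\<close>
  annihilates \<open>\<delta>\<close> and commutes with \<open>\<nabla>\<^sup>v\<close>, with \<open>j\<close> and with traces. If \<open>\<lbrakk>S, \<eta>\<^sup>C\<rbrakk> = 0\<close>, then the Jacobi
  identity and \<open>\<lbrakk>\<eta>\<^sup>C, \<xi>\<^sup>C\<rbrakk> = [\<eta>, \<xi>]\<^sup>C\<close> show that bracketing with \<open>\<eta>\<^sup>C\<close> preserves the Berwald connection; so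
  \<open>L\<close> also commutes with \<open>\<nabla>\<^sup>h\<close> on basic sections, whence \<open>L \<B> = 0\<close>, and every term of the Douglas
  curvature is built naturally from \<open>\<B>\<close>, its trace, \<open>\<nabla>\<^sup>v\<close> and \<open>\<delta>\<close>.

  The complete lift, given by a definite description, is obtained by correcting \<open>\<lbrakk>\<eta>\<^sup>V, S\<rbrakk>\<close> by a
  vertical section. Its uniqueness uses the splitting into vertical and horizontal sections: a
  section of the prolongation with zero first component is vertical, and a vertical section is
  determined by its action on fibrewise linear functions.
\<close>

section \<open>Smooth functions on finite-dimensional spaces\<close>

text \<open>Several objects are fixed by choice or description: \<open>nabla_v\<close> picks a lift,
  \<open>lie_dual\<close> and \<open>imap_inv\<close> are solutions of conditions, the trace uses
  some trivialization and some basis. Each must be freed of its choice before it can be computed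
  with; evaluation on dual sections turns all such claims into claims about real functions.
  Linearity is available only over globally defined functions. Local frames are therefore cut off by
  a bump function so that \<open>f id = \<Sum> \<theta>\<^sub>b \<otimes> e\<^sub>b\<close> holds
  everywhere; claims are proved after multiplication by f and read at a point where f = 1. Tangent
  vectors are abstract derivations and are never expanded in coordinates. In place of such an
  expansion, the vertical map of the connection, with kernel the image of H, gives exactness of the
  sequence of i and j in the middle.\<close>

definition onb :: "'a::finite_dim_inner set" where
  "onb = (SOME B. finite B \<and> (\<forall>b\<in>B. \<forall>c\<in>B. b \<bullet> c = (if b = c then 1 else 0)) \<and> span B = UNIV)"

text \<open>\<open>basis_orthogonal\<close> yields an orthogonal spanning set that may contain 0;
  removing 0 and normalising keeps the span. In dimension 0 the result is the empty set.\<close>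

lemma onb_props:
  "finite (onb :: 'a::finite_dim_inner set) \<and>
   (\<forall>b\<in>onb. \<forall>c\<in>(onb :: 'a set). b \<bullet> c = (if b = c then 1 else 0)) \<and> span (onb :: 'a set) = UNIV"
proof -
  obtain A :: "'a set" where A: "finite A" "span A = UNIV" using finite_spanning by blast
  obtain C where C: "finite C" "span C = span A" "pairwise orthogonal C"
    using basis_orthogonal[OF A(1)] by blast
  let ?B = "(\<lambda>b. b /\<^sub>R norm b) ` (C - {0})"
  have "span ?B = UNIV"
  proof -
    have "x \<in> span ?B" if "x \<in> C" for x
    proof (cases "x = 0")
      case False
      then have "norm x *\<^sub>R (x /\<^sub>R norm x) \<in> span ?B"
        using that by (intro span_scale span_base) auto
      then show ?thesis using False by simp
    qed (simp add: span_zero)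
    then have "span C \<subseteq> span ?B" by (intro span_minimal) auto
    then show ?thesis using C A by auto
  qed
  moreover have "b \<bullet> c = (if b = c then 1 else 0)" if bc: "b \<in> ?B" "c \<in> ?B" for b c
  proof -
    obtain x y where x: "x \<in> C" "x \<noteq> 0" "b = x /\<^sub>R norm x" and y: "y \<in> C" "y \<noteq> 0" "c = y /\<^sub>R norm y"
      using bc by auto
    show ?thesis
    proof (cases "x = y")
      case True
      then show ?thesis using x y by (simp add: dot_square_norm power2_eq_square field_simps)
    next
      case False
      then have o: "x \<bullet> y = 0" using C(3) x y by (auto simp: pairwise_def orthogonal_def)
      moreover have "b \<noteq> c"
      proof
        assume "b = c"
        then have "b \<bullet> b = b \<bullet> c" by simp
        then show False using x y o by simp
      qed
      ultimately show ?thesis using x y by simp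
    qed
  qed
  moreover have "finite ?B" using C(1) by simp
  ultimately have "\<exists>B :: 'a set. finite B \<and>
      (\<forall>b\<in>B. \<forall>c\<in>B. b \<bullet> c = (if b = c then 1 else 0)) \<and> span B = UNIV"
    by (intro exI[of _ ?B] conjI ballI) assumption+
  then show ?thesis unfolding onb_def by (rule someI_ex)
qed

lemma finite_onb [simp, intro]: "finite onb"
  and inner_onb: "b \<in> onb \<Longrightarrow> c \<in> onb \<Longrightarrow> b \<bullet> c = (if b = c then 1 else 0)"
  and span_onb [simp]: "span onb = UNIV"
  using onb_props by blast+

lemma onb_expansion: "(\<Sum>b\<in>onb. (x \<bullet> b) *\<^sub>R b) = (x :: 'a::finite_dim_inner)"
proof -
  obtain r where r: "x = (\<Sum>b\<in>onb. r b *\<^sub>R b)"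
    using span_finite[of "onb :: 'a set"] by auto
  have "x \<bullet> c = r c" if "c \<in> onb" for c
    using that by (simp add: r inner_sum_left inner_onb if_distrib sum.delta cong: if_cong)
  then show ?thesis using r by simp
qed

lemma linear_onb_expansion:
  "linear f \<Longrightarrow> f x = (\<Sum>b\<in>onb. (x \<bullet> b) *\<^sub>R f b)" for x :: "'a::finite_dim_inner"
  by (subst (1) onb_expansion[of x, symmetric]) (simp add: linear_sum linear_scale)

text \<open>A closed ball lies in the set of combinations of \<open>onb\<close> with bounded
  coefficients, and that set is compact by induction on the basis: each vector contributes one
  interval factor. The result makes the supports of bump functions closed.\<close>

lemma compact_finite_dim_cball: "compact (cball (x::'a::finite_dim_inner) r)"
proof -
  have comp: "finite B \<Longrightarrow>
      compact {\<Sum>b\<in>B. c b *\<^sub>R b | c. \<forall>b\<in>B. \<bar>c b\<bar> \<le> R}" (is "_ \<Longrightarrow> compact (?K B)")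
    for B :: "'a set" and R :: real
  proof (induction B rule: finite_induct)
    case (insert a B)
    have "?K (insert a B) = (\<lambda>(y, t). y + t *\<^sub>R a) ` (?K B \<times> {-R..R})" (is "?L = ?M")
    proof
      show "?L \<subseteq> ?M"
      proof
        fix z assume "z \<in> ?L"
        then obtain c where c: "z = (\<Sum>b\<in>insert a B. c b *\<^sub>R b)" "\<forall>b\<in>insert a B. \<bar>c b\<bar> \<le> R"
          by blast
        have "(\<Sum>b\<in>B. c b *\<^sub>R b) \<in> ?K B" "c a \<in> {-R..R}" using c(2) by (auto simp: abs_le_iff)
        moreover have "z = (\<Sum>b\<in>B. c b *\<^sub>R b) + c a *\<^sub>R a"
          using c(1) insert by (simp add: add.commute)
        ultimately show "z \<in> ?M" by force
      qed
      show "?M \<subseteq> ?L"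
      proof clarsimp
        fix c t assume c: "\<forall>b\<in>B. \<bar>c b\<bar> \<le> R" "- R \<le> t" "t \<le> R"
        have eq: "(\<Sum>b\<in>insert a B. (c(a := t)) b *\<^sub>R b) = (\<Sum>b\<in>B. c b *\<^sub>R b) + t *\<^sub>R a"
          using insert(1,2) by (simp add: sum.insert add.commute) (rule sum.cong; auto)
        show "\<exists>ca. (\<Sum>b\<in>B. c b *\<^sub>R b) + t *\<^sub>R a = (\<Sum>b\<in>insert a B. ca b *\<^sub>R b) \<and>
            \<bar>ca a\<bar> \<le> R \<and> (\<forall>b\<in>B. \<bar>ca b\<bar> \<le> R)"
          using c insert(2) by (intro exI[of _ "c(a := t)"]) (auto simp: eq[symmetric])
      qed
    qed
    moreover have "compact ?M"
      using insert by (intro compact_continuous_image compact_Times)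
        (auto intro!: continuous_intros simp: split_def)
    ultimately show ?case by simp
  qed simp
  have "cball x r \<subseteq> {\<Sum>b\<in>onb. c b *\<^sub>R b | c. \<forall>b\<in>onb. \<bar>c b\<bar> \<le> norm x + \<bar>r\<bar>}"
  proof
    fix y assume "y \<in> cball x r"
    then have "norm y \<le> norm x + \<bar>r\<bar>"
      using norm_triangle_ineq2[of y x] by (simp add: dist_norm norm_minus_commute)
    moreover have "\<bar>y \<bullet> b\<bar> \<le> norm y" if "b \<in> onb" for b
      using Cauchy_Schwarz_ineq2[of y b] inner_onb[OF that that] by (simp add: norm_eq_sqrt_inner)
    ultimately have "y = (\<Sum>b\<in>onb. (y \<bullet> b) *\<^sub>R b) \<and> (\<forall>b\<in>onb. \<bar>y \<bullet> b\<bar> \<le> norm x + \<bar>r\<bar>)"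
      by (force simp: onb_expansion)
    then show "y \<in> {\<Sum>b\<in>onb. c b *\<^sub>R b | c. \<forall>b\<in>onb. \<bar>c b\<bar> \<le> norm x + \<bar>r\<bar>}"
      by (auto intro!: exI[of _ "\<lambda>b. y \<bullet> b"])
  qed
  from closed_Int_compact[OF closed_cball comp[OF finite_onb, of "norm x + \<bar>r\<bar>"], of x r] this
  show ?thesis by (simp add: Int_absorb2)
qed

section \<open>Calculus of k times continuously differentiable maps\<close>

abbreviation fderiv where
  "fderiv f x \<equiv> frechet_derivative f (at x)"

lemma Ck_on_cong:
  assumes "open U" "\<And>x. x \<in> U \<Longrightarrow> f x = g x" "Ck_on k U f"
  shows "Ck_on k U g"
  using assms(2,3)
proof (induction k arbitrary: f g)
  case 0
  then show ?case using continuous_on_cong by force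
next
  case (Suc k)
  have d: "(g has_derivative fderiv f x) (at x)" if "x \<in> U" for x
    using Suc.prems that assms(1)
    by (auto simp: frechet_derivative_works intro: has_derivative_transform_within_open)
  have "Ck_on k U (\<lambda>x. fderiv g x v)" for v
  proof (rule Suc.IH)
    show "fderiv f x v = fderiv g x v" if "x \<in> U" for x
      using frechet_derivative_at[OF d[OF that]] by simp
    show "Ck_on k U (\<lambda>x. fderiv f x v)" using Suc.prems(2) by simp
  qed
  then show ?case using d by (auto simp: differentiable_def)
qed

text \<open>Induction steps exhibit a derivative in closed form; uniqueness of the derivative
  identifies it with \<open>frechet_derivative\<close>.\<close>

lemma Ck_on_Suc_intro:
  assumes "open U" "\<And>x. x \<in> U \<Longrightarrow> (f has_derivative f' x) (at x)"
    "\<And>v. Ck_on k U (\<lambda>x. f' x v)"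
  shows "Ck_on (Suc k) U f"
proof -
  have "fderiv f x = f' x" if "x \<in> U" for x
    using frechet_derivative_at[OF assms(2)[OF that]] by simp
  then have "Ck_on k U (\<lambda>x. fderiv f x v)" for v
    by (intro Ck_on_cong[OF assms(1) _ assms(3)[of v]]) simp
  then show ?thesis using assms(2) by (auto simp: differentiable_def)
qed

lemma Ck_on_Suc_elim:
  assumes "Ck_on (Suc k) U f" "x \<in> U"
  shows "(f has_derivative fderiv f x) (at x)"
  using assms by (simp add: frechet_derivative_works)

lemma Ck_on_mono: "Ck_on (Suc k) U f \<Longrightarrow> Ck_on k U f"
proof (induction k arbitrary: f)
  case 0
  then show ?case
    by (auto intro!: continuous_at_imp_continuous_on differentiable_imp_continuous_within)
qed simp

lemma Ck_on_subset: "Ck_on k U f \<Longrightarrow> W \<subseteq> U \<Longrightarrow> Ck_on k W f"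
  by (induction k arbitrary: f) (auto intro: continuous_on_subset)

text \<open>Differentiability at a point refers to full neighbourhoods, so it passes directly from
  \<open>U \<inter> W\<close> to U; only continuity at order 0 has to compare two restricted
  filters.\<close>

lemma Ck_on_local:
  assumes "\<And>x. x \<in> U \<Longrightarrow> \<exists>W. open W \<and> x \<in> W \<and> Ck_on k (U \<inter> W) f"
  shows "Ck_on k U f"
  using assms
proof (induction k arbitrary: f)
  case 0
  show ?case
  proof (clarsimp simp: continuous_on_eq_continuous_within)
    fix x assume x: "x \<in> U"
    then obtain W where W: "open W" "x \<in> W" "continuous_on (U \<inter> W) f" using 0 by auto
    then have "continuous (at x within U \<inter> W) f" using x by (simp add: continuous_on_eq_continuous_within)
    moreover have "at x within U \<inter> W = at x within U"
      using W by (intro at_within_nhd[of _ W]) auto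
    ultimately show "continuous (at x within U) f" by simp
  qed
next
  case (Suc k)
  show ?case
  proof (simp, intro conjI ballI allI)
    fix x assume "x \<in> U"
    then show "f differentiable at x" using Suc.prems[of x] by auto
  next
    fix v show "Ck_on k U (\<lambda>x. fderiv f x v)"
      using Suc.prems by (intro Suc.IH) fastforce
  qed
qed

lemma Ck_on_const: "open U \<Longrightarrow> Ck_on k U (\<lambda>x. c)"
  by (induction k arbitrary: c) (auto)

lemma Ck_on_bounded_linear:
  assumes "open U" "bounded_linear L" "Ck_on k U f"
  shows "Ck_on k U (\<lambda>x. L (f x))"
  using assms(3)
proof (induction k arbitrary: f)
  case 0
  then show ?case using bounded_linear.continuous_on[OF assms(2)] by auto
next
  case (Suc k)
  show ?case
  proof (rule Ck_on_Suc_intro[OF assms(1)])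
    show "((\<lambda>x. L (f x)) has_derivative (\<lambda>v. L (fderiv f x v))) (at x)" if "x \<in> U" for x
      by (rule bounded_linear.has_derivative[OF assms(2) Ck_on_Suc_elim[OF Suc.prems that]])
    show "Ck_on k U (\<lambda>x. L (fderiv f x v))" for v
      using Suc by simp
  qed
qed

lemma Ck_on_linear: "open U \<Longrightarrow> bounded_linear L \<Longrightarrow> Ck_on k U L"
proof (induction k)
  case 0
  then show ?case using linear_continuous_on by auto
next
  case (Suc k)
  then show ?case
    by (intro Ck_on_Suc_intro[where f' = "\<lambda>x. L"])
       (auto intro: Ck_on_const bounded_linear_imp_has_derivative)
qed

lemma Ck_on_add:
  assumes "open U" "Ck_on k U f" "Ck_on k U g"
  shows "Ck_on k U (\<lambda>x. f x + g x)"
  using assms(2,3)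
proof (induction k arbitrary: f g)
  case (Suc k)
  show ?case
  proof (rule Ck_on_Suc_intro[OF assms(1)])
    show "((\<lambda>x. f x + g x) has_derivative
        (\<lambda>v. fderiv f x v + fderiv g x v)) (at x)" if "x \<in> U" for x
      using that Suc.prems by (intro has_derivative_add Ck_on_Suc_elim)
    show "Ck_on k U (\<lambda>x. fderiv f x v + fderiv g x v)" for v
      using Suc by simp
  qed
qed (auto intro: continuous_on_add)

lemma Ck_on_sum:
  assumes "open U" "finite A" "\<And>i. i \<in> A \<Longrightarrow> Ck_on k U (f i)"
  shows "Ck_on k U (\<lambda>x. \<Sum>i\<in>A. f i x)"
  using assms(2,3) by (induction A rule: finite_induct) (auto intro: Ck_on_const Ck_on_add assms(1))

lemma Ck_on_bilinear:
  assumes "open U" "bounded_bilinear B" "Ck_on k U f" "Ck_on k U g"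
  shows "Ck_on k U (\<lambda>x. B (f x) (g x))"
  using assms(3,4)
proof (induction k arbitrary: f g)
  case 0
  then show ?case using bounded_bilinear.continuous_on[OF assms(2)] by auto
next
  case (Suc k)
  show ?case
  proof (rule Ck_on_Suc_intro[OF assms(1)])
    show "((\<lambda>x. B (f x) (g x)) has_derivative
        (\<lambda>v. B (f x) (fderiv g x v) + B (fderiv f x v) (g x))) (at x)"
      if "x \<in> U" for x
      using that Suc.prems by (intro bounded_bilinear.FDERIV[OF assms(2)] Ck_on_Suc_elim)
    show "Ck_on k U (\<lambda>x. B (f x) (fderiv g x v) + B (fderiv f x v) (g x))" for v
      using Suc Suc.prems[THEN Ck_on_mono] by (intro Ck_on_add assms(1) Suc.IH) auto
  qed
qed

text \<open>In the chain rule both the base point and the direction of the derivative of f depend on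
  x, whereas \<open>Ck_on\<close> controls fixed directions. Expanding the direction in
  \<open>onb\<close> leaves finitely many fixed directions with scalar coefficients; hence the
  finite-dimensional middle space.\<close>

lemma Ck_on_compose:
  fixes g :: "'a::real_normed_vector \<Rightarrow> 'b::finite_dim_inner"
  assumes "open U" "Ck_on k W f" "Ck_on k U g" "g ` U \<subseteq> W"
  shows "Ck_on k U (\<lambda>x. f (g x))"
  using assms(2,3)
proof (induction k arbitrary: f)
  case 0
  then show ?case using continuous_on_compose2[of W f U g] assms(4) by simp
next
  case (Suc k)
  let ?f' = "\<lambda>y. fderiv f y" and ?g' = "\<lambda>x. fderiv g x"
  show ?case
  proof (rule Ck_on_Suc_intro[OF assms(1)])
    fix x assume x: "x \<in> U"
    then have fd: "(f has_derivative ?f' (g x)) (at (g x))"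
      using Ck_on_Suc_elim[OF Suc.prems(1)] assms(4) by blast
    have "((f \<circ> g) has_derivative (?f' (g x) \<circ> ?g' x)) (at x)"
      by (rule diff_chain_at[OF Ck_on_Suc_elim[OF Suc.prems(2) x] fd])
    moreover have "?f' (g x) \<circ> ?g' x = (\<lambda>v. \<Sum>b\<in>onb. (?g' x v \<bullet> b) *\<^sub>R ?f' (g x) b)"
      unfolding o_def by (intro ext linear_onb_expansion has_derivative_linear[OF fd])
    ultimately show "((\<lambda>x. f (g x)) has_derivative (\<lambda>v. \<Sum>b\<in>onb. (?g' x v \<bullet> b) *\<^sub>R ?f' (g x) b)) (at x)"
      by (simp add: o_def)
  next
    fix v
    have "Ck_on k U (\<lambda>x. ?f' (g x) b)" for b
      using Suc.prems(1) Ck_on_mono[OF Suc.prems(2)] by (intro Suc.IH) simp_all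
    moreover have "Ck_on k U (\<lambda>x. ?g' x v \<bullet> b)" for b
      using Suc.prems(2) by (intro Ck_on_bounded_linear[OF assms(1) bounded_linear_inner_left]) auto
    ultimately show "Ck_on k U (\<lambda>x. \<Sum>b\<in>onb. (?g' x v \<bullet> b) *\<^sub>R ?f' (g x) b)"
      by (intro Ck_on_sum Ck_on_bilinear[OF _ bounded_bilinear_scaleR] assms(1)) auto
  qed
qed

text \<open>The derivative of \<open>inverse\<close> is a constant times
  \<open>inverse x * inverse x\<close>, so order k gives order k + 1.\<close>

lemma Ck_on_inverse: "Ck_on k (- {0 :: real}) inverse"
proof (induction k)
  case 0
  show ?case by (auto intro!: continuous_intros)
next
  case (Suc k)
  have op: "open (- {0 :: real})" by auto
  show ?case
  proof (rule Ck_on_Suc_intro[OF op])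
    show "(inverse has_derivative (\<lambda>h. - (inverse x * h * inverse x))) (at x)" if "x \<in> - {0}" for x :: real
      using that by (intro has_derivative_inverse') auto
    fix v :: real
    have *: "Ck_on k (- {0}) (\<lambda>x::real. (- v) * (inverse x * inverse x))"
      by (intro Ck_on_bilinear[OF op bounded_bilinear_mult] Suc Ck_on_const op)
    show "Ck_on k (- {0}) (\<lambda>x. - (inverse x * v * inverse x))"
      by (rule Ck_on_cong[OF op _ *]) auto
  qed
qed

section \<open>Closure properties of smooth maps\<close>

lemma smooth_on_subset: "smooth_on U f \<Longrightarrow> W \<subseteq> U \<Longrightarrow> smooth_on W f"
  by (auto simp: smooth_on_def intro: Ck_on_subset)

lemma smooth_on_cong: "open U \<Longrightarrow> (\<And>x. x \<in> U \<Longrightarrow> f x = g x) \<Longrightarrow> smooth_on U f \<Longrightarrow> smooth_on U g"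
  by (auto simp: smooth_on_def intro: Ck_on_cong)

lemma smooth_on_local:
  "(\<And>x. x \<in> U \<Longrightarrow> \<exists>W. open W \<and> x \<in> W \<and> smooth_on (U \<inter> W) f) \<Longrightarrow> smooth_on U f"
  unfolding smooth_on_def by (meson Ck_on_local)

lemma smooth_on_continuous_on: "smooth_on U f \<Longrightarrow> continuous_on U f"
  unfolding smooth_on_def by (metis Ck_on.simps(1))

lemma smooth_on_const: "open U \<Longrightarrow> smooth_on U (\<lambda>x. c)"
  by (simp add: smooth_on_def Ck_on_const)

lemma smooth_on_linear: "open U \<Longrightarrow> bounded_linear L \<Longrightarrow> smooth_on U L"
  by (simp add: smooth_on_def Ck_on_linear)

lemma smooth_on_bounded_linear:
  "open U \<Longrightarrow> bounded_linear L \<Longrightarrow> smooth_on U f \<Longrightarrow> smooth_on U (\<lambda>x. L (f x))"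
  by (simp add: smooth_on_def Ck_on_bounded_linear)

lemma smooth_on_add:
  "open U \<Longrightarrow> smooth_on U f \<Longrightarrow> smooth_on U g \<Longrightarrow> smooth_on U (\<lambda>x. f x + g x)"
  by (simp add: smooth_on_def Ck_on_add)

lemma smooth_on_sum:
  "open U \<Longrightarrow> finite A \<Longrightarrow> (\<And>i. i \<in> A \<Longrightarrow> smooth_on U (f i)) \<Longrightarrow> smooth_on U (\<lambda>x. \<Sum>i\<in>A. f i x)"
  by (simp add: smooth_on_def Ck_on_sum)

lemma smooth_on_mult:
  "open U \<Longrightarrow> smooth_on U f \<Longrightarrow> smooth_on U g \<Longrightarrow> smooth_on U (\<lambda>x. f x * g x :: real)"
  by (simp add: smooth_on_def Ck_on_bilinear[OF _ bounded_bilinear_mult])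

lemma smooth_on_scaleR:
  "open U \<Longrightarrow> smooth_on U f \<Longrightarrow> smooth_on U g \<Longrightarrow> smooth_on U (\<lambda>x. f x *\<^sub>R g x)"
  by (simp add: smooth_on_def Ck_on_bilinear[OF _ bounded_bilinear_scaleR])

lemma smooth_on_compose:
  fixes g :: "'a::real_normed_vector \<Rightarrow> 'b::finite_dim_inner"
  shows "open U \<Longrightarrow> smooth_on W f \<Longrightarrow> smooth_on U g \<Longrightarrow> g ` U \<subseteq> W \<Longrightarrow> smooth_on U (\<lambda>x. f (g x))"
  by (auto simp: smooth_on_def intro: Ck_on_compose)

lemma smooth_on_Pair:
  fixes f :: "'a::real_normed_vector \<Rightarrow> 'b::real_normed_vector"
    and g :: "'a \<Rightarrow> 'c::real_normed_vector"
  assumes "open U" "smooth_on U f" "smooth_on U g"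
  shows "smooth_on U (\<lambda>x. (f x, g x))"
proof -
  have l: "bounded_linear (\<lambda>y::'b. (y, 0::'c))" "bounded_linear (\<lambda>z::'c. (0::'b, z))"
    by (simp_all add: bounded_linear_Pair bounded_linear_zero bounded_linear_ident)
  have "smooth_on U (\<lambda>x. (f x, 0) + (0, g x))"
    by (rule smooth_on_add[OF assms(1) smooth_on_bounded_linear[OF assms(1) l(1) assms(2)]
          smooth_on_bounded_linear[OF assms(1) l(2) assms(3)]])
  then show ?thesis by simp
qed

lemma smooth_on_inverse:
  assumes "open U" "smooth_on U f" "\<And>x. x \<in> U \<Longrightarrow> f x \<noteq> (0::real)"
  shows "smooth_on U (\<lambda>x. inverse (f x))"
proof -
  have "smooth_on (- {0::real}) inverse" by (simp add: smooth_on_def Ck_on_inverse)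
  then show ?thesis using assms by (intro smooth_on_compose[of U "- {0}" inverse f]) auto
qed

lemma smooth_on_frechet:
  assumes "open U" "smooth_on U f"
  shows "smooth_on U (\<lambda>x. fderiv f x v)"
  using assms(2) unfolding smooth_on_def by (metis Ck_on.simps(2))

lemma smooth_on_has_derivative:
  "smooth_on U f \<Longrightarrow> x \<in> U \<Longrightarrow> (f has_derivative fderiv f x) (at x)"
  unfolding smooth_on_def by (rule Ck_on_Suc_elim) auto

text \<open>
  The functions \<open>p(1/x) exp(-1/x)\<close> on the positive axis, extended by 0, are closed under
  differentiation, which makes \<open>exp(-1/x)\<close> smooth at the origin.
\<close>

definition bump_fun :: "real poly \<Rightarrow> real \<Rightarrow> real" where
  "bump_fun p x = (if x > 0 then poly p (inverse x) * exp (- inverse x) else 0)"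

text \<open>Put y = 1/x. Since dy/dx = -y^2, the derivative of p(y) exp(-y) is y^2 (p - p')(y)
  exp(-y), and \<open>[:0, 0, 1:]\<close> is the polynomial y^2.\<close>

lemma bump_fun_deriv:
  "(bump_fun p has_real_derivative bump_fun ([:0, 0, 1:] * (p - pderiv p)) x) (at x)"
proof -
  consider "x > 0" | "x < 0" | "x = 0" by linarith
  then show ?thesis
  proof cases
    case 1
    have "((\<lambda>x. poly p (inverse x) * exp (- inverse x)) has_real_derivative
        bump_fun ([:0, 0, 1:] * (p - pderiv p)) x) (at x)"
      using 1 by (auto intro!: derivative_eq_intros simp: bump_fun_def field_simps power2_eq_square)
    then show ?thesis
      by (rule has_field_derivative_transform_within_open[of _ _ _ "{0<..}"])
         (use 1 in \<open>auto simp: bump_fun_def\<close>)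
  next
    case 2
    have "((\<lambda>x. 0) has_real_derivative bump_fun ([:0, 0, 1:] * (p - pderiv p)) x) (at x)"
      using 2 by (auto simp: bump_fun_def)
    then show ?thesis
      by (rule has_field_derivative_transform_within_open[of _ _ _ "{..<0}"])
         (use 2 in \<open>auto simp: bump_fun_def\<close>)
  next
    case 3
    \<comment> \<open>At the origin the right difference quotient is y p(y) exp(-y) with y = 1/x
      tending to infinity, hence the polynomial \<open>[:0, 1:] * p\<close> below; the left quotient
      vanishes identically.\<close>
    have "((\<lambda>y. \<Sum>i\<le>degree q. coeff q i * (y ^ i / exp y)) \<longlongrightarrow> 0) at_top" for q :: "real poly"
      by (intro tendsto_null_sum tendsto_mult_right_zero tendsto_power_div_exp_0)
    from this[of "[:0, 1:] * p"] have "((\<lambda>y. poly ([:0, 1:] * p) y / exp y) \<longlongrightarrow> 0) at_top"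
      by (simp only: poly_altdef sum_divide_distrib times_divide_eq_right)
    then have "((\<lambda>y. y * poly p y * exp (- y)) \<longlongrightarrow> 0) at_top"
      by (simp add: exp_minus field_simps)
    then have "((\<lambda>x. inverse x * poly p (inverse x) * exp (- inverse x)) \<longlongrightarrow> 0) (at_right 0)"
      by (rule filterlim_compose[OF _ filterlim_inverse_at_top_right])
    then have "((\<lambda>x. bump_fun p x / x) \<longlongrightarrow> 0) (at_right 0)"
      by (rule Lim_transform_eventually)
         (auto simp: bump_fun_def eventually_at_filter field_simps)
    moreover have "((\<lambda>x. bump_fun p x / x) \<longlongrightarrow> 0) (at_left 0)"
      by (rule Lim_transform_eventually[OF tendsto_const])
         (auto simp: bump_fun_def eventually_at_filter)
    ultimately have "((\<lambda>x. bump_fun p x / x) \<longlongrightarrow> 0) (at 0)"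
      by (simp add: filterlim_at_split)
    then show ?thesis using 3 by (simp add: has_field_derivative_iff bump_fun_def)
  qed
qed

lemma Ck_on_bump_fun: "Ck_on k UNIV (bump_fun p)"
proof (induction k arbitrary: p)
  case 0
  show ?case using bump_fun_deriv by (auto intro!: DERIV_continuous_on)
next
  case (Suc k)
  show ?case
  proof (rule Ck_on_Suc_intro)
    show "(bump_fun p has_derivative (\<lambda>h. bump_fun ([:0, 0, 1:] * (p - pderiv p)) x * h)) (at x)" for x
      using bump_fun_deriv[of p x] by (simp add: has_field_derivative_def)
    show "Ck_on k UNIV (\<lambda>x. bump_fun ([:0, 0, 1:] * (p - pderiv p)) x * v)" for v
      by (intro Ck_on_bilinear[OF _ bounded_bilinear_mult] Suc Ck_on_const) auto
  qed auto
qed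

lemma smooth_cutoff:
  assumes "r > 0"
  obtains h :: "'a::finite_dim_inner \<Rightarrow> real"
  where "smooth_on UNIV h" "h x = 1" "\<And>y. y \<notin> cball x r \<Longrightarrow> h y = 0"
proof
  let ?q = "\<lambda>y. r * r - (y - x) \<bullet> (y - x)"
  \<comment> \<open>At the centre \<open>bump_fun 1\<close> equals exp(-1/r^2), which the constant
    factor normalises to 1; \<open>?q y\<close> is positive exactly when y is at distance less than
    r from x.\<close>
  let ?h = "\<lambda>y. exp (inverse (r * r)) * bump_fun 1 (?q y)"
  have l: "smooth_on UNIV (\<lambda>y. y - x)"
    using smooth_on_add[OF open_UNIV smooth_on_linear[OF open_UNIV bounded_linear_ident]
        smooth_on_const[OF open_UNIV], of "- x"] by simp
  have "smooth_on UNIV (\<lambda>y. (y - x) \<bullet> (y - x))"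
    using l by (simp add: smooth_on_def Ck_on_bilinear[OF _ bounded_bilinear_inner])
  then have "smooth_on UNIV (\<lambda>y. r * r + (-1) *\<^sub>R ((y - x) \<bullet> (y - x)))"
    by (intro smooth_on_add smooth_on_scaleR smooth_on_const) auto
  then have "smooth_on UNIV ?q" by simp
  then have "smooth_on UNIV (\<lambda>y. bump_fun 1 (?q y))"
    by (intro smooth_on_compose[of UNIV UNIV "bump_fun 1" ?q])
       (auto simp: smooth_on_def Ck_on_bump_fun)
  then show "smooth_on UNIV ?h" by (intro smooth_on_mult smooth_on_const) auto
  show "?h x = 1" using assms by (simp add: bump_fun_def flip: exp_add)
  show "?h y = 0" if "y \<notin> cball x r" for y
  proof -
    have "r < norm (y - x)" using that by (simp add: dist_norm norm_minus_commute)
    then have "r * r \<le> norm (y - x) * norm (y - x)" using assms by (intro mult_mono) auto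
    then show ?thesis by (simp add: bump_fun_def dot_square_norm power2_eq_square)
  qed
qed

section \<open>Smooth functions and maps on manifolds\<close>

lemma atlas_chart:
  assumes "smooth_atlas A" "(U, \<phi>) \<in> A"
  shows "open U" "open (\<phi> ` U)" "continuous_on U \<phi>" "continuous_on (\<phi> ` U) (inv_into U \<phi>)"
    "\<And>x. x \<in> U \<Longrightarrow> inv_into U \<phi> (\<phi> x) = x"
proof -
  have "homeomorphism U (\<phi> ` U) \<phi> (inv_into U \<phi>)" "open U \<and> open (\<phi> ` U)"
    using assms unfolding smooth_atlas_def by fast+
  then show "open U" "open (\<phi> ` U)" "continuous_on U \<phi>" "continuous_on (\<phi> ` U) (inv_into U \<phi>)"
    "\<And>x. x \<in> U \<Longrightarrow> inv_into U \<phi> (\<phi> x) = x"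
    by (auto simp: homeomorphism_def)
qed

lemma atlas_cover:
  assumes "smooth_atlas A"
  obtains U \<phi> where "(U, \<phi>) \<in> A" "x \<in> U"
  using assms unfolding smooth_atlas_def by fast

lemma atlas_transition:
  "smooth_atlas A \<Longrightarrow> (U, \<phi>) \<in> A \<Longrightarrow> (V, \<psi>) \<in> A \<Longrightarrow> smooth_on (\<phi> ` (U \<inter> V)) (\<psi> \<circ> inv_into U \<phi>)"
  unfolding smooth_atlas_def by fast

lemma atlas_open_image:
  assumes "smooth_atlas A" "(U, \<phi>) \<in> A" "open W" "W \<subseteq> U"
  shows "open (\<phi> ` W)"
proof -
  note c = atlas_chart[OF assms(1,2)]
  have "\<phi> ` W = \<phi> ` U \<inter> inv_into U \<phi> -` W" using c(5) assms(4) by force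
  then show ?thesis using continuous_open_preimage[OF c(4,2) assms(3)] by simp
qed

lemma Cinf_chart:
  "f \<in> Cinf A \<Longrightarrow> (U, \<phi>) \<in> A \<Longrightarrow> smooth_on (\<phi> ` U) (f \<circ> inv_into U \<phi>)"
  unfolding Cinf_def by fast

definition smooth_near where
  "smooth_near A f x \<longleftrightarrow> (\<exists>U \<phi> W. (U, \<phi>) \<in> A \<and> open W \<and> x \<in> W \<and> W \<subseteq> U \<and>
    smooth_on (\<phi> ` W) (f \<circ> inv_into U \<phi>))"

lemma smooth_nearI:
  "(U, \<phi>) \<in> A \<Longrightarrow> open W \<Longrightarrow> x \<in> W \<Longrightarrow> W \<subseteq> U \<Longrightarrow> smooth_on (\<phi> ` W) (f \<circ> inv_into U \<phi>) \<Longrightarrow> smooth_near A f x"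
  unfolding smooth_near_def by blast

text \<open>Transition maps are smooth, so one suitable chart near x transfers smoothness to all
  charts. This permits a different chart on each piece when a function is extended by zero.\<close>

lemma Cinf_local:
  assumes A: "smooth_atlas A" and loc: "\<And>x. smooth_near A f x"
  shows "f \<in> Cinf A"
proof -
  have "smooth_on (\<psi> ` V) (f \<circ> inv_into V \<psi>)" if V: "(V, \<psi>) \<in> A" for V \<psi>
  proof (rule smooth_on_local)
    fix y assume "y \<in> \<psi> ` V"
    then obtain x where x: "x \<in> V" "y = \<psi> x" by blast
    obtain U \<phi> W where U: "(U, \<phi>) \<in> A" "open W" "x \<in> W" "W \<subseteq> U"
      "smooth_on (\<phi> ` W) (f \<circ> inv_into U \<phi>)" using loc unfolding smooth_near_def by blast
    note cU = atlas_chart[OF A U(1)] and cV = atlas_chart[OF A V]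
    let ?N = "\<psi> ` (V \<inter> W)"
    have op: "open ?N" using atlas_open_image[OF A V] U(2) cV(1) by blast
    have "smooth_on ?N (\<phi> \<circ> inv_into V \<psi>)"
      by (rule smooth_on_subset[OF atlas_transition[OF A V U(1)]]) (use U in auto)
    then have "smooth_on ?N (\<lambda>z. (f \<circ> inv_into U \<phi>) ((\<phi> \<circ> inv_into V \<psi>) z))"
      by (rule smooth_on_compose[OF op U(5)]) (auto simp: cV(5))
    then have "smooth_on ?N (f \<circ> inv_into V \<psi>)"
      by (rule smooth_on_cong[OF op, rotated]) (use U cU(5) cV(5) in auto)
    then show "\<exists>N. open N \<and> y \<in> N \<and> smooth_on (\<psi> ` V \<inter> N) (f \<circ> inv_into V \<psi>)"
      using op x U(3) by (intro exI[of _ ?N]) (auto intro: smooth_on_subset)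
  qed
  then show ?thesis unfolding Cinf_def by auto
qed

lemma smooth_map_chart:
  assumes "smooth_map A B F" "(U, \<phi>) \<in> A" "(V, \<psi>) \<in> B" "W \<subseteq> U" "F ` W \<subseteq> V"
  shows "smooth_on (\<phi> ` W) (\<psi> \<circ> F \<circ> inv_into U \<phi>)"
proof (rule smooth_on_subset)
  show "smooth_on (\<phi> ` (U \<inter> F -` V)) (\<psi> \<circ> F \<circ> inv_into U \<phi>)"
    using assms unfolding smooth_map_def by fast
  show "\<phi> ` W \<subseteq> \<phi> ` (U \<inter> F -` V)" using assms by (intro image_mono) auto
qed

definition smooth_map_near where
  "smooth_map_near A B F x \<longleftrightarrow> (\<exists>U \<phi> V \<psi> W. (U, \<phi>) \<in> A \<and> (V, \<psi>) \<in> B \<and> open W \<and> x \<in> W \<and>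
    W \<subseteq> U \<and> F ` W \<subseteq> V \<and> smooth_on (\<phi> ` W) (\<psi> \<circ> F \<circ> inv_into U \<phi>))"

lemma smooth_map_nearI:
  "(U, \<phi>) \<in> A \<Longrightarrow> (V, \<psi>) \<in> B \<Longrightarrow> open W \<Longrightarrow> x \<in> W \<Longrightarrow> W \<subseteq> U \<Longrightarrow> F ` W \<subseteq> V \<Longrightarrow>
    smooth_on (\<phi> ` W) (\<psi> \<circ> F \<circ> inv_into U \<phi>) \<Longrightarrow> smooth_map_near A B F x"
  unfolding smooth_map_near_def by blast

lemma smooth_map_nearE:
  assumes A: "smooth_atlas A" and B: "smooth_atlas B" and "smooth_map_near A B F x"
  obtains U \<phi> V \<psi> W where "(U, \<phi>) \<in> A" "(V, \<psi>) \<in> B" "open W" "x \<in> W"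
    "smooth_on (\<phi> ` W) (\<psi> \<circ> F \<circ> inv_into U \<phi>)"
    "\<And>y. y \<in> W \<Longrightarrow> y \<in> U \<and> F y \<in> V \<and> inv_into U \<phi> (\<phi> y) = y \<and> inv_into V \<psi> (\<psi> (F y)) = F y"
proof -
  obtain U \<phi> V \<psi> W where *: "(U, \<phi>) \<in> A" "(V, \<psi>) \<in> B" "open W" "x \<in> W" "W \<subseteq> U" "F ` W \<subseteq> V"
    "smooth_on (\<phi> ` W) (\<psi> \<circ> F \<circ> inv_into U \<phi>)"
    using assms(3) unfolding smooth_map_near_def by blast
  have "y \<in> U \<and> F y \<in> V" if "y \<in> W" for y using *(5,6) that by blast
  then show thesis
    using that[OF *(1-4,7)] atlas_chart(5)[OF A *(1)] atlas_chart(5)[OF B *(2)] by blast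
qed

text \<open>Near x, F is composed of a chart, its smooth local representative and an inverse chart,
  hence continuous. Continuity makes preimages of chart domains open, and then two transition maps
  carry the representative to any pair of charts.\<close>

lemma smooth_map_local:
  assumes A: "smooth_atlas A" and B: "smooth_atlas B" and loc: "\<And>x. smooth_map_near A B F x"
  shows "smooth_map A B F"
  unfolding smooth_map_def
proof (intro conjI)
  have "\<exists>W. open W \<and> x \<in> W \<and> continuous_on W F" for x
  proof -
    obtain U \<phi> V \<psi> W where U: "(U, \<phi>) \<in> A" and V: "(V, \<psi>) \<in> B" and W: "open W" "x \<in> W"
      and s: "smooth_on (\<phi> ` W) (\<psi> \<circ> F \<circ> inv_into U \<phi>)"
      and e: "\<And>y. y \<in> W \<Longrightarrow> y \<in> U \<and> F y \<in> V \<and> inv_into U \<phi> (\<phi> y) = y \<and> inv_into V \<psi> (\<psi> (F y)) = F y"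
      using smooth_map_nearE[OF A B loc] by blast
    note cU = atlas_chart[OF A U] and cV = atlas_chart[OF B V]
    have "continuous_on W (\<lambda>y. (\<psi> \<circ> F \<circ> inv_into U \<phi>) (\<phi> y))"
      by (rule continuous_on_compose2[OF smooth_on_continuous_on[OF s] continuous_on_subset[OF cU(3)]])
         (use e in auto)
    then have "continuous_on W (\<lambda>y. inv_into V \<psi> ((\<psi> \<circ> F \<circ> inv_into U \<phi>) (\<phi> y)))"
      by (rule continuous_on_compose2[OF cV(4)]) (auto simp: e)
    then have "continuous_on W F"
      by (rule continuous_on_eq) (simp add: e)
    then show ?thesis using W by blast
  qed
  then show "continuous_on UNIV F"
    by (metis continuous_at_imp_continuous_on continuous_on_eq_continuous_at)
  show "\<forall>(U', \<phi>')\<in>A. \<forall>(V', \<psi>')\<in>B. smooth_on (\<phi>' ` (U' \<inter> F -` V')) (\<psi>' \<circ> F \<circ> inv_into U' \<phi>')"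
  proof clarify
    fix U' \<phi>' V' \<psi>' assume U': "(U', \<phi>') \<in> A" and V': "(V', \<psi>') \<in> B"
    show "smooth_on (\<phi>' ` (U' \<inter> F -` V')) (\<psi>' \<circ> F \<circ> inv_into U' \<phi>')"
    proof (rule smooth_on_local)
      fix y assume "y \<in> \<phi>' ` (U' \<inter> F -` V')"
      then obtain x where x: "x \<in> U'" "F x \<in> V'" "y = \<phi>' x" by blast
      obtain U \<phi> V \<psi> W where U: "(U, \<phi>) \<in> A" and V: "(V, \<psi>) \<in> B" and W: "open W" "x \<in> W"
        and s: "smooth_on (\<phi> ` W) (\<psi> \<circ> F \<circ> inv_into U \<phi>)"
        and e: "\<And>y. y \<in> W \<Longrightarrow> y \<in> U \<and> F y \<in> V \<and> inv_into U \<phi> (\<phi> y) = y \<and> inv_into V \<psi> (\<psi> (F y)) = F y"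
        using smooth_map_nearE[OF A B loc] by blast
      note cU = atlas_chart[OF A U] and cV = atlas_chart[OF B V]
        and cU' = atlas_chart[OF A U'] and cV' = atlas_chart[OF B V']
      have "continuous_on UNIV F" by fact
      then have "open (F -` V')" using cV'(1) by (simp add: open_vimage)
      then have opW: "open (U' \<inter> F -` V' \<inter> W)" using W(1) cU'(1) by auto
      let ?N = "\<phi>' ` (U' \<inter> F -` V' \<inter> W)"
      have op: "open ?N" using atlas_open_image[OF A U' opW] by blast
      have "smooth_on ?N (\<phi> \<circ> inv_into U' \<phi>')"
        by (rule smooth_on_subset[OF atlas_transition[OF A U' U]]) (use e in auto)
      then have "smooth_on ?N (\<lambda>z. (\<psi> \<circ> F \<circ> inv_into U \<phi>) ((\<phi> \<circ> inv_into U' \<phi>') z))"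
        by (rule smooth_on_compose[OF op s]) (auto simp: cU'(5))
      then have "smooth_on ?N (\<lambda>z. (\<psi>' \<circ> inv_into V \<psi>) ((\<psi> \<circ> F \<circ> inv_into U \<phi>) ((\<phi> \<circ> inv_into U' \<phi>') z)))"
      proof (rule smooth_on_compose[OF op atlas_transition[OF B V V']])
        show "(\<lambda>z. (\<psi> \<circ> F \<circ> inv_into U \<phi>) ((\<phi> \<circ> inv_into U' \<phi>') z)) ` ?N \<subseteq> \<psi> ` (V \<inter> V')"
          by (auto simp: e cU'(5))
      qed
      then have "smooth_on ?N (\<psi>' \<circ> F \<circ> inv_into U' \<phi>')"
        by (rule smooth_on_cong[OF op, rotated]) (auto simp: e cU'(5))
      then show "\<exists>N. open N \<and> y \<in> N \<and> smooth_on (\<phi>' ` (U' \<inter> F -` V') \<inter> N) (\<psi>' \<circ> F \<circ> inv_into U' \<phi>')"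
        using op x W(2) by (intro exI[of _ ?N]) (auto intro: smooth_on_subset)
    qed
  qed
qed

lemma smooth_map_ident: "smooth_atlas A \<Longrightarrow> smooth_map A A (\<lambda>x. x)"
proof (rule smooth_map_local)
  fix x assume A: "smooth_atlas A"
  obtain U \<phi> where U: "(U, \<phi>) \<in> A" "x \<in> U" using atlas_cover[OF A] .
  have "smooth_on (\<phi> ` U) (\<phi> \<circ> (\<lambda>x. x) \<circ> inv_into U \<phi>)"
    using atlas_transition[OF A U(1) U(1)] by (simp add: o_def)
  then show "smooth_map_near A A (\<lambda>x. x) x"
    by (rule smooth_map_nearI[OF U(1) U(1) atlas_chart(1)[OF A U(1)] U(2), rotated 2]) auto
qed

lemma Cinf_compose:
  assumes A: "smooth_atlas A" and B: "smooth_atlas B" and F: "smooth_map A B F" and f: "f \<in> Cinf B"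
  shows "(\<lambda>x. f (F x)) \<in> Cinf A"
proof (rule Cinf_local[OF A])
  fix x
  obtain U \<phi> where U: "(U, \<phi>) \<in> A" "x \<in> U" using atlas_cover[OF A] .
  obtain V \<psi> where V: "(V, \<psi>) \<in> B" "F x \<in> V" using atlas_cover[OF B] .
  note cU = atlas_chart[OF A U(1)] and cV = atlas_chart[OF B V(1)]
  let ?W = "U \<inter> F -` V"
  have "open (F -` V)" using F cV(1) by (simp add: smooth_map_def open_vimage)
  then have W: "open ?W" using cU(1) by auto
  have op: "open (\<phi> ` ?W)" using atlas_open_image[OF A U(1) W] by blast
  have "smooth_on (\<phi> ` ?W) (\<psi> \<circ> F \<circ> inv_into U \<phi>)"
    by (rule smooth_map_chart[OF F U(1) V(1)]) auto
  then have "smooth_on (\<phi> ` ?W) (\<lambda>z. (f \<circ> inv_into V \<psi>) ((\<psi> \<circ> F \<circ> inv_into U \<phi>) z))"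
    by (rule smooth_on_compose[OF op Cinf_chart[OF f V(1)]]) (auto simp: cU(5))
  then have "smooth_on (\<phi> ` ?W) ((\<lambda>x. f (F x)) \<circ> inv_into U \<phi>)"
    by (rule smooth_on_cong[OF op, rotated]) (auto simp: cU(5) cV(5))
  then show "smooth_near A (\<lambda>x. f (F x)) x"
    by (rule smooth_nearI[OF U(1) W, rotated 2]) (use U V in auto)
qed

lemma CinfI: "(\<And>U \<phi>. (U, \<phi>) \<in> A \<Longrightarrow> smooth_on (\<phi> ` U) (f \<circ> inv_into U \<phi>)) \<Longrightarrow> f \<in> Cinf A"
  unfolding Cinf_def by fast

lemma Cinf_const: "smooth_atlas A \<Longrightarrow> (\<lambda>x. c) \<in> Cinf A"
  by (rule CinfI) (simp add: o_def smooth_on_const atlas_chart(2))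

lemma Cinf_add:
  assumes "smooth_atlas A" "f \<in> Cinf A" "g \<in> Cinf A"
  shows "(\<lambda>x. f x + g x) \<in> Cinf A"
proof (rule CinfI)
  fix U \<phi> assume U: "(U, \<phi>) \<in> A"
  show "smooth_on (\<phi> ` U) ((\<lambda>x. f x + g x) \<circ> inv_into U \<phi>)"
    using smooth_on_add[OF atlas_chart(2)[OF assms(1) U] Cinf_chart[OF assms(2) U] Cinf_chart[OF assms(3) U]]
    by (simp add: o_def)
qed

lemma Cinf_mult:
  assumes "smooth_atlas A" "f \<in> Cinf A" "g \<in> Cinf A"
  shows "(\<lambda>x. f x * g x) \<in> Cinf A"
proof (rule CinfI)
  fix U \<phi> assume U: "(U, \<phi>) \<in> A"
  show "smooth_on (\<phi> ` U) ((\<lambda>x. f x * g x) \<circ> inv_into U \<phi>)"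
    using smooth_on_mult[OF atlas_chart(2)[OF assms(1) U] Cinf_chart[OF assms(2) U] Cinf_chart[OF assms(3) U]]
    by (simp add: o_def)
qed

lemma Cinf_cmult: "smooth_atlas A \<Longrightarrow> f \<in> Cinf A \<Longrightarrow> (\<lambda>x. c * f x) \<in> Cinf A"
  by (rule Cinf_mult[OF _ Cinf_const])

lemma Cinf_diff:
  assumes "smooth_atlas A" "f \<in> Cinf A" "g \<in> Cinf A"
  shows "(\<lambda>x. f x - g x) \<in> Cinf A"
  using Cinf_add[OF assms(1,2) Cinf_cmult[OF assms(1,3), of "-1"]] by simp

lemma Cinf_sum:
  assumes "smooth_atlas A" "finite I" "\<And>i. i \<in> I \<Longrightarrow> f i \<in> Cinf A"
  shows "(\<lambda>x. \<Sum>i\<in>I. f i x) \<in> Cinf A"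
  using assms(2,3) by (induction I rule: finite_induct) (auto intro: Cinf_const Cinf_add assms(1))

lemma Cinf_continuous:
  assumes A: "smooth_atlas A" and f: "f \<in> Cinf A"
  shows "continuous_on UNIV f"
proof -
  have "\<exists>W. open W \<and> x \<in> W \<and> continuous_on W f" for x
  proof -
    obtain U \<phi> where U: "(U, \<phi>) \<in> A" "x \<in> U" using atlas_cover[OF A] .
    note c = atlas_chart[OF A U(1)]
    have "continuous_on U (\<lambda>x. (f \<circ> inv_into U \<phi>) (\<phi> x))"
      by (rule continuous_on_compose2[OF smooth_on_continuous_on[OF Cinf_chart[OF f U(1)]] c(3)]) auto
    then have "continuous_on U f" by (rule continuous_on_eq) (use c(5) in auto)
    then show ?thesis using U c(1) by blast
  qed
  then show ?thesis
    by (metis continuous_at_imp_continuous_on continuous_on_eq_continuous_at)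
qed

text \<open>Near x the function g does not vanish, and f is there a quotient of smooth functions.
  Frame identities determine a function only up to a cut-off factor, which is the g of the
  applications.\<close>

lemma Cinf_by_multiples:
  assumes A: "smooth_atlas A" and g: "\<And>x. \<exists>g\<in>Cinf A. g x \<noteq> 0 \<and> (\<lambda>y. g y * f y) \<in> Cinf A"
  shows "f \<in> Cinf A"
proof (rule Cinf_local[OF A])
  fix x
  obtain g where g: "g \<in> Cinf A" "g x \<noteq> 0" "(\<lambda>y. g y * f y) \<in> Cinf A" using g by blast
  obtain U \<phi> where U: "(U, \<phi>) \<in> A" "x \<in> U" using atlas_cover[OF A] .
  note c = atlas_chart[OF A U(1)]
  let ?W = "U \<inter> g -` (- {0})"
  have "open (g -` (- {0}))" by (rule open_vimage[OF _ Cinf_continuous[OF A g(1)]]) auto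
  then have W: "open ?W" using c(1) by auto
  have op: "open (\<phi> ` ?W)" using atlas_open_image[OF A U(1) W] by blast
  have sg: "smooth_on (\<phi> ` ?W) (g \<circ> inv_into U \<phi>)" "smooth_on (\<phi> ` ?W) ((\<lambda>y. g y * f y) \<circ> inv_into U \<phi>)"
    using Cinf_chart[OF g(1) U(1)] Cinf_chart[OF g(3) U(1)] by (auto elim: smooth_on_subset)
  have "smooth_on (\<phi> ` ?W) (\<lambda>z. inverse ((g \<circ> inv_into U \<phi>) z))"
    by (rule smooth_on_inverse[OF op sg(1)]) (auto simp: c(5))
  then have "smooth_on (\<phi> ` ?W) (\<lambda>z. inverse ((g \<circ> inv_into U \<phi>) z) * ((\<lambda>y. g y * f y) \<circ> inv_into U \<phi>) z)"
    by (rule smooth_on_mult[OF op _ sg(2)])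
  then have "smooth_on (\<phi> ` ?W) (f \<circ> inv_into U \<phi>)"
    by (rule smooth_on_cong[OF op, rotated]) (auto simp: c(5))
  then show "smooth_near A f x"
    by (rule smooth_nearI[OF U(1) W, rotated 2]) (use U g in auto)
qed

text \<open>A cut-off on a ball in a chart is transported to the manifold. It vanishes off a compact
  set K, which is closed since the manifold is Hausdorff; so the complement of K is an open set on
  which the extension by 0 is smooth.\<close>

lemma Cinf_bump:
  assumes A: "smooth_atlas A" and N: "open N" "x \<in> N"
  obtains h K where "h \<in> Cinf A" "h x = 1" "closed K" "K \<subseteq> N" "\<And>y. y \<notin> K \<Longrightarrow> h y = 0"
proof -
  obtain U \<phi> where U: "(U, \<phi>) \<in> A" "x \<in> U" using atlas_cover[OF A] .
  note c = atlas_chart[OF A U(1)]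
  have "open (U \<inter> N)" using c(1) N by auto
  then have op: "open (\<phi> ` (U \<inter> N))" using atlas_open_image[OF A U(1)] by blast
  have "\<phi> x \<in> \<phi> ` (U \<inter> N)" using U(2) N(2) by blast
  then obtain r where r: "r > 0" "cball (\<phi> x) r \<subseteq> \<phi> ` (U \<inter> N)"
    using open_contains_cball_eq[OF op] by blast
  obtain k where k: "smooth_on UNIV k" "k (\<phi> x) = 1" "\<And>y. y \<notin> cball (\<phi> x) r \<Longrightarrow> k y = (0::real)"
    using smooth_cutoff[OF r(1)] by blast
  define K where "K = inv_into U \<phi> ` cball (\<phi> x) r"
  define h where "h = (\<lambda>y. if y \<in> U then k (\<phi> y) else 0)"
  have "compact K" unfolding K_def
    using r(2) by (intro compact_continuous_image compact_finite_dim_cball continuous_on_subset[OF c(4)]) auto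
  then have K: "closed K" by (rule compact_imp_closed)
  have "y \<in> U \<inter> N" if yK: "y \<in> K" for y
  proof -
    obtain z where z: "z \<in> cball (\<phi> x) r" "y = inv_into U \<phi> z" using yK unfolding K_def by blast
    then obtain w where "w \<in> U \<inter> N" "z = \<phi> w" using r(2) by blast
    then show ?thesis using z c(5) by auto
  qed
  then have KN: "K \<subseteq> U \<inter> N" by blast
  have h0: "h y = 0" if "y \<notin> K" for y
  proof (cases "y \<in> U")
    case True
    then have "\<phi> y \<notin> cball (\<phi> x) r" using that c(5)[of y] unfolding K_def by force
    then show ?thesis using k(3) by (simp add: h_def)
  qed (simp add: h_def)
  have "h \<in> Cinf A"
  proof (rule Cinf_local[OF A])
    fix y
    show "smooth_near A h y"
    proof (cases "y \<in> U")
      case True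
      have "smooth_on (\<phi> ` U) k" using k(1) by (rule smooth_on_subset) simp
      then have "smooth_on (\<phi> ` U) (h \<circ> inv_into U \<phi>)"
        by (rule smooth_on_cong[OF c(2), rotated]) (auto simp: h_def c(5))
      then show ?thesis by (rule smooth_nearI[OF U(1) c(1) True subset_refl])
    next
      case False
      obtain V \<psi> where V: "(V, \<psi>) \<in> A" "y \<in> V" using atlas_cover[OF A] .
      note cV = atlas_chart[OF A V(1)]
      let ?W = "V \<inter> - K"
      have W: "open ?W" using cV(1) K by auto
      have op: "open (\<psi> ` ?W)" using atlas_open_image[OF A V(1) W] by blast
      have "smooth_on (\<psi> ` ?W) (h \<circ> inv_into V \<psi>)"
        by (rule smooth_on_cong[OF op _ smooth_on_const[OF op, of 0]]) (auto simp: h0 cV(5))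
      then show ?thesis by (rule smooth_nearI[OF V(1) W, rotated 2]) (use V False KN in auto)
    qed
  qed
  moreover have "h x = 1" using U(2) k(2) by (simp add: h_def)
  ultimately show ?thesis using that K KN h0 by blast
qed

section \<open>Vector bundles, sections and local frames\<close>

locale vbundle =
  fixes G :: "('m::{t2_space, second_countable_topology}, 'a::finite_dim_inner,
    'e::{t2_space, second_countable_topology}, 'f::finite_dim_inner, 'z) bundle_data_scheme"
  assumes vb: "vector_bundle G"
begin

abbreviation "MA \<equiv> base_atlas G"
abbreviation "EA \<equiv> E_atlas G"
abbreviation "CM \<equiv> Cinf MA"
abbreviation "CE \<equiv> Cinf EA"
abbreviation "sec \<equiv> sections G"
abbreviation "dual \<equiv> dual_sections G"
abbreviation "pb \<equiv> pb_sections G"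
abbreviation "dhat \<equiv> dual_hat G"
text \<open>For a section X of the pullback bundle this is the function \<theta>(X) on E; the base
  point is read off from the vector itself.\<close>

abbreviation "ev \<theta> X u \<equiv> dual_hat G \<theta> (snd (X u))"
abbreviation "FB \<equiv> (onb :: 'f set)"
abbreviation "\<pi> \<equiv> bproj G"
abbreviation "tinv \<Phi> p \<equiv> inv_into (bproj G -` {p}) \<Phi>"
abbreviation "bchart \<phi> \<Phi> \<equiv> (\<lambda>e. (\<phi> (bproj G e), \<Phi> e))"

lemma atlM: "smooth_atlas MA" and atlE: "smooth_atlas EA"
  using vb by (auto simp: vector_bundle_def)

lemma proj_fadd: "\<pi> u = \<pi> v \<Longrightarrow> \<pi> (fadd G u v) = \<pi> v"
  and proj_fscale [simp]: "\<pi> (fscale G c u) = \<pi> u"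
  using vb by (auto simp: vector_bundle_def)

lemma triv_cover:
  obtains V \<Phi> where "(V, \<Phi>) \<in> trivs G" "p \<in> V"
proof -
  have "(\<Union>(V, \<Phi>)\<in>trivs G. V) = UNIV" using vb unfolding vector_bundle_def by (elim conjE)
  then have "p \<in> (\<Union>(V, \<Phi>)\<in>trivs G. V)" by simp
  then show thesis using that by auto
qed

lemma triv_fibre:
  assumes "(V, \<Phi>) \<in> trivs G"
  shows triv_open: "open V"
    and "p \<in> V \<Longrightarrow> bij_betw \<Phi> (\<pi> -` {p}) UNIV"
    and "p \<in> V \<Longrightarrow> \<pi> u = p \<Longrightarrow> \<pi> v = p \<Longrightarrow> \<Phi> (fadd G u v) = \<Phi> u + \<Phi> v"
    and "p \<in> V \<Longrightarrow> \<pi> u = p \<Longrightarrow> \<Phi> (fscale G c u) = c *\<^sub>R \<Phi> u"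
proof -
  have "\<forall>(V, \<Phi>)\<in>trivs G. open V \<and>
        (\<forall>p\<in>V. bij_betw \<Phi> (bproj G -` {p}) UNIV \<and>
          (\<forall>u v. bproj G u = p \<and> bproj G v = p \<longrightarrow> \<Phi> (fadd G u v) = \<Phi> u + \<Phi> v) \<and>
          (\<forall>c u. bproj G u = p \<longrightarrow> \<Phi> (fscale G c u) = c *\<^sub>R \<Phi> u))"
    using vb unfolding vector_bundle_def by (elim conjE)
  from bspec[OF this assms, unfolded prod.case] have *: "open V \<and> (\<forall>p\<in>V. bij_betw \<Phi> (bproj G -` {p}) UNIV \<and>
          (\<forall>u v. bproj G u = p \<and> bproj G v = p \<longrightarrow> \<Phi> (fadd G u v) = \<Phi> u + \<Phi> v) \<and>
          (\<forall>c u. bproj G u = p \<longrightarrow> \<Phi> (fscale G c u) = c *\<^sub>R \<Phi> u))"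
    .
  show "open V" using * by simp
  show "p \<in> V \<Longrightarrow> bij_betw \<Phi> (\<pi> -` {p}) UNIV" using * by simp
  show "p \<in> V \<Longrightarrow> \<pi> u = p \<Longrightarrow> \<pi> v = p \<Longrightarrow> \<Phi> (fadd G u v) = \<Phi> u + \<Phi> v" using * by simp
  show "p \<in> V \<Longrightarrow> \<pi> u = p \<Longrightarrow> \<Phi> (fscale G c u) = c *\<^sub>R \<Phi> u" using * by simp
qed

lemma triv_inj:
  assumes "(V, \<Phi>) \<in> trivs G" "\<pi> u \<in> V" "\<pi> u = \<pi> v" "\<Phi> u = \<Phi> v"
  shows "u = v"
  using triv_fibre(2)[OF assms(1,2)] assms(3,4) by (auto simp: bij_betw_def inj_on_def)

lemma tinv:
  assumes "(V, \<Phi>) \<in> trivs G" "p \<in> V"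
  shows "\<pi> (tinv \<Phi> p y) = p" "\<Phi> (tinv \<Phi> p y) = y" "\<pi> u = p \<Longrightarrow> tinv \<Phi> p (\<Phi> u) = u"
proof -
  note b = triv_fibre(2)[OF assms]
  have "y \<in> \<Phi> ` (\<pi> -` {p})" using b by (auto simp: bij_betw_def)
  then show "\<pi> (tinv \<Phi> p y) = p" "\<Phi> (tinv \<Phi> p y) = y"
    using inv_into_into[of y \<Phi> "\<pi> -` {p}"] by (auto simp: f_inv_into_f)
  show "\<pi> u = p \<Longrightarrow> tinv \<Phi> p (\<Phi> u) = u"
    using b by (auto simp: bij_betw_def)
qed

lemma
  assumes V: "(V, \<Phi>) \<in> trivs G" "p \<in> V"
  shows tinv_add: "tinv \<Phi> p (x + y) = fadd G (tinv \<Phi> p x) (tinv \<Phi> p y)"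
    and tinv_scale: "tinv \<Phi> p (c *\<^sub>R x) = fscale G c (tinv \<Phi> p x)"
  by (rule triv_inj[OF V(1)]; simp add: tinv[OF V] triv_fibre(3,4)[OF V] proj_fadd V(2))+

text \<open>In a trivialization a left neutral z satisfies \<Phi> z + \<Phi> z = \<Phi> z, which
  forces \<Phi> z = 0. The equivalence is the form in which the definite description of
  \<open>fzero\<close> can be resolved.\<close>

lemma fzero_unique:
  assumes "(V, \<Phi>) \<in> trivs G" "p \<in> V"
  shows "\<pi> z = p \<and> (\<forall>u. \<pi> u = p \<longrightarrow> fadd G z u = u) \<longleftrightarrow> z = tinv \<Phi> p 0"
proof
  assume z: "\<pi> z = p \<and> (\<forall>u. \<pi> u = p \<longrightarrow> fadd G z u = u)"
  then have "\<Phi> z + \<Phi> z = \<Phi> z" using triv_fibre(3)[OF assms, of z z] by simp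
  then have "\<Phi> z = 0" by simp
  then show "z = tinv \<Phi> p 0" using tinv(3)[OF assms, of z] z by simp
next
  assume z: "z = tinv \<Phi> p 0"
  show "\<pi> z = p \<and> (\<forall>u. \<pi> u = p \<longrightarrow> fadd G z u = u)"
  proof (intro conjI allI impI)
    show pz: "\<pi> z = p" using z tinv(1)[OF assms] by simp
    fix u assume u: "\<pi> u = p"
    show "fadd G z u = u"
    proof (rule triv_inj[OF assms(1)])
      show "\<Phi> (fadd G z u) = \<Phi> u"
        using triv_fibre(3)[OF assms pz u] tinv(2)[OF assms, of 0] z by simp
    qed (use pz u assms(2) proj_fadd[of z u] in auto)
  qed
qed

lemma fzero_tinv: "(V, \<Phi>) \<in> trivs G \<Longrightarrow> p \<in> V \<Longrightarrow> fzero G p = tinv \<Phi> p 0"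
  unfolding fzero_def by (rule the_equality) (simp_all add: fzero_unique)

lemma proj_fzero [simp]: "\<pi> (fzero G p) = p"
  and fadd_fzero: "\<pi> u = p \<Longrightarrow> fadd G (fzero G p) u = u"
proof -
  obtain V \<Phi> where V: "(V, \<Phi>) \<in> trivs G" "p \<in> V" by (rule triv_cover)
  show "\<pi> (fzero G p) = p" "\<pi> u = p \<Longrightarrow> fadd G (fzero G p) u = u"
    using fzero_unique[OF V, of "fzero G p"] fzero_tinv[OF V] by auto
qed

lemma E_chart:
  assumes "(U, \<phi>) \<in> MA" "(V, \<Phi>) \<in> trivs G"
  shows "(\<pi> -` (U \<inter> V), bchart \<phi> \<Phi>) \<in> EA"
    and "\<And>u. \<pi> u \<in> U \<inter> V \<Longrightarrow> inv_into (\<pi> -` (U \<inter> V)) (bchart \<phi> \<Phi>) (\<phi> (\<pi> u), \<Phi> u) = u"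
proof -
  show c: "(\<pi> -` (U \<inter> V), bchart \<phi> \<Phi>) \<in> EA"
    unfolding E_atlas_def using assms by blast
  show "\<And>u. \<pi> u \<in> U \<inter> V \<Longrightarrow> inv_into (\<pi> -` (U \<inter> V)) (bchart \<phi> \<Phi>) (\<phi> (\<pi> u), \<Phi> u) = u"
    using atlas_chart(5)[OF atlE c] by simp
qed

lemma smooth_proj: "smooth_map EA MA \<pi>"
proof (rule smooth_map_local[OF atlE atlM])
  fix u
  obtain U \<phi> where U: "(U, \<phi>) \<in> MA" "\<pi> u \<in> U" using atlas_cover[OF atlM] .
  obtain V \<Phi> where V: "(V, \<Phi>) \<in> trivs G" "\<pi> u \<in> V" by (rule triv_cover)
  let ?W = "\<pi> -` (U \<inter> V)"
  note c = E_chart[OF U(1) V(1)]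
  note cE = atlas_chart[OF atlE c(1)]
  have "smooth_on (bchart \<phi> \<Phi> ` ?W) fst" by (rule smooth_on_linear[OF cE(2) bounded_linear_fst])
  then have "smooth_on (bchart \<phi> \<Phi> ` ?W) (\<phi> \<circ> \<pi> \<circ> inv_into ?W (bchart \<phi> \<Phi>))"
    by (rule smooth_on_cong[OF cE(2), rotated]) (auto simp: c(2) simp del: vimage_Int)
  then show "smooth_map_near EA MA \<pi> u"
    by (rule smooth_map_nearI[OF c(1) U(1) cE(1), rotated 3]) (use U V in auto)
qed

lemma proj_continuous: "continuous_on UNIV \<pi>"
  using smooth_proj by (simp add: smooth_map_def)

lemma Cinf_proj: "g \<in> CM \<Longrightarrow> (\<lambda>u. g (\<pi> u)) \<in> CE"
  by (rule Cinf_compose[OF atlE atlM smooth_proj])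

lemma smooth_into_E_nearI:
  assumes A: "smooth_atlas A" and c: "(N, \<kappa>) \<in> A" "(U, \<phi>) \<in> MA" "(V, \<Phi>) \<in> trivs G"
    and W: "open W" "x \<in> W" "W \<subseteq> N" "\<And>y. y \<in> W \<Longrightarrow> \<pi> (F y) \<in> U \<inter> V"
    and s: "smooth_on (\<kappa> ` W) (\<lambda>z. \<phi> (\<pi> (F (inv_into N \<kappa> z))))"
      "smooth_on (\<kappa> ` W) (\<lambda>z. \<Phi> (F (inv_into N \<kappa> z)))"
  shows "smooth_map_near A EA F x"
proof (rule smooth_map_nearI[OF c(1) E_chart(1)[OF c(2,3)] W(1-3)])
  show "smooth_on (\<kappa> ` W) (bchart \<phi> \<Phi> \<circ> F \<circ> inv_into N \<kappa>)"
    using smooth_on_Pair[OF atlas_open_image[OF A c(1) W(1,3)] s] by (simp add: o_def)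
qed (use W(4) in auto)

section \<open>Dual sections as fibrewise linear functions\<close>

lemma dual_hat_fadd: "\<theta> \<in> dual \<Longrightarrow> \<pi> u = \<pi> v \<Longrightarrow> dhat \<theta> (fadd G u v) = dhat \<theta> u + dhat \<theta> v"
  and dual_hat_fscale: "\<theta> \<in> dual \<Longrightarrow> dhat \<theta> (fscale G c u) = c * dhat \<theta> u"
  and dual_off_fibre: "\<theta> \<in> dual \<Longrightarrow> \<pi> u \<noteq> p \<Longrightarrow> \<theta> p u = 0"
  and dual_smooth: "\<theta> \<in> dual \<Longrightarrow> s \<in> sec \<Longrightarrow> (\<lambda>p. \<theta> p (s p)) \<in> CM"
  by (auto simp: dual_sections_def dual_hat_def dual_pair_def proj_fadd)

lemma dual_hat_fzero: "\<theta> \<in> dual \<Longrightarrow> dhat \<theta> (fzero G p) = 0"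
  using dual_hat_fadd[of \<theta> "fzero G p" "fzero G p"] fadd_fzero[of "fzero G p" p] by simp

lemma linear_dual_tinv:
  assumes "\<theta> \<in> dual" "(V, \<Phi>) \<in> trivs G" "p \<in> V"
  shows "linear (\<lambda>y. dhat \<theta> (tinv \<Phi> p y))"
  by (intro linearI)
     (simp_all add: tinv_add[OF assms(2,3)] tinv_scale[OF assms(2,3)] dual_hat_fadd dual_hat_fscale
        assms(1) tinv(1)[OF assms(2,3)])

lemma dual_hat_expansion:
  assumes "\<theta> \<in> dual" "(V, \<Phi>) \<in> trivs G" "\<pi> u \<in> V"
  shows "dhat \<theta> u = (\<Sum>b\<in>onb. (\<Phi> u \<bullet> b) * dhat \<theta> (tinv \<Phi> (\<pi> u) b))"
proof -
  from linear_onb_expansion[OF linear_dual_tinv[OF assms], of "\<Phi> u"]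
  show ?thesis by (simp add: tinv(3)[OF assms(2,3)])
qed

lemma section_proj: "s \<in> sec \<Longrightarrow> \<pi> (s p) = p"
  by (simp add: sections_def)

text \<open>
  A trivialization is cut off by a bump function \<open>h\<close> on the base to obtain global sections and
  global dual sections.
\<close>

definition adapted where
  "adapted U \<phi> V \<Phi> h K \<longleftrightarrow> (U, \<phi>) \<in> MA \<and> (V, \<Phi>) \<in> trivs G \<and> h \<in> CM \<and> closed K \<and> K \<subseteq> U \<inter> V \<and>
    (\<forall>q. q \<notin> K \<longrightarrow> h q = 0)"

definition loc_sec where
  "loc_sec V \<Phi> h b q = (if q \<in> V then tinv \<Phi> q (h q *\<^sub>R b) else fzero G q)"

definition loc_dual where
  "loc_dual V \<Phi> h b q u = (if q \<in> V \<and> \<pi> u = q then h q * (\<Phi> u \<bullet> b) else 0)"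

lemma adaptedD:
  assumes "adapted U \<phi> V \<Phi> h K"
  shows "(U, \<phi>) \<in> MA" "(V, \<Phi>) \<in> trivs G" "h \<in> CM" "closed K" "K \<subseteq> U \<inter> V"
    "\<And>q. q \<notin> K \<Longrightarrow> h q = 0"
  using assms by (auto simp: adapted_def)

lemma adapted_exists:
  obtains U \<phi> V \<Phi> h K where "adapted U \<phi> V \<Phi> h K" "h p = 1" "p \<in> U \<inter> V"
proof -
  obtain U \<phi> where U: "(U, \<phi>) \<in> MA" "p \<in> U" using atlas_cover[OF atlM] .
  obtain V \<Phi> where V: "(V, \<Phi>) \<in> trivs G" "p \<in> V" by (rule triv_cover)
  have "open (U \<inter> V)" using atlas_chart(1)[OF atlM U(1)] triv_open[OF V(1)] by auto
  then obtain h K where "h \<in> CM" "h p = 1" "closed K" "K \<subseteq> U \<inter> V" "\<And>y. y \<notin> K \<Longrightarrow> h y = 0"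
    using Cinf_bump[OF atlM] U(2) V(2) by (metis IntI)
  then show ?thesis using that[of U \<phi> V \<Phi> h K] U V by (auto simp: adapted_def)
qed

text \<open>Over \<open>U \<inter> V\<close> the fibre coordinate is the smooth function h times the
  constant b; off the closed set K the section is zero. These two open sets cover the base.\<close>

lemma loc_sec_section:
  assumes a: "adapted U \<phi> V \<Phi> h K"
  shows "loc_sec V \<Phi> h b \<in> sec"
proof -
  note U = adaptedD(1)[OF a] and V = adaptedD(2)[OF a] and h = adaptedD(3)[OF a] and K = adaptedD(4-6)[OF a]
  note cU = atlas_chart[OF atlM U]
  let ?e = "loc_sec V \<Phi> h b"
  have pe: "\<pi> (?e q) = q" for q using tinv(1)[OF V] by (simp add: loc_sec_def)
  have z: "?e q = fzero G q" if "q \<notin> K" for q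
    using that K(3) fzero_tinv[OF V] by (simp add: loc_sec_def)
  have "smooth_map MA EA ?e"
  proof (rule smooth_map_local[OF atlM atlE])
    fix q
    show "smooth_map_near MA EA ?e q"
    proof (cases "q \<in> U \<inter> V")
      case True
      let ?W = "U \<inter> V"
      have W: "open ?W" using cU(1) triv_open[OF V] by auto
      have op: "open (\<phi> ` ?W)" by (rule atlas_open_image[OF atlM U W]) auto
      have s1: "smooth_on (\<phi> ` ?W) (\<lambda>z. \<phi> (\<pi> (?e (inv_into U \<phi> z))))"
        by (rule smooth_on_cong[OF op _ smooth_on_linear[OF op bounded_linear_ident]]) (auto simp: pe cU(5))
      have "smooth_on (\<phi> ` ?W) (h \<circ> inv_into U \<phi>)"
        using Cinf_chart[OF h U] by (rule smooth_on_subset) auto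
      then have s2: "smooth_on (\<phi> ` ?W) (\<lambda>z. (h \<circ> inv_into U \<phi>) z *\<^sub>R b)"
        by (rule smooth_on_scaleR[OF op _ smooth_on_const[OF op]])
      have s2: "smooth_on (\<phi> ` ?W) (\<lambda>z. \<Phi> (?e (inv_into U \<phi> z)))"
        by (rule smooth_on_cong[OF op _ s2]) (auto simp: cU(5) loc_sec_def tinv(2)[OF V])
      show ?thesis
        by (rule smooth_into_E_nearI[OF atlM U U V W True _ _ s1 s2]) (auto simp: pe)
    next
      case False
      obtain U' \<phi>' where U': "(U', \<phi>') \<in> MA" "q \<in> U'" using atlas_cover[OF atlM] .
      obtain V' \<Phi>' where V': "(V', \<Phi>') \<in> trivs G" "q \<in> V'" by (rule triv_cover)
      note cU' = atlas_chart[OF atlM U'(1)]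
      let ?W = "U' \<inter> V' \<inter> - K"
      have W: "open ?W" using cU'(1) triv_open[OF V'(1)] K(1) by auto
      have op: "open (\<phi>' ` ?W)" by (rule atlas_open_image[OF atlM U'(1) W]) auto
      have s1: "smooth_on (\<phi>' ` ?W) (\<lambda>z. \<phi>' (\<pi> (?e (inv_into U' \<phi>' z))))"
        by (rule smooth_on_cong[OF op _ smooth_on_linear[OF op bounded_linear_ident]]) (auto simp: pe cU'(5))
      have s2: "smooth_on (\<phi>' ` ?W) (\<lambda>z. \<Phi>' (?e (inv_into U' \<phi>' z)))"
        by (rule smooth_on_cong[OF op _ smooth_on_const[OF op, of 0]])
           (auto simp: cU'(5) z fzero_tinv[OF V'(1)] tinv(2)[OF V'(1)])
      show ?thesis
        by (rule smooth_into_E_nearI[OF atlM U'(1) U'(1) V'(1) W _ _ _ s1 s2])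
           (use U' V' False K(2) in \<open>auto simp: pe\<close>)
    qed
  qed
  then show ?thesis using pe by (simp add: sections_def)
qed

lemma section_in_chart:
  assumes s: "s \<in> sec" and U: "(U, \<phi>) \<in> MA" and V: "(V, \<Phi>) \<in> trivs G"
  shows "smooth_on (\<phi> ` (U \<inter> V)) (\<lambda>z. \<Phi> (s (inv_into U \<phi> z)))"
proof -
  note cU = atlas_chart[OF atlM U]
  have "open (U \<inter> V)" using cU(1) triv_open[OF V] by auto
  then have op: "open (\<phi> ` (U \<inter> V))" by (rule atlas_open_image[OF atlM U]) auto
  have "smooth_on (\<phi> ` (U \<inter> V)) (bchart \<phi> \<Phi> \<circ> s \<circ> inv_into U \<phi>)"
    using s by (intro smooth_map_chart[OF _ U E_chart(1)[OF U V]]) (auto simp: sections_def)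
  from smooth_on_bounded_linear[OF op bounded_linear_snd this] show ?thesis by (simp add: o_def)
qed

lemma loc_dual_dual:
  assumes a: "adapted U \<phi> V \<Phi> h K"
  shows "loc_dual V \<Phi> h b \<in> dual"
proof -
  note U = adaptedD(1)[OF a] and V = adaptedD(2)[OF a] and h = adaptedD(3)[OF a] and K = adaptedD(4-6)[OF a]
  note cU = atlas_chart[OF atlM U]
  let ?t = "loc_dual V \<Phi> h b"
  have "(\<lambda>p. ?t p (s p)) \<in> CM" if s: "s \<in> sec" for s
  proof (rule Cinf_local[OF atlM])
    fix q
    have z: "?t p (s p) = 0" if "p \<notin> K" for p using that K(3) by (simp add: loc_dual_def)
    show "smooth_near MA (\<lambda>p. ?t p (s p)) q"
    proof (cases "q \<in> U \<inter> V")
      case True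
      let ?W = "U \<inter> V"
      have W: "open ?W" using cU(1) triv_open[OF V] by auto
      have op: "open (\<phi> ` ?W)" by (rule atlas_open_image[OF atlM U W]) auto
      have "smooth_on (\<phi> ` ?W) (h \<circ> inv_into U \<phi>)"
        using Cinf_chart[OF h U] by (rule smooth_on_subset) auto
      then have "smooth_on (\<phi> ` ?W) (\<lambda>z. (h \<circ> inv_into U \<phi>) z * (\<Phi> (s (inv_into U \<phi> z)) \<bullet> b))"
        by (intro smooth_on_mult op smooth_on_bounded_linear[OF op bounded_linear_inner_left]
            section_in_chart s U V)
      then have "smooth_on (\<phi> ` ?W) ((\<lambda>p. ?t p (s p)) \<circ> inv_into U \<phi>)"
        by (rule smooth_on_cong[OF op, rotated]) (auto simp: cU(5) loc_dual_def section_proj[OF s])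
      then show ?thesis by (rule smooth_nearI[OF U W True, rotated]) auto
    next
      case False
      obtain U' \<phi>' where U': "(U', \<phi>') \<in> MA" "q \<in> U'" using atlas_cover[OF atlM] .
      note cU' = atlas_chart[OF atlM U'(1)]
      let ?W = "U' \<inter> - K"
      have W: "open ?W" using cU'(1) K(1) by auto
      have op: "open (\<phi>' ` ?W)" by (rule atlas_open_image[OF atlM U'(1) W]) auto
      have "smooth_on (\<phi>' ` ?W) ((\<lambda>p. ?t p (s p)) \<circ> inv_into U' \<phi>')"
        by (rule smooth_on_cong[OF op _ smooth_on_const[OF op, of 0]]) (auto simp: cU'(5) z)
      then show ?thesis by (rule smooth_nearI[OF U'(1) W, rotated 2]) (use U' False K(2) in auto)
    qed
  qed
  then show ?thesis
    by (auto simp: dual_sections_def dual_pair_def loc_dual_def triv_fibre(2-4)[OF V] proj_fadd inner_add_left algebra_simps)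
qed

text \<open>Membership in \<open>dual_sections\<close> speaks only of pairings with sections over
  the base. Smoothness on the total space is a further claim, read off here from a bundle chart,
  where the function is h times an inner product with b. From here \<open>dual_hat_smooth\<close>
  reaches all dual sections.\<close>

lemma loc_dual_hat_smooth:
  assumes a: "adapted U \<phi> V \<Phi> h K"
  shows "dhat (loc_dual V \<Phi> h b) \<in> CE"
proof (rule Cinf_local[OF atlE])
  fix u
  note U = adaptedD(1)[OF a] and V = adaptedD(2)[OF a] and h = adaptedD(3)[OF a] and K = adaptedD(4-6)[OF a]
  note cU = atlas_chart[OF atlM U]
  let ?t = "dhat (loc_dual V \<Phi> h b)"
  have z: "?t u = 0" if "\<pi> u \<notin> K" for u using that K(3) by (simp add: dual_hat_def loc_dual_def)
  show "smooth_near EA ?t u"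
  proof (cases "\<pi> u \<in> U \<inter> V")
    case True
    let ?W = "\<pi> -` (U \<inter> V)"
    note c = E_chart[OF U V]
    note cE = atlas_chart[OF atlE c(1)]
    have "smooth_on (bchart \<phi> \<Phi> ` ?W) (\<lambda>z. (h \<circ> inv_into U \<phi>) (fst z))"
      by (rule smooth_on_compose[OF cE(2) Cinf_chart[OF h U] smooth_on_linear[OF cE(2) bounded_linear_fst]]) auto
    then have "smooth_on (bchart \<phi> \<Phi> ` ?W) (\<lambda>z. (h \<circ> inv_into U \<phi>) (fst z) * (snd z \<bullet> b))"
      by (rule smooth_on_mult[OF cE(2) _ smooth_on_bounded_linear[OF cE(2) bounded_linear_inner_left
            smooth_on_linear[OF cE(2) bounded_linear_snd]]])
    then have "smooth_on (bchart \<phi> \<Phi> ` ?W) (?t \<circ> inv_into ?W (bchart \<phi> \<Phi>))"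
      by (rule smooth_on_cong[OF cE(2), rotated]) (auto simp: c(2) cU(5) dual_hat_def loc_dual_def simp del: vimage_Int)
    then show ?thesis by (rule smooth_nearI[OF c(1) cE(1), rotated 2]) (use True in auto)
  next
    case False
    obtain N \<kappa> where N: "(N, \<kappa>) \<in> EA" "u \<in> N" using atlas_cover[OF atlE] .
    note cN = atlas_chart[OF atlE N(1)]
    let ?W = "N \<inter> \<pi> -` (- K)"
    have "open (\<pi> -` (- K))" by (rule open_vimage[OF _ proj_continuous]) (use K(1) in auto)
    then have W: "open ?W" using cN(1) by auto
    have op: "open (\<kappa> ` ?W)" by (rule atlas_open_image[OF atlE N(1) W]) auto
    have "smooth_on (\<kappa> ` ?W) (?t \<circ> inv_into N \<kappa>)"
      by (rule smooth_on_cong[OF op _ smooth_on_const[OF op, of 0]]) (auto simp: cN(5) z)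
    then show ?thesis by (rule smooth_nearI[OF N(1) W, rotated 2]) (use N False K(2) in auto)
  qed
qed

text \<open>A frame cut off by f: formally
  \<open>f id = \<Sum> \<theta>\<^sub>b \<otimes> e\<^sub>b\<close>, where \<theta>_b(e_c) is f for
  b = c and 0 otherwise. The identities hold on the whole bundle, so linearity over global functions
  applies to them directly; over p, where f = 1, they describe dual bases of the fibre.\<close>

definition frame_at where
  "frame_at p f e \<theta> \<longleftrightarrow> f \<in> CM \<and> f p = 1 \<and>
    (\<forall>b\<in>onb. e b \<in> sec \<and> \<theta> b \<in> dual \<and> dhat (\<theta> b) \<in> CE) \<and>
    (\<forall>\<tau>\<in>dual. \<forall>u. f (\<pi> u) * dhat \<tau> u =
       (\<Sum>b\<in>FB. dhat (\<theta> b) u * dhat \<tau> (e b (\<pi> u)))) \<and>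
    (\<forall>b\<in>onb. \<forall>c\<in>onb. \<forall>q. dhat (\<theta> b) (e c q) = (if b = c then f q else 0)) \<and>
    (\<forall>u v. \<pi> u = p \<and> \<pi> v = p \<and> (\<forall>b\<in>onb. dhat (\<theta> b) u = dhat (\<theta> b) v) \<longrightarrow> u = v)"

lemma frame_exists: obtains f e \<theta> where "frame_at p f e \<theta>"
proof -
  obtain U \<phi> V \<Phi> h K where a: "adapted U \<phi> V \<Phi> h K" and hp: "h p = 1" "p \<in> U \<inter> V"
    by (rule adapted_exists)
  note U = adaptedD(1)[OF a] and V = adaptedD(2)[OF a] and h = adaptedD(3)[OF a] and K = adaptedD(4-6)[OF a]
  \<comment> \<open>The square arises because \<open>loc_sec\<close> and \<open>loc_dual\<close>
    each carry one factor h.\<close>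
  let ?f = "\<lambda>q. h q * h q" and ?e = "loc_sec V \<Phi> h" and ?\<theta> = "loc_dual V \<Phi> h"
  have hV: "h q = 0" if "q \<notin> V" for q using that K by blast
  have "?f (\<pi> u) * dhat \<tau> u = (\<Sum>b\<in>FB. dhat (?\<theta> b) u * dhat \<tau> (?e b (\<pi> u)))"
    if t: "\<tau> \<in> dual" for \<tau> u
  proof (cases "\<pi> u \<in> V")
    case True
    have "?e b (\<pi> u) = fscale G (h (\<pi> u)) (tinv \<Phi> (\<pi> u) b)" for b
      by (rule triv_inj[OF V]) (simp_all add: loc_sec_def True tinv[OF V True] triv_fibre(2-4)[OF V True])
    then show ?thesis
      by (simp add: dual_hat_expansion[OF t V True] dual_hat_fscale[OF t] sum_distrib_left)
         (rule sum.cong, auto simp: dual_hat_def loc_dual_def True)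
  qed (simp add: hV dual_hat_def loc_dual_def)
  moreover have "dhat (?\<theta> b) (?e c q) = (if b = c then ?f q else 0)" if "b \<in> onb" "c \<in> onb" for b c q
    using inner_onb[OF that(2,1)] by (auto simp: hV dual_hat_def loc_dual_def loc_sec_def tinv[OF V])
  moreover have "u = v" if uv: "\<pi> u = p" "\<pi> v = p" and eq: "\<forall>b\<in>onb. dhat (?\<theta> b) u = dhat (?\<theta> b) v" for u v
  proof (rule triv_inj[OF V])
    have "\<Phi> u \<bullet> b = \<Phi> v \<bullet> b" if "b \<in> onb" for b
      using eq that uv hp by (auto simp: dual_hat_def loc_dual_def)
    then show "\<Phi> u = \<Phi> v" by (subst (1 2) onb_expansion[symmetric]) (auto intro: sum.cong)
  qed (use uv hp in auto)
  ultimately have "frame_at p ?f ?e ?\<theta>"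
    unfolding frame_at_def
    using hp Cinf_mult[OF atlM h h] loc_sec_section[OF a] loc_dual_dual[OF a] loc_dual_hat_smooth[OF a] by auto
  then show ?thesis using that by blast
qed

lemma frame_atD:
  assumes "frame_at p f e \<theta>"
  shows "f \<in> CM" "f p = 1" "b \<in> onb \<Longrightarrow> e b \<in> sec" "b \<in> onb \<Longrightarrow> \<theta> b \<in> dual"
    "b \<in> onb \<Longrightarrow> dhat (\<theta> b) \<in> CE"
    "\<tau> \<in> dual \<Longrightarrow> f (\<pi> u) * dhat \<tau> u =
       (\<Sum>b\<in>FB. dhat (\<theta> b) u * dhat \<tau> (e b (\<pi> u)))"
    "b \<in> onb \<Longrightarrow> c \<in> onb \<Longrightarrow> dhat (\<theta> b) (e c q) = (if b = c then f q else 0)"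
    "\<pi> u = p \<Longrightarrow> \<pi> v = p \<Longrightarrow> (\<And>b. b \<in> onb \<Longrightarrow> dhat (\<theta> b) u = dhat (\<theta> b) v) \<Longrightarrow> u = v"
  using assms unfolding frame_at_def by blast+

lemma fibre_eqI:
  assumes "\<pi> u = \<pi> v" "\<And>\<theta>. \<theta> \<in> dual \<Longrightarrow> dhat \<theta> u = dhat \<theta> v"
  shows "u = v"
proof -
  obtain f e \<theta> where F: "frame_at (\<pi> v) f e \<theta>" by (rule frame_exists)
  show ?thesis by (rule frame_atD(8)[OF F]) (use assms frame_atD(4)[OF F] in auto)
qed

text \<open>Multiplied by f, the function is a sum of products of the smooth
  \<open>dhat (\<theta> b)\<close> with pullbacks of the base functions \<tau>(e_b).\<close>

lemma dual_hat_smooth: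
  assumes "\<tau> \<in> dual"
  shows "dhat \<tau> \<in> CE"
proof (rule Cinf_by_multiples[OF atlE])
  fix u
  obtain f e \<theta> where F: "frame_at (\<pi> u) f e \<theta>" by (rule frame_exists)
  have "(\<lambda>v. \<Sum>b\<in>FB. dhat (\<theta> b) v * \<tau> (\<pi> v) (e b (\<pi> v))) \<in> CE"
    by (intro Cinf_sum Cinf_mult atlE finite_onb frame_atD(5)[OF F]
        Cinf_proj[of "\<lambda>p. \<tau> p (e _ p)"] dual_smooth[OF assms] frame_atD(3)[OF F])
  moreover have "(\<Sum>b\<in>FB. dhat (\<theta> b) v * \<tau> (\<pi> v) (e b (\<pi> v))) = f (\<pi> v) * dhat \<tau> v" for v
    unfolding frame_atD(6)[OF F assms]
    by (rule sum.cong) (auto simp: dual_hat_def section_proj frame_atD(3)[OF F])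
  ultimately show "\<exists>g\<in>CE. g u \<noteq> 0 \<and> (\<lambda>y. g y * dhat \<tau> y) \<in> CE"
    using frame_atD(1,2)[OF F] by (intro bexI[of _ "\<lambda>u. f (\<pi> u)"] Cinf_proj) auto
qed

text \<open>On the open set where h does not vanish, the fibre coordinates of F along
  \<open>onb\<close> are the values of \<open>dhat (loc_dual V \<Phi> h b)\<close> on F divided by
  h. The criterion turns smoothness of sections into smoothness of real functions.\<close>

lemma smooth_map_criterion:
  assumes A: "smooth_atlas A" and p: "smooth_map A MA (\<lambda>x. \<pi> (F x))"
    and d: "\<And>\<theta>. \<theta> \<in> dual \<Longrightarrow> (\<lambda>x. dhat \<theta> (F x)) \<in> Cinf A"
  shows "smooth_map A EA F"
proof (rule smooth_map_local[OF A atlE])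
  fix x
  obtain N \<kappa> where N: "(N, \<kappa>) \<in> A" "x \<in> N" using atlas_cover[OF A] .
  obtain U \<phi> V \<Phi> h K where a: "adapted U \<phi> V \<Phi> h K" and hp: "h (\<pi> (F x)) = 1" "\<pi> (F x) \<in> U \<inter> V"
    by (rule adapted_exists)
  note U = adaptedD(1)[OF a] and V = adaptedD(2)[OF a] and h = adaptedD(3)[OF a]
  note cU = atlas_chart[OF atlM U] and cN = atlas_chart[OF A N(1)]
  let ?W = "N \<inter> ((\<lambda>x. \<pi> (F x)) -` (U \<inter> V) \<inter> (\<lambda>x. h (\<pi> (F x))) -` (- {0}))"
  have hs: "(\<lambda>x. h (\<pi> (F x))) \<in> Cinf A" by (rule Cinf_compose[OF A atlM p h])
  have "open (U \<inter> V)" using cU(1) triv_open[OF V] by auto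
  then have "open ((\<lambda>x. \<pi> (F x)) -` (U \<inter> V))"
    using p by (intro open_vimage) (auto simp: smooth_map_def)
  moreover have "open ((\<lambda>x. h (\<pi> (F x))) -` (- {0}))"
    by (rule open_vimage[OF _ Cinf_continuous[OF A hs]]) auto
  ultimately have W: "open ?W" using cN(1) by auto
  have op: "open (\<kappa> ` ?W)" by (rule atlas_open_image[OF A N(1) W]) auto
  have s1: "smooth_on (\<kappa> ` ?W) (\<lambda>z. \<phi> (\<pi> (F (inv_into N \<kappa> z))))"
    using smooth_map_chart[OF p N(1) U, of ?W] by (auto simp: o_def)
  have sh: "smooth_on (\<kappa> ` ?W) (\<lambda>z. h (\<pi> (F (inv_into N \<kappa> z))))"
    using smooth_on_subset[OF Cinf_chart[OF hs N(1)], of "\<kappa> ` ?W"] by (auto simp: o_def)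
  have sd: "smooth_on (\<kappa> ` ?W) (\<lambda>z. dhat (loc_dual V \<Phi> h b) (F (inv_into N \<kappa> z)))" for b
    using smooth_on_subset[OF Cinf_chart[OF d[OF loc_dual_dual[OF a, of b]] N(1)], of "\<kappa> ` ?W"] by (auto simp: o_def)
  have "smooth_on (\<kappa> ` ?W) (\<lambda>z. \<Sum>b\<in>onb. (inverse (h (\<pi> (F (inv_into N \<kappa> z)))) *
      dhat (loc_dual V \<Phi> h b) (F (inv_into N \<kappa> z))) *\<^sub>R b)"
    by (intro smooth_on_sum smooth_on_scaleR smooth_on_mult smooth_on_inverse smooth_on_const op finite_onb sh sd)
       (auto simp: cN(5))
  then have s2: "smooth_on (\<kappa> ` ?W) (\<lambda>z. \<Phi> (F (inv_into N \<kappa> z)))"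
  proof (rule smooth_on_cong[OF op, rotated])
    fix z assume "z \<in> \<kappa> ` ?W"
    then obtain y where y: "y \<in> ?W" "z = \<kappa> y" by blast
    then have "inverse (h (\<pi> (F y))) * h (\<pi> (F y)) = 1" by simp
    then show "(\<Sum>b\<in>onb. (inverse (h (\<pi> (F (inv_into N \<kappa> z)))) *
        dhat (loc_dual V \<Phi> h b) (F (inv_into N \<kappa> z))) *\<^sub>R b) = \<Phi> (F (inv_into N \<kappa> z))"
      using y by (simp add: cN(5) dual_hat_def loc_dual_def onb_expansion mult.assoc[symmetric])
  qed
  show "smooth_map_near A EA F x"
    by (rule smooth_into_E_nearI[OF A N(1) U V W _ _ _ s1 s2]) (use N hp in auto)
qed

lemma sectionsI:
  assumes "\<And>p. \<pi> (s p) = p" "\<And>\<theta>. \<theta> \<in> dual \<Longrightarrow> (\<lambda>p. dhat \<theta> (s p)) \<in> CM"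
  shows "s \<in> sec"
proof -
  have "smooth_map MA MA (\<lambda>p. \<pi> (s p))"
    using smooth_map_ident[OF atlM] by (simp add: assms(1))
  then show ?thesis
    using smooth_map_criterion[OF atlM _ assms(2)] assms(1) by (simp add: sections_def)
qed

lemma dhat_section: "s \<in> sec \<Longrightarrow> dhat \<theta> (s p) = dual_pair \<theta> s p"
  by (simp add: dual_hat_def dual_pair_def section_proj)

lemma section_smooth: "s \<in> sec \<Longrightarrow> \<theta> \<in> dual \<Longrightarrow> (\<lambda>p. dhat \<theta> (s p)) \<in> CM"
  using dual_smooth[of \<theta> s] by (simp add: dual_hat_def section_proj)

lemma section_eqI:
  assumes "s \<in> sec" "t \<in> sec" "\<And>\<theta> p. \<theta> \<in> dual \<Longrightarrow> dhat \<theta> (s p) = dhat \<theta> (t p)"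
  shows "s = t"
proof
  show "s p = t p" for p by (rule fibre_eqI) (simp_all add: section_proj assms)
qed

lemma dhat_sadd: "\<theta> \<in> dual \<Longrightarrow> s \<in> sec \<Longrightarrow> t \<in> sec \<Longrightarrow> dhat \<theta> (sadd G s t p) = dhat \<theta> (s p) + dhat \<theta> (t p)"
  and dhat_smul: "\<theta> \<in> dual \<Longrightarrow> dhat \<theta> (smul G g s p) = g p * dhat \<theta> (s p)"
  and dhat_szero: "\<theta> \<in> dual \<Longrightarrow> dhat \<theta> (szero G p) = 0"
  by (simp_all add: sadd_def smul_def szero_def dual_hat_fadd dual_hat_fscale dual_hat_fzero section_proj)

lemma sadd_section: "s \<in> sec \<Longrightarrow> t \<in> sec \<Longrightarrow> sadd G s t \<in> sec"
  by (rule sectionsI) (simp_all add: dhat_sadd Cinf_add[OF atlM] section_smooth, simp add: sadd_def section_proj proj_fadd)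

lemma smul_section: "g \<in> CM \<Longrightarrow> s \<in> sec \<Longrightarrow> smul G g s \<in> sec"
  by (rule sectionsI) (simp_all add: dhat_smul Cinf_mult[OF atlM] section_smooth, simp add: smul_def section_proj)

lemma szero_section: "szero G \<in> sec"
  by (rule sectionsI) (simp_all add: dhat_szero Cinf_const[OF atlM], simp add: szero_def)

section \<open>Sections of the pullback bundle and tensoriality\<close>

lemma pb_fst: "X \<in> pb \<Longrightarrow> fst (X u) = u"
  and pb_proj: "X \<in> pb \<Longrightarrow> \<pi> (snd (X u)) = \<pi> u"
  by (simp_all add: pb_sections_def)

lemma pb_smooth: "X \<in> pb \<Longrightarrow> \<theta> \<in> dual \<Longrightarrow> (\<lambda>u. ev \<theta> X u) \<in> CE"
  using Cinf_compose[OF atlE atlE _ dual_hat_smooth, of "snd \<circ> X" \<theta>] by (simp add: pb_sections_def)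

lemma pbI:
  assumes "\<And>u. fst (X u) = u" "\<And>u. \<pi> (snd (X u)) = \<pi> u" "\<And>\<theta>. \<theta> \<in> dual \<Longrightarrow> (\<lambda>u. ev \<theta> X u) \<in> CE"
  shows "X \<in> pb"
proof -
  have "smooth_map EA EA (\<lambda>u. snd (X u))"
    by (rule smooth_map_criterion[OF atlE]) (simp_all add: assms(2,3) smooth_proj)
  then show ?thesis using assms by (simp add: pb_sections_def o_def)
qed

lemma pb_eqI:
  assumes "X \<in> pb" "Y \<in> pb" "\<And>\<theta> u. \<theta> \<in> dual \<Longrightarrow> ev \<theta> X u = ev \<theta> Y u"
  shows "X = Y"
proof
  fix u
  have "snd (X u) = snd (Y u)" by (rule fibre_eqI) (simp_all add: pb_proj assms)
  then show "X u = Y u" using assms(1,2) by (simp add: pb_fst prod_eq_iff)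
qed

lemma ev_padd: "\<theta> \<in> dual \<Longrightarrow> X \<in> pb \<Longrightarrow> Y \<in> pb \<Longrightarrow> ev \<theta> (padd G X Y) u = ev \<theta> X u + ev \<theta> Y u"
  and ev_pmul: "\<theta> \<in> dual \<Longrightarrow> ev \<theta> (pmul G g X) u = g u * ev \<theta> X u"
  and ev_pzero: "\<theta> \<in> dual \<Longrightarrow> ev \<theta> (pzero G) u = 0"
  and ev_hat: "ev \<theta> (hat G s) u = dhat \<theta> (s (\<pi> u))"
  and ev_delta: "ev \<theta> delta u = dhat \<theta> u"
  by (simp_all add: padd_def pmul_def pzero_def hat_def delta_def dual_hat_fadd dual_hat_fscale dual_hat_fzero pb_proj)

lemma padd_pb: "X \<in> pb \<Longrightarrow> Y \<in> pb \<Longrightarrow> padd G X Y \<in> pb"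
  by (rule pbI) (simp_all add: ev_padd Cinf_add[OF atlE] pb_smooth, simp_all add: padd_def pb_proj proj_fadd)

lemma pmul_pb: "g \<in> CE \<Longrightarrow> X \<in> pb \<Longrightarrow> pmul G g X \<in> pb"
  by (rule pbI) (simp_all add: ev_pmul Cinf_mult[OF atlE] pb_smooth, simp_all add: pmul_def pb_proj)

lemma pzero_pb: "pzero G \<in> pb"
  by (rule pbI) (simp_all add: ev_pzero Cinf_const[OF atlE], simp_all add: pzero_def)

lemma hat_pb: "s \<in> sec \<Longrightarrow> hat G s \<in> pb"
  by (rule pbI) (simp_all add: ev_hat Cinf_proj[OF section_smooth], simp_all add: hat_def section_proj)

lemma delta_pb: "delta \<in> pb"
  by (rule pbI) (simp_all add: ev_delta dual_hat_smooth, simp_all add: delta_def)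

text \<open>Covers linear forms and, through \<open>ev\<close>, endomorphisms of the module of
  sections; the point u stays explicit so that equalities can be proved one point at a time.\<close>

definition pb_linear :: "(('e \<Rightarrow> 'e \<times> 'e) \<Rightarrow> 'e \<Rightarrow> real) \<Rightarrow> bool" where
  "pb_linear T \<longleftrightarrow> (\<forall>X\<in>pb. \<forall>Y\<in>pb. \<forall>u. T (padd G X Y) u = T X u + T Y u) \<and>
     (\<forall>g\<in>CE. \<forall>X\<in>pb. \<forall>u. T (pmul G g X) u = g u * T X u)"

lemma pb_linearI:
  "(\<And>X Y u. X \<in> pb \<Longrightarrow> Y \<in> pb \<Longrightarrow> T (padd G X Y) u = T X u + T Y u) \<Longrightarrow>
   (\<And>g X u. g \<in> CE \<Longrightarrow> X \<in> pb \<Longrightarrow> T (pmul G g X) u = g u * T X u) \<Longrightarrow> pb_linear T"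
  by (simp add: pb_linear_def)

text \<open>Sums of sections are iterated uses of \<open>padd\<close>; the induction produces Y
  together with its evaluations and its image under T. The empty sum works because the zero section
  is 0 times itself.\<close>

lemma pb_linear_combination:
  assumes T: "pb_linear T" and "finite A" "\<And>b. b \<in> A \<Longrightarrow> c b \<in> CE" "\<And>b. b \<in> A \<Longrightarrow> E b \<in> pb"
  shows "\<exists>Y\<in>pb. (\<forall>\<theta>\<in>dual. \<forall>u. ev \<theta> Y u = (\<Sum>b\<in>A. c b u * ev \<theta> (E b) u)) \<and>
    (\<forall>u. T Y u = (\<Sum>b\<in>A. c b u * T (E b) u))"
  using assms(2-4)
proof (induction A rule: finite_induct)
  case empty
  have "pmul G (\<lambda>_. 0) (pzero G) = pzero G"
    by (rule pb_eqI) (simp_all add: pmul_pb Cinf_const[OF atlE] pzero_pb ev_pmul ev_pzero)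
  then have "T (pzero G) u = 0" for u
    using T Cinf_const[OF atlE, of 0] pzero_pb unfolding pb_linear_def by (metis mult_zero_left)
  then show ?case by (intro bexI[of _ "pzero G"]) (simp_all add: ev_pzero pzero_pb)
next
  case (insert b A)
  then obtain Y where Y: "Y \<in> pb" "\<forall>\<theta>\<in>dual. \<forall>u. ev \<theta> Y u = (\<Sum>b\<in>A. c b u * ev \<theta> (E b) u)"
    "\<forall>u. T Y u = (\<Sum>b\<in>A. c b u * T (E b) u)" by auto
  have E: "E b \<in> pb" "pmul G (c b) (E b) \<in> pb" "c b \<in> CE" using insert.prems pmul_pb by auto
  show ?case
    using insert.hyps Y E T
    by (intro bexI[of _ "padd G (pmul G (c b) (E b)) Y"]) (simp_all add: padd_pb ev_padd ev_pmul pb_linear_def)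
qed

text \<open>The section f X equals \<Sum> \<theta>_b(X) times the basic sections of the frame on all
  of E, since dual sections evaluate both sides alike. Linearity over smooth functions transfers
  this to T.\<close>

lemma pb_expansion:
  assumes F: "frame_at p f e \<theta>" and T: "pb_linear T" and X: "X \<in> pb"
  shows "f (\<pi> u) * T X u = (\<Sum>b\<in>FB. ev (\<theta> b) X u * T (hat G (e b)) u)"
proof -
  note D = frame_atD[OF F]
  have f: "(\<lambda>u. f (\<pi> u)) \<in> CE" by (rule Cinf_proj[OF D(1)])
  obtain Y where Y: "Y \<in> pb" "\<forall>\<tau>\<in>dual. \<forall>u. ev \<tau> Y u = (\<Sum>b\<in>FB. ev (\<theta> b) X u * ev \<tau> (hat G (e b)) u)"
    "\<forall>u. T Y u = (\<Sum>b\<in>FB. ev (\<theta> b) X u * T (hat G (e b)) u)"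
    using pb_linear_combination[OF T, of onb "\<lambda>b u. ev (\<theta> b) X u" "\<lambda>b. hat G (e b)"]
      D(3,4) pb_smooth[OF X] hat_pb by auto
  have "pmul G (\<lambda>u. f (\<pi> u)) X = Y"
    using D(6)[of _ "snd (X _)"] X
    by (intro pb_eqI) (simp_all add: pmul_pb f Y(1,2) ev_pmul ev_hat pb_proj)
  then show ?thesis using T f X Y(3) unfolding pb_linear_def by metis
qed

text \<open>The expansion is read at a point where f = 1. This reduces tensorial identities on E to
  basic sections \<open>hat G s\<close>, on which the Berwald connection and its curvature are
  prescribed.\<close>

lemma pb_linear_eq_0:
  assumes T: "pb_linear T" and z: "\<And>s u. s \<in> sec \<Longrightarrow> T (hat G s) u = 0" and X: "X \<in> pb"
  shows "T X u = 0"
proof -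
  obtain f e \<theta> where F: "frame_at (\<pi> u) f e \<theta>" by (rule frame_exists)
  show ?thesis using pb_expansion[OF F T X, of u] frame_atD(2)[OF F] z[OF frame_atD(3)[OF F]] by simp
qed

definition sec_linear :: "(('m \<Rightarrow> 'e) \<Rightarrow> 'm \<Rightarrow> real) \<Rightarrow> bool" where
  "sec_linear T \<longleftrightarrow> (\<forall>s\<in>sec. \<forall>t\<in>sec. \<forall>p. T (sadd G s t) p = T s p + T t p) \<and>
     (\<forall>g\<in>CM. \<forall>s\<in>sec. \<forall>p. T (smul G g s) p = g p * T s p)"

lemma sec_linear_combination:
  assumes T: "sec_linear T" and "finite A" "\<And>b. b \<in> A \<Longrightarrow> c b \<in> CM" "\<And>b. b \<in> A \<Longrightarrow> e b \<in> sec"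
  shows "\<exists>t\<in>sec. (\<forall>\<theta>\<in>dual. \<forall>p. dhat \<theta> (t p) = (\<Sum>b\<in>A. c b p * dhat \<theta> (e b p))) \<and>
    (\<forall>p. T t p = (\<Sum>b\<in>A. c b p * T (e b) p))"
  using assms(2-4)
proof (induction A rule: finite_induct)
  case empty
  have "smul G (\<lambda>_. 0) (szero G) = szero G"
    by (rule section_eqI) (simp_all add: smul_section Cinf_const[OF atlM] szero_section dhat_smul dhat_szero)
  then have "T (szero G) p = 0" for p
    using T Cinf_const[OF atlM, of 0] szero_section unfolding sec_linear_def by (metis mult_zero_left)
  then show ?case by (intro bexI[of _ "szero G"]) (simp_all add: dhat_szero szero_section)
next
  case (insert b A)
  then obtain t where t: "t \<in> sec" "\<forall>\<theta>\<in>dual. \<forall>p. dhat \<theta> (t p) = (\<Sum>b\<in>A. c b p * dhat \<theta> (e b p))"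
    "\<forall>p. T t p = (\<Sum>b\<in>A. c b p * T (e b) p)" by auto
  have E: "e b \<in> sec" "smul G (c b) (e b) \<in> sec" "c b \<in> CM" using insert.prems smul_section by auto
  show ?case
    using insert.hyps t E T
    by (intro bexI[of _ "sadd G (smul G (c b) (e b)) t"]) (simp_all add: sadd_section dhat_sadd dhat_smul sec_linear_def)
qed

lemma sec_expansion:
  assumes F: "frame_at p f e \<theta>" and T: "sec_linear T" and s: "s \<in> sec"
  shows "f q * T s q = (\<Sum>b\<in>FB. dhat (\<theta> b) (s q) * T (e b) q)"
proof -
  note D = frame_atD[OF F]
  obtain t where t: "t \<in> sec" "\<forall>\<tau>\<in>dual. \<forall>p. dhat \<tau> (t p) = (\<Sum>b\<in>FB. dhat (\<theta> b) (s p) * dhat \<tau> (e b p))"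
    "\<forall>p. T t p = (\<Sum>b\<in>FB. dhat (\<theta> b) (s p) * T (e b) p)"
    using sec_linear_combination[OF T, of onb "\<lambda>b p. dhat (\<theta> b) (s p)" e]
      D(3,4) section_smooth[OF s] by auto
  have "smul G f s = t"
    using D(6)[of _ "s _"] s
    by (intro section_eqI) (simp_all add: smul_section D(1) t(1,2) dhat_smul section_proj)
  then show ?thesis using T D(1) s t(3) unfolding sec_linear_def by metis
qed

lemma section_with_values:
  assumes F: "frame_at p f e \<theta>"
  shows "\<exists>s\<in>sec. \<forall>\<tau>\<in>dual. \<forall>q. dhat \<tau> (s q) = (\<Sum>b\<in>FB. c b * dhat \<tau> (e b q))"
proof -
  have "sec_linear (\<lambda>s p. 0)" by (simp add: sec_linear_def)
  from sec_linear_combination[OF this, of onb "\<lambda>b p. c b" e] frame_atD(3)[OF F] Cinf_const[OF atlM]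
  show ?thesis by auto
qed

lemma section_through: "\<exists>s\<in>sec. s (\<pi> u) = u"
proof -
  obtain f e \<theta> where F: "frame_at (\<pi> u) f e \<theta>" by (rule frame_exists)
  obtain s where s: "s \<in> sec" "\<forall>\<tau>\<in>dual. \<forall>q. dhat \<tau> (s q) = (\<Sum>b\<in>FB. dhat (\<theta> b) u * dhat \<tau> (e b q))"
    using section_with_values[OF F, of "\<lambda>b. dhat (\<theta> b) u"] by blast
  have "s (\<pi> u) = u"
    by (rule fibre_eqI) (use s frame_atD(6)[OF F, of _ u] frame_atD(2)[OF F] in \<open>simp_all add: section_proj\<close>)
  then show ?thesis using s(1) by blast
qed

lemma dual_eqI:
  assumes "\<theta> \<in> dual" "\<theta>' \<in> dual" "\<And>s. s \<in> sec \<Longrightarrow> dual_pair \<theta> s = dual_pair \<theta>' s"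
  shows "\<theta> = \<theta>'"
proof (intro ext)
  fix p u
  show "\<theta> p u = \<theta>' p u"
  proof (cases "\<pi> u = p")
    case True
    obtain s where "s \<in> sec" "s (\<pi> u) = u" using section_through by blast
    then show ?thesis using True fun_cong[OF assms(3), of s p] by (simp add: dual_pair_def)
  qed (simp add: dual_off_fibre assms)
qed

text \<open>By \<open>sec_expansion\<close> the number P s p depends only on s p, so P induces a
  function on each fibre through any section passing through a given vector. Its linearity comes
  from comparing sections with equal values at a point. This supplies the existence part for
  \<open>lie_dual\<close>.\<close>

lemma dual_from_form:
  assumes P: "sec_linear P" and sm: "\<And>s. s \<in> sec \<Longrightarrow> P s \<in> CM"
  shows "\<exists>\<theta>\<in>dual. \<forall>s\<in>sec. dual_pair \<theta> s = P s"
proof -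
  have loc: "P s p = P t p" if st: "s \<in> sec" "t \<in> sec" "s p = t p" for s t p
  proof -
    obtain f e \<theta> where F: "frame_at p f e \<theta>" by (rule frame_exists)
    show ?thesis
      using sec_expansion[OF F P st(1), of p] sec_expansion[OF F P st(2), of p] st(3) frame_atD(2)[OF F] by simp
  qed
  define \<sigma> where "\<sigma> u = (SOME s. s \<in> sec \<and> s (\<pi> u) = u)" for u
  have \<sigma>: "\<sigma> u \<in> sec" "\<sigma> u (\<pi> u) = u" for u
  proof -
    have "\<exists>s. s \<in> sec \<and> s (\<pi> u) = u" using section_through[of u] by blast
    from someI_ex[OF this] have "\<sigma> u \<in> sec \<and> \<sigma> u (\<pi> u) = u" unfolding \<sigma>_def .
    then show "\<sigma> u \<in> sec" "\<sigma> u (\<pi> u) = u" by auto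
  qed
  define \<theta> where "\<theta> p u = (if \<pi> u = p then P (\<sigma> u) p else 0)" for p u
  have val: "dual_pair \<theta> s = P s" if "s \<in> sec" for s
    using that loc[OF \<sigma>(1) that] \<sigma>(2)[of "s _"] by (auto simp: dual_pair_def \<theta>_def section_proj fun_eq_iff)
  have "\<theta> (\<pi> u) (fadd G u v) = \<theta> (\<pi> u) u + \<theta> (\<pi> u) v" if uv: "\<pi> u = \<pi> v" for u v
  proof -
    have "P (\<sigma> (fadd G u v)) (\<pi> v) = P (sadd G (\<sigma> u) (\<sigma> v)) (\<pi> v)"
      using \<sigma>(2)[of "fadd G u v"] \<sigma>(2)[of u] \<sigma>(2)[of v] uv
      by (intro loc sadd_section \<sigma>) (simp add: proj_fadd sadd_def)
    then show ?thesis using P \<sigma>(1) uv by (simp add: \<theta>_def proj_fadd sec_linear_def)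
  qed
  moreover have "\<theta> (\<pi> u) (fscale G c u) = c * \<theta> (\<pi> u) u" for c u
  proof -
    have "P (\<sigma> (fscale G c u)) (\<pi> u) = P (smul G (\<lambda>_. c) (\<sigma> u)) (\<pi> u)"
      using \<sigma>(2)[of "fscale G c u"] \<sigma>(2)[of u]
      by (intro loc smul_section \<sigma> Cinf_const atlM) (simp add: smul_def)
    then show ?thesis using P \<sigma>(1) Cinf_const[OF atlM, of c] by (simp add: \<theta>_def sec_linear_def)
  qed
  ultimately have "\<theta> \<in> dual"
    using sm val by (auto simp: dual_sections_def \<theta>_def)
  then show ?thesis using val by blast
qed

section \<open>Pullback sections from functionals on dual sections\<close>

lemma dual_add: "\<theta> \<in> dual \<Longrightarrow> \<tau> \<in> dual \<Longrightarrow> (\<lambda>p u. \<theta> p u + \<tau> p u) \<in> dual"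
  and dual_scale: "g \<in> CM \<Longrightarrow> \<theta> \<in> dual \<Longrightarrow> (\<lambda>p u. g p * \<theta> p u) \<in> dual"
  and dual_zero: "(\<lambda>p u. 0) \<in> dual"
  by (auto simp: dual_sections_def dual_pair_def algebra_simps Cinf_add[OF atlM] Cinf_mult[OF atlM] Cinf_const[OF atlM])

text \<open>Biduality: linearity over base functions makes K at v a form on the dual fibre, hence
  evaluation at the vector \<Sum> K(\<theta>_b)(v) e_b. It will construct the vertical correction of
  the complete lift.\<close>

lemma pb_from_dual:
  assumes add: "\<And>\<theta> \<tau> v. \<theta> \<in> dual \<Longrightarrow> \<tau> \<in> dual \<Longrightarrow> K (\<lambda>p u. \<theta> p u + \<tau> p u) v = K \<theta> v + (K \<tau> v :: real)"
    and scale: "\<And>g \<theta> v. g \<in> CM \<Longrightarrow> \<theta> \<in> dual \<Longrightarrow> K (\<lambda>p u. g p * \<theta> p u) v = g (\<pi> v) * K \<theta> v"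
    and sm: "\<And>\<theta>. \<theta> \<in> dual \<Longrightarrow> K \<theta> \<in> CE"
  shows "\<exists>X\<in>pb. \<forall>\<theta>\<in>dual. \<forall>v. ev \<theta> X v = K \<theta> v"
proof -
  have sum: "(\<lambda>p u. \<Sum>b\<in>A. g b p * \<theta> b p u) \<in> dual \<and>
      K (\<lambda>p u. \<Sum>b\<in>A. g b p * \<theta> b p u) v = (\<Sum>b\<in>A. g b (\<pi> v) * K (\<theta> b) v)"
    if "finite A" "\<And>b. b \<in> A \<Longrightarrow> g b \<in> CM" "\<And>b. b \<in> A \<Longrightarrow> \<theta> b \<in> dual" for A :: "'f set" and g \<theta> v
    using that
  proof (induction A rule: finite_induct)
    case empty
    then show ?case using scale[OF Cinf_const[OF atlM, of 0] dual_zero] dual_zero by simp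
  next
    case (insert b A)
    then show ?case
      using add[of "\<lambda>p u. g b p * \<theta> b p u" "\<lambda>p u. \<Sum>b\<in>A. g b p * \<theta> b p u"] scale[of "g b" "\<theta> b"]
      by (simp add: dual_add dual_scale)
  qed
  have "\<exists>w. \<pi> w = \<pi> v \<and> (\<forall>\<tau>\<in>dual. dhat \<tau> w = K \<tau> v)" for v
  proof -
    obtain f e \<theta> where F: "frame_at (\<pi> v) f e \<theta>" by (rule frame_exists)
    note D = frame_atD[OF F]
    obtain s where s: "s \<in> sec" "\<forall>\<tau>\<in>dual. \<forall>q. dhat \<tau> (s q) = (\<Sum>b\<in>FB. K (\<theta> b) v * dhat \<tau> (e b q))"
      using section_with_values[OF F, of "\<lambda>b. K (\<theta> b) v"] by blast
    have "K \<tau> v = (\<Sum>b\<in>FB. K (\<theta> b) v * dhat \<tau> (e b (\<pi> v)))" if t: "\<tau> \<in> dual" for \<tau>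
    proof -
      \<comment> \<open>The frame identity read in the dual bundle, f \<tau> = \<Sum> \<tau>(e_b)
        \<theta>_b; the coefficients are base functions, so K can be applied termwise.\<close>
      have "(\<lambda>p u. f p * \<tau> p u) = (\<lambda>p u. \<Sum>b\<in>FB. dhat \<tau> (e b p) * \<theta> b p u)"
      proof (intro ext)
        fix p u
        show "f p * \<tau> p u = (\<Sum>b\<in>FB. dhat \<tau> (e b p) * \<theta> b p u)"
        proof (cases "\<pi> u = p")
          case True
          then show ?thesis using D(6)[OF t, of u] by (simp add: dual_hat_def mult.commute)
        qed (simp add: dual_off_fibre t D(4))
      qed
      then have "f (\<pi> v) * K \<tau> v = (\<Sum>b\<in>FB. dhat \<tau> (e b (\<pi> v)) * K (\<theta> b) v)"
        using sum[of onb "\<lambda>b p. dhat \<tau> (e b p)" \<theta> v] scale[OF D(1) t, of v] section_smooth[OF D(3) t] D(4) by auto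
      then show ?thesis using D(2) by (simp add: mult.commute)
    qed
    then show ?thesis using s by (intro exI[of _ "s (\<pi> v)"]) (simp add: section_proj)
  qed
  then obtain w where w: "\<And>v. \<pi> (w v) = \<pi> v" "\<And>v \<tau>. \<tau> \<in> dual \<Longrightarrow> dhat \<tau> (w v) = K \<tau> v" by metis
  have "(\<lambda>v. (v, w v)) \<in> pb" by (rule pbI) (simp_all add: w sm)
  then show ?thesis using w by (intro bexI[of _ "\<lambda>v. (v, w v)"]) auto
qed

end

section \<open>Derivatives along the fibres\<close>

context vbundle
begin

definition vderiv :: "('e \<Rightarrow> real) \<Rightarrow> 'e \<Rightarrow> 'e \<Rightarrow> real" where
  "vderiv F u w = deriv (\<lambda>t. F (fadd G u (fscale G t w))) 0"

text \<open>In a bundle chart the curve t \<mapsto> u + t w is a straight line with direction (0,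
  \<Phi> w), so the chain rule gives a Frechet derivative, which is linear in w.\<close>

lemma vderiv_chart:
  assumes F: "F \<in> CE" and U: "(U, \<phi>) \<in> MA" and V: "(V, \<Phi>) \<in> trivs G"
    and u: "\<pi> u \<in> U \<inter> V" "\<pi> w = \<pi> u"
  defines "g \<equiv> F \<circ> inv_into (\<pi> -` (U \<inter> V)) (bchart \<phi> \<Phi>)"
  shows "((\<lambda>t. F (fadd G u (fscale G t w))) has_real_derivative
      fderiv g (\<phi> (\<pi> u), \<Phi> u) (0, \<Phi> w)) (at 0)"
    and "vderiv F u w = fderiv g (\<phi> (\<pi> u), \<Phi> u) (0, \<Phi> w)"
    and "linear (fderiv g (\<phi> (\<pi> u), \<Phi> u))"
proof -
  note c = E_chart[OF U V]
  have pV: "\<pi> u \<in> V" using u by simp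
  let ?D = "fderiv g (\<phi> (\<pi> u), \<Phi> u)"
  have "smooth_on (bchart \<phi> \<Phi> ` (\<pi> -` (U \<inter> V))) g"
    unfolding g_def by (rule Cinf_chart[OF F c(1)])
  then have D: "(g has_derivative ?D) (at (\<phi> (\<pi> u), \<Phi> u))"
    by (rule smooth_on_has_derivative) (use u in auto)
  then show lin: "linear ?D" by (rule has_derivative_linear)
  have "((\<lambda>t. (\<phi> (\<pi> u), \<Phi> u + t *\<^sub>R \<Phi> w)) has_derivative (\<lambda>t. (0, t *\<^sub>R \<Phi> w))) (at 0)"
    by (auto intro!: derivative_eq_intros)
  then have "((g \<circ> (\<lambda>t. (\<phi> (\<pi> u), \<Phi> u + t *\<^sub>R \<Phi> w))) has_derivative (?D \<circ> (\<lambda>t. (0, t *\<^sub>R \<Phi> w)))) (at 0)"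
    by (rule diff_chain_at) (use D in simp)
  moreover have "(\<lambda>t. F (fadd G u (fscale G t w))) = g \<circ> (\<lambda>t. (\<phi> (\<pi> u), \<Phi> u + t *\<^sub>R \<Phi> w))"
  proof
    fix t
    let ?x = "fadd G u (fscale G t w)"
    have "\<pi> ?x = \<pi> u" "\<Phi> ?x = \<Phi> u + t *\<^sub>R \<Phi> w"
      using u by (simp_all add: proj_fadd triv_fibre(3,4)[OF V pV])
    then show "F ?x = (g \<circ> (\<lambda>t. (\<phi> (\<pi> u), \<Phi> u + t *\<^sub>R \<Phi> w))) t"
      using c(2)[of ?x] u by (simp add: g_def)
  qed
  moreover have "?D \<circ> (\<lambda>t. (0, t *\<^sub>R \<Phi> w)) = (*) (?D (0, \<Phi> w))"
    using linear_scale[OF lin, of _ "(0, \<Phi> w)"] by (auto simp: mult.commute)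
  ultimately show d: "((\<lambda>t. F (fadd G u (fscale G t w))) has_real_derivative ?D (0, \<Phi> w)) (at 0)"
    by (simp add: has_field_derivative_def)
  then show "vderiv F u w = ?D (0, \<Phi> w)"
    unfolding vderiv_def by (rule DERIV_imp_deriv)
qed

lemma vderiv_works:
  assumes "F \<in> CE" "\<pi> w = \<pi> u"
  shows "((\<lambda>t. F (fadd G u (fscale G t w))) has_real_derivative vderiv F u w) (at 0)"
proof -
  obtain U \<phi> where U: "(U, \<phi>) \<in> MA" "\<pi> u \<in> U" using atlas_cover[OF atlM] .
  obtain V \<Phi> where V: "(V, \<Phi>) \<in> trivs G" "\<pi> u \<in> V" by (rule triv_cover)
  show ?thesis using vderiv_chart(1,2)[OF assms(1) U(1) V(1) _ assms(2)] U(2) V(2) by simp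
qed

lemma vderiv_fscale:
  assumes "F \<in> CE" "\<pi> w = \<pi> u"
  shows "vderiv F u (fscale G c w) = c * vderiv F u w"
proof -
  obtain U \<phi> where U: "(U, \<phi>) \<in> MA" "\<pi> u \<in> U" using atlas_cover[OF atlM] .
  obtain V \<Phi> where V: "(V, \<Phi>) \<in> trivs G" "\<pi> u \<in> V" by (rule triv_cover)
  have uUV: "\<pi> u \<in> U \<inter> V" using U V by simp
  note ch = vderiv_chart(2)[OF assms(1) U(1) V(1) uUV] vderiv_chart(3)[OF assms(1) U(1) V(1) uUV refl]
  have "\<Phi> (fscale G c w) = c *\<^sub>R \<Phi> w" using assms by (simp add: triv_fibre(4)[OF V])
  then show ?thesis
    using linear_scale[OF ch(2), of c "(0, \<Phi> w)"] assms by (simp add: ch(1))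
qed

text \<open>The direction varies with u, while Frechet derivatives are known to be smooth for fixed
  directions; it is expanded in \<open>onb\<close> as in \<open>Ck_on_compose\<close>.\<close>

lemma vderiv_smooth:
  assumes F: "F \<in> CE" and X: "X \<in> pb"
  shows "(\<lambda>u. vderiv F u (snd (X u))) \<in> CE"
proof (rule Cinf_local[OF atlE])
  fix u
  obtain U \<phi> where U: "(U, \<phi>) \<in> MA" "\<pi> u \<in> U" using atlas_cover[OF atlM] .
  obtain V \<Phi> where V: "(V, \<Phi>) \<in> trivs G" "\<pi> u \<in> V" by (rule triv_cover)
  let ?W = "\<pi> -` (U \<inter> V)" and ?c = "bchart \<phi> \<Phi>"
  note c = E_chart[OF U(1) V(1)]
  note cE = atlas_chart[OF atlE c(1)]
  let ?g = "F \<circ> inv_into ?W ?c" and ?y = "\<lambda>z. \<Phi> (snd (X (inv_into ?W ?c z)))"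
  have "smooth_on (?c ` ?W) (?c \<circ> (snd \<circ> X) \<circ> inv_into ?W ?c)"
    by (rule smooth_map_chart[OF _ c(1) c(1)]) (use X pb_proj[OF X] in \<open>auto simp: pb_sections_def\<close>)
  from smooth_on_bounded_linear[OF cE(2) bounded_linear_snd this]
  have y: "smooth_on (?c ` ?W) ?y" by (simp add: o_def)
  have s: "smooth_on (?c ` ?W) (\<lambda>z. \<Sum>b\<in>onb. (?y z \<bullet> b) *\<^sub>R fderiv ?g z (0, b))"
    by (intro smooth_on_sum smooth_on_scaleR smooth_on_frechet Cinf_chart[OF F c(1)] cE(2) finite_onb
        smooth_on_bounded_linear[OF cE(2) bounded_linear_inner_left y])
  have "smooth_on (?c ` ?W) ((\<lambda>u. vderiv F u (snd (X u))) \<circ> inv_into ?W ?c)"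
  proof (rule smooth_on_cong[OF cE(2) _ s])
    fix z assume "z \<in> ?c ` ?W"
    then obtain v where v: "\<pi> v \<in> U \<inter> V" "z = ?c v" by blast
    let ?D = "fderiv ?g (\<phi> (\<pi> v), \<Phi> v)"
    note ch = vderiv_chart(2,3)[OF F U(1) V(1) v(1) pb_proj[OF X]]
    have "linear (\<lambda>y. ?D (0, y))"
      using linear_compose[OF bounded_linear.linear[OF bounded_linear_Pair[OF bounded_linear_zero bounded_linear_ident]] ch(2)]
      by (simp add: o_def)
    from linear_onb_expansion[OF this, of "\<Phi> (snd (X v))"]
    show "(\<Sum>b\<in>onb. (?y z \<bullet> b) *\<^sub>R fderiv ?g z (0, b)) =
        ((\<lambda>u. vderiv F u (snd (X u))) \<circ> inv_into ?W ?c) z"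
      using v(1) by (simp add: v(2) c(2) ch(1) del: vimage_Int)
  qed
  then show "smooth_near EA (\<lambda>u. vderiv F u (snd (X u))) u"
    by (rule smooth_nearI[OF c(1) cE(1), rotated 2]) (use U V in auto)
qed

lemma vderiv_proj: "\<pi> w = \<pi> u \<Longrightarrow> vderiv (\<lambda>v. g (\<pi> v)) u w = 0"
  by (simp add: vderiv_def proj_fadd)

lemma vderiv_dual_hat: "\<theta> \<in> dual \<Longrightarrow> \<pi> w = \<pi> u \<Longrightarrow> vderiv (dhat \<theta>) u w = dhat \<theta> w"
  unfolding vderiv_def
  by (rule DERIV_imp_deriv) (auto simp: dual_hat_fadd dual_hat_fscale intro!: derivative_eq_intros)

lemma fadd_fscale_0: "\<pi> w = \<pi> u \<Longrightarrow> fadd G u (fscale G 0 w) = u"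
  by (rule fibre_eqI) (simp_all add: proj_fadd dual_hat_fadd dual_hat_fscale)

lemma vderiv_add: "F \<in> CE \<Longrightarrow> F' \<in> CE \<Longrightarrow> \<pi> w = \<pi> u \<Longrightarrow>
    vderiv (\<lambda>x. F x + F' x) u w = vderiv F u w + vderiv F' u w"
  by (subst vderiv_def) (intro DERIV_imp_deriv DERIV_add vderiv_works)

lemma vderiv_cmult: "F \<in> CE \<Longrightarrow> \<pi> w = \<pi> u \<Longrightarrow> vderiv (\<lambda>x. c * F x) u w = c * vderiv F u w"
  by (subst vderiv_def) (intro DERIV_imp_deriv DERIV_cmult vderiv_works)

lemma vderiv_mult: "F \<in> CE \<Longrightarrow> F' \<in> CE \<Longrightarrow> \<pi> w = \<pi> u \<Longrightarrow>
    vderiv (\<lambda>x. F x * F' x) u w = F u * vderiv F' u w + F' u * vderiv F u w"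
  using DERIV_mult[OF vderiv_works[of F w u] vderiv_works[of F' w u]]
  by (subst vderiv_def) (intro DERIV_imp_deriv, simp add: fadd_fscale_0 algebra_simps)

lemma vderiv_tangent:
  assumes "\<pi> w = \<pi> u"
  shows "(u, \<lambda>F. if F \<in> CE then vderiv F u w else 0) \<in> tangent_space EA u"
  using assms unfolding tangent_space_def
  by (auto simp: vderiv_add vderiv_cmult vderiv_mult Cinf_add[OF atlE] Cinf_cmult[OF atlE] Cinf_mult[OF atlE])

end

section \<open>The prolongation\<close>

locale algebroid =
  fixes G :: "('m::{t2_space, second_countable_topology}, 'a::finite_dim_inner,
    'e::{t2_space, second_countable_topology}, 'f::finite_dim_inner) algebroid_data"
    and br :: "('e \<Rightarrow> 'e \<times> 'e tvec) \<Rightarrow> ('e \<Rightarrow> 'e \<times> 'e tvec) \<Rightarrow> ('e \<Rightarrow> 'e \<times> 'e tvec)"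
  assumes alg: "lie_algebroid G" and pbr: "prolongation_bracket G br"

sublocale algebroid \<subseteq> vbundle G
  by unfold_locales (use alg in \<open>simp add: lie_algebroid_def\<close>)

context algebroid
begin

abbreviation "pr \<equiv> prol_sections G"
abbreviation "\<rho> w g \<equiv> snd (anchor G w) g"
abbreviation "LD \<equiv> lie_dual G"
abbreviation "clift \<equiv> complete_lift G"
abbreviation "nv \<equiv> nabla_v G br"
abbreviation "jv \<theta> \<zeta> u \<equiv> dhat \<theta> (fst (\<zeta> u))"
abbreviation "im X \<equiv> imap G \<circ> X"

section \<open>The anchor, and sections of the prolongation as derivations\<close>

lemma anchor_tangent: "anchor G u \<in> tangent_space MA (\<pi> u)"
  using alg by (simp add: lie_algebroid_def)

lemma anchor_smooth: "g \<in> CM \<Longrightarrow> (\<lambda>u. \<rho> u g) \<in> CE"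
  using alg by (simp add: lie_algebroid_def)

lemma anchor_fst: "fst (anchor G u) = \<pi> u"
  using anchor_tangent[of u] by (auto simp: tangent_space_def)

lemma anchor_off: "g \<notin> CM \<Longrightarrow> \<rho> u g = 0"
  using anchor_tangent[of u] by (auto simp: tangent_space_def)

lemma anchor_fadd: "\<pi> u = \<pi> v \<Longrightarrow> \<rho> (fadd G u v) g = \<rho> u g + \<rho> v g"
  and anchor_fscale: "\<rho> (fscale G c u) g = c * \<rho> u g"
  using alg by (simp_all add: lie_algebroid_def tadd_def tscale_def)

lemma anchor_fzero: "\<rho> (fzero G p) g = 0"
  using anchor_fadd[of "fzero G p" "fzero G p" g] fadd_fzero[of "fzero G p" p] by simp

lemma tangent_derivation:
  assumes "z \<in> tangent_space A p"
  shows "fst z = p" "f \<notin> Cinf A \<Longrightarrow> snd z f = 0"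
    "f \<in> Cinf A \<Longrightarrow> g \<in> Cinf A \<Longrightarrow> snd z (\<lambda>x. f x + g x) = snd z f + snd z g"
    "f \<in> Cinf A \<Longrightarrow> snd z (\<lambda>x. c * f x) = c * snd z f"
    "f \<in> Cinf A \<Longrightarrow> g \<in> Cinf A \<Longrightarrow> snd z (\<lambda>x. f x * g x) = f p * snd z g + g p * snd z f"
  using assms by (auto simp: tangent_space_def)

text \<open>Both derivations vanish on functions that are not smooth, so only smooth functions of
  the base are left to compare.\<close>

lemma pushforward_iff:
  assumes "z \<in> tangent_space EA v"
  shows "anchor G w = pushforward EA \<pi> MA z \<longleftrightarrow>
    \<pi> w = \<pi> v \<and> (\<forall>g\<in>CM. snd z (\<lambda>u. g (\<pi> u)) = \<rho> w g)"
proof -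
  have "anchor G w = (\<pi> w, snd (anchor G w))" by (simp add: prod_eq_iff anchor_fst)
  then show ?thesis
    using anchor_off[of _ w] tangent_derivation(1)[OF assms]
    by (auto simp: pushforward_def prod_eq_iff fun_eq_iff o_def anchor_fst)
qed

lemma pr_facts:
  assumes "\<zeta> \<in> pr"
  shows pr_tangent: "snd (\<zeta> v) \<in> tangent_space EA v"
    and pr_fst: "fst (snd (\<zeta> v)) = v" and pr_proj: "\<pi> (fst (\<zeta> v)) = \<pi> v"
    and pr_act_base: "g \<in> CM \<Longrightarrow> lact \<zeta> (\<lambda>u. g (\<pi> u)) v = \<rho> (fst (\<zeta> v)) g"
    and pr_act_smooth: "F \<in> CE \<Longrightarrow> lact \<zeta> F \<in> CE"
    and pr_vector_field: "snd \<circ> \<zeta> \<in> vector_fields EA"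
    and pr_jv_smooth: "\<theta> \<in> dual \<Longrightarrow> (\<lambda>u. jv \<theta> \<zeta> u) \<in> CE"
    and pr_related: "anchor G (fst (\<zeta> v)) = pushforward EA \<pi> MA (snd (\<zeta> v))"
proof -
  have z: "\<zeta> v \<in> prolongation G \<and> fst (snd (\<zeta> v)) = v"
    and sm: "smooth_map EA EA (fst \<circ> \<zeta>)"
    and vf: "snd \<circ> \<zeta> \<in> vector_fields EA" using assms by (auto simp: prol_sections_def)
  show "snd \<circ> \<zeta> \<in> vector_fields EA" by fact
  show t: "snd (\<zeta> v) \<in> tangent_space EA v" and "fst (snd (\<zeta> v)) = v"
    and r: "anchor G (fst (\<zeta> v)) = pushforward EA \<pi> MA (snd (\<zeta> v))"
    using z by (auto simp: prolongation_def split_def)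
  then show "\<pi> (fst (\<zeta> v)) = \<pi> v" "g \<in> CM \<Longrightarrow> lact \<zeta> (\<lambda>u. g (\<pi> u)) v = \<rho> (fst (\<zeta> v)) g"
    using pushforward_iff[OF t, of "fst (\<zeta> v)"] by (auto simp: lact_def vf_act_def)
  show "F \<in> CE \<Longrightarrow> lact \<zeta> F \<in> CE" using vf by (simp add: vector_fields_def lact_def)
  show "\<theta> \<in> dual \<Longrightarrow> (\<lambda>u. jv \<theta> \<zeta> u) \<in> CE"
    using Cinf_compose[OF atlE atlE sm dual_hat_smooth] by simp
qed

lemma lact_apply: "lact \<zeta> F u = snd (snd (\<zeta> u)) F"
  by (simp add: lact_def vf_act_def)

lemma prI:
  assumes t: "\<And>v. snd (\<zeta> v) \<in> tangent_space EA v" and p: "\<And>v. \<pi> (fst (\<zeta> v)) = \<pi> v"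
    and a: "\<And>g v. g \<in> CM \<Longrightarrow> lact \<zeta> (\<lambda>u. g (\<pi> u)) v = \<rho> (fst (\<zeta> v)) g"
    and s: "\<And>\<theta>. \<theta> \<in> dual \<Longrightarrow> (\<lambda>u. jv \<theta> \<zeta> u) \<in> CE" and l: "\<And>F. F \<in> CE \<Longrightarrow> lact \<zeta> F \<in> CE"
  shows "\<zeta> \<in> pr"
proof -
  have "anchor G (fst (\<zeta> v)) = pushforward EA \<pi> MA (snd (\<zeta> v))" for v
    using pushforward_iff[OF t, of "fst (\<zeta> v)"] p a by (simp add: lact_apply)
  moreover have f: "fst (snd (\<zeta> v)) = v" for v using tangent_derivation(1)[OF t] .
  ultimately have "\<zeta> v \<in> prolongation G" for v
    using t[of v] by (simp add: prolongation_def split_def)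
  moreover have "smooth_map EA EA (fst \<circ> \<zeta>)"
    using smooth_map_criterion[OF atlE, of "fst \<circ> \<zeta>"] s by (simp add: p smooth_proj)
  moreover have "snd \<circ> \<zeta> \<in> vector_fields EA"
    using t l by (simp add: vector_fields_def lact_def)
  ultimately show ?thesis using f by (simp add: prol_sections_def)
qed

lemma pr_eqI:
  assumes "\<zeta> \<in> pr" "\<omega> \<in> pr" "\<And>\<theta> u. \<theta> \<in> dual \<Longrightarrow> jv \<theta> \<zeta> u = jv \<theta> \<omega> u"
    "\<And>F u. F \<in> CE \<Longrightarrow> lact \<zeta> F u = lact \<omega> F u"
  shows "\<zeta> = \<omega>"
proof
  fix u
  have "fst (\<zeta> u) = fst (\<omega> u)" by (rule fibre_eqI) (simp_all add: pr_proj assms)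
  moreover have "snd (snd (\<zeta> u)) F = snd (snd (\<omega> u)) F" for F
    using assms(4)[of F u] tangent_derivation(2)[OF pr_tangent[OF assms(1)], of F u]
      tangent_derivation(2)[OF pr_tangent[OF assms(2)], of F u]
    by (cases "F \<in> CE") (simp_all add: lact_apply)
  ultimately show "\<zeta> u = \<omega> u" using assms(1,2) by (auto simp: prod_eq_iff pr_fst)
qed

lemma lact_add: "\<zeta> \<in> pr \<Longrightarrow> F \<in> CE \<Longrightarrow> F' \<in> CE \<Longrightarrow> lact \<zeta> (\<lambda>x. F x + F' x) u = lact \<zeta> F u + lact \<zeta> F' u"
  and lact_cmult: "\<zeta> \<in> pr \<Longrightarrow> F \<in> CE \<Longrightarrow> lact \<zeta> (\<lambda>x. c * F x) u = c * lact \<zeta> F u"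
  and lact_mult: "\<zeta> \<in> pr \<Longrightarrow> F \<in> CE \<Longrightarrow> F' \<in> CE \<Longrightarrow>
    lact \<zeta> (\<lambda>x. F x * F' x) u = F u * lact \<zeta> F' u + F' u * lact \<zeta> F u"
  using tangent_derivation(3-5)[OF pr_tangent[of \<zeta> u]] by (simp_all add: lact_apply)

lemma lact_const: "\<zeta> \<in> pr \<Longrightarrow> lact \<zeta> (\<lambda>x. c) u = 0"
  using lact_mult[of \<zeta> "\<lambda>x. 1" "\<lambda>x. 1" u] lact_cmult[of \<zeta> "\<lambda>x. 1" c u] Cinf_const[OF atlE, of 1] by simp

lemma lact_diff: "\<zeta> \<in> pr \<Longrightarrow> F \<in> CE \<Longrightarrow> F' \<in> CE \<Longrightarrow> lact \<zeta> (\<lambda>x. F x - F' x) u = lact \<zeta> F u - lact \<zeta> F' u"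
  using lact_add[of \<zeta> F "\<lambda>x. (-1) * F' x" u] lact_cmult[of \<zeta> F' "-1" u] Cinf_cmult[OF atlE, of F' "-1"] by simp

lemma lact_sum:
  assumes "\<zeta> \<in> pr" "finite A" "\<And>i. i \<in> A \<Longrightarrow> F i \<in> CE"
  shows "lact \<zeta> (\<lambda>x. \<Sum>i\<in>A. F i x) u = (\<Sum>i\<in>A. lact \<zeta> (F i) u)"
  using assms(2,3)
proof (induction A rule: finite_induct)
  case (insert i A)
  then show ?case
    using lact_add[OF assms(1), of "F i" "\<lambda>x. \<Sum>i\<in>A. F i x" u] Cinf_sum[OF atlE, of A F] by simp
qed (simp add: lact_const assms(1))

section \<open>The module of sections of the prolongation\<close>

lemma lact_ladd: "lact (ladd G \<zeta> \<omega>) F u = lact \<zeta> F u + lact \<omega> F u"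
  and lact_lmul: "lact (lmul G g \<zeta>) F u = g u * lact \<zeta> F u"
  and lact_lzero: "lact (lzero G) F u = 0"
  by (simp_all add: lact_apply ladd_def lmul_def lzero_def tadd_def tscale_def tzero_def)

lemma jv_ladd: "\<theta> \<in> dual \<Longrightarrow> \<zeta> \<in> pr \<Longrightarrow> \<omega> \<in> pr \<Longrightarrow> jv \<theta> (ladd G \<zeta> \<omega>) u = jv \<theta> \<zeta> u + jv \<theta> \<omega> u"
  and jv_lmul: "\<theta> \<in> dual \<Longrightarrow> jv \<theta> (lmul G g \<zeta>) u = g u * jv \<theta> \<zeta> u"
  and jv_lzero: "\<theta> \<in> dual \<Longrightarrow> jv \<theta> (lzero G) u = 0"
  by (simp_all add: ladd_def lmul_def lzero_def dual_hat_fadd dual_hat_fscale dual_hat_fzero pr_proj)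

lemma ladd_pr:
  assumes "\<zeta> \<in> pr" "\<omega> \<in> pr"
  shows "ladd G \<zeta> \<omega> \<in> pr"
proof (rule prI)
  note t = assms[THEN pr_tangent]
  show "snd (ladd G \<zeta> \<omega> v) \<in> tangent_space EA v" for v
    using t(1)[of v] t(2)[of v] by (auto simp: tangent_space_def ladd_def tadd_def algebra_simps)
  show "\<pi> (fst (ladd G \<zeta> \<omega> v)) = \<pi> v" for v by (simp add: ladd_def proj_fadd pr_proj assms)
  show "lact (ladd G \<zeta> \<omega>) (\<lambda>u. g (\<pi> u)) v = \<rho> (fst (ladd G \<zeta> \<omega> v)) g" if "g \<in> CM" for g v
    using that assms unfolding lact_ladd by (simp add: pr_act_base ladd_def anchor_fadd pr_proj)
  show "(\<lambda>u. jv \<theta> (ladd G \<zeta> \<omega>) u) \<in> CE" if "\<theta> \<in> dual" for \<theta>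
    using that assms by (simp add: jv_ladd Cinf_add[OF atlE] pr_jv_smooth)
  show "lact (ladd G \<zeta> \<omega>) F \<in> CE" if "F \<in> CE" for F
  proof -
    have "lact (ladd G \<zeta> \<omega>) F = (\<lambda>u. lact \<zeta> F u + lact \<omega> F u)" by (simp add: fun_eq_iff lact_ladd)
    then show ?thesis using that assms by (simp add: Cinf_add[OF atlE] pr_act_smooth)
  qed
qed

lemma lmul_pr:
  assumes "h \<in> CE" "\<zeta> \<in> pr"
  shows "lmul G h \<zeta> \<in> pr"
proof (rule prI)
  note t = pr_tangent[OF assms(2)]
  show "snd (lmul G h \<zeta> v) \<in> tangent_space EA v" for v
    using t[of v] by (auto simp: tangent_space_def lmul_def tscale_def algebra_simps)
  show "\<pi> (fst (lmul G h \<zeta> v)) = \<pi> v" for v by (simp add: lmul_def pr_proj assms)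
  show "lact (lmul G h \<zeta>) (\<lambda>u. g (\<pi> u)) v = \<rho> (fst (lmul G h \<zeta> v)) g" if "g \<in> CM" for g v
    using that assms unfolding lact_lmul by (simp add: pr_act_base lmul_def anchor_fscale)
  show "(\<lambda>u. jv \<theta> (lmul G h \<zeta>) u) \<in> CE" if "\<theta> \<in> dual" for \<theta>
    using that assms by (simp add: jv_lmul Cinf_mult[OF atlE] pr_jv_smooth)
  show "lact (lmul G h \<zeta>) F \<in> CE" if "F \<in> CE" for F
  proof -
    have "lact (lmul G h \<zeta>) F = (\<lambda>u. h u * lact \<zeta> F u)" by (simp add: fun_eq_iff lact_lmul)
    then show ?thesis using that assms by (simp add: Cinf_mult[OF atlE] pr_act_smooth)
  qed
qed

lemma lzero_pr: "lzero G \<in> pr"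
proof (rule prI)
  show "snd (lzero G v) \<in> tangent_space EA v" for v
    by (auto simp: tangent_space_def lzero_def tzero_def)
  show "lact (lzero G) F \<in> CE" for F
  proof -
    have "lact (lzero G) F = (\<lambda>u. 0)" by (simp add: fun_eq_iff lact_lzero)
    then show ?thesis by (simp add: Cinf_const[OF atlE])
  qed
qed (simp_all add: lact_lzero jv_lzero Cinf_const[OF atlE], simp_all add: lzero_def anchor_fzero)

lemma jmap_pb: "\<zeta> \<in> pr \<Longrightarrow> jmap \<circ> \<zeta> \<in> pb"
  by (rule pbI) (simp_all add: jmap_def split_def pr_fst pr_proj pr_jv_smooth)

lemma ev_jmap [simp]: "snd (jmap z) = fst z"
  by (simp add: jmap_def split_def)

section \<open>The inclusion of vertical sections\<close>

lemma imap_apply: "X \<in> pb \<Longrightarrow> imap G (X u) = (fzero G (\<pi> u), (u, \<lambda>F. if F \<in> CE then vderiv F u (snd (X u)) else 0))"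
  using pb_fst[of X u] by (cases "X u") (simp add: imap_def vderiv_def fun_eq_iff)

lemma lact_im: "X \<in> pb \<Longrightarrow> F \<in> CE \<Longrightarrow> lact (im X) F u = vderiv F u (snd (X u))"
  by (simp add: lact_apply imap_apply)

lemma jv_im: "X \<in> pb \<Longrightarrow> \<theta> \<in> dual \<Longrightarrow> dhat \<theta> (fst (imap G (X u))) = 0"
  by (simp add: imap_apply dual_hat_fzero)

lemma fst_im: "X \<in> pb \<Longrightarrow> fst (imap G (X u)) = szero G (\<pi> u)"
  by (simp add: imap_apply szero_def)

lemma lact_im_proj: "X \<in> pb \<Longrightarrow> g \<in> CM \<Longrightarrow> lact (im X) (\<lambda>u. g (\<pi> u)) u = 0"
  by (simp add: lact_im Cinf_proj vderiv_proj pb_proj)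

lemma im_pr:
  assumes X: "X \<in> pb"
  shows "im X \<in> pr"
proof (rule prI)
  show "snd (im X v) \<in> tangent_space EA v" for v
    using vderiv_tangent[OF pb_proj[OF X]] by (simp add: imap_apply X)
  show "lact (im X) F \<in> CE" if "F \<in> CE" for F
  proof -
    have "lact (im X) F = (\<lambda>u. vderiv F u (snd (X u)))" by (simp add: fun_eq_iff lact_im X that)
    then show ?thesis by (simp add: vderiv_smooth that X)
  qed
  show "lact (im X) (\<lambda>u. g (\<pi> u)) v = \<rho> (fst (im X v)) g" if "g \<in> CM" for g v
    using that lact_im_proj[OF X that] by (simp add: imap_apply X anchor_fzero)
  show "(\<lambda>u. jv \<theta> (im X) u) \<in> CE" if "\<theta> \<in> dual" for \<theta>
    using that by (simp add: jv_im[OF X] Cinf_const[OF atlE])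
qed (simp add: imap_apply X)

lemma lact_im_dual: "X \<in> pb \<Longrightarrow> \<theta> \<in> dual \<Longrightarrow> lact (im X) (dhat \<theta>) u = ev \<theta> X u"
  by (simp add: lact_im dual_hat_smooth vderiv_dual_hat pb_proj)

lemma lact_im_pmul: "X \<in> pb \<Longrightarrow> g \<in> CE \<Longrightarrow> F \<in> CE \<Longrightarrow> lact (im (pmul G g X)) F u = g u * lact (im X) F u"
  by (simp add: lact_im pmul_pb) (simp add: pmul_def vderiv_fscale pb_proj)

lemma im_inj: "X \<in> pb \<Longrightarrow> Y \<in> pb \<Longrightarrow> im X = im Y \<Longrightarrow> X = Y"
  by (rule pb_eqI) (simp_all flip: lact_im_dual)

lemma imap_inv_im: "X \<in> pb \<Longrightarrow> imap_inv G (im X) = X"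
  unfolding imap_inv_def by (rule the_equality) (auto intro: im_inj)

end

section \<open>Brackets and Lie derivatives of dual sections\<close>

text \<open>The abstract \<open>add\<close> comes with no group laws, so the usual polarization of
  b(X + Y, X + Y) = 0 is carried out in the reals, after an additive \<epsilon>.\<close>

lemma lie_bracket_on_skew:
  fixes \<epsilon> :: "'s \<Rightarrow> real"
  assumes L: "lie_bracket_on \<Gamma> add sm zero b"
    and add: "\<And>X Y. X \<in> \<Gamma> \<Longrightarrow> Y \<in> \<Gamma> \<Longrightarrow> add X Y \<in> \<Gamma>" and zz: "add zero zero = zero"
    and \<epsilon>: "\<And>X Y. X \<in> \<Gamma> \<Longrightarrow> Y \<in> \<Gamma> \<Longrightarrow> \<epsilon> (add X Y) = \<epsilon> X + \<epsilon> Y"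
    and XY: "X \<in> \<Gamma>" "Y \<in> \<Gamma>"
  shows "\<epsilon> (b X Y) = - \<epsilon> (b Y X)"
proof -
  have c: "\<And>X Y. X \<in> \<Gamma> \<Longrightarrow> Y \<in> \<Gamma> \<Longrightarrow> b X Y \<in> \<Gamma>" and s: "\<And>X. X \<in> \<Gamma> \<Longrightarrow> b X X = zero"
    and l: "\<And>X Y Z. X \<in> \<Gamma> \<Longrightarrow> Y \<in> \<Gamma> \<Longrightarrow> Z \<in> \<Gamma> \<Longrightarrow> b (add X Y) Z = add (b X Z) (b Y Z)"
    and r: "\<And>X Y Z. X \<in> \<Gamma> \<Longrightarrow> Y \<in> \<Gamma> \<Longrightarrow> Z \<in> \<Gamma> \<Longrightarrow> b X (add Y Z) = add (b X Y) (b X Z)"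
    using L unfolding lie_bracket_on_def by blast+
  have "zero \<in> \<Gamma>" using c[OF XY(1) XY(1)] s[OF XY(1)] by simp
  then have z: "\<epsilon> zero = 0" using \<epsilon>[of zero zero] zz by simp
  have "b (add X Y) (add X Y) = add (add (b X X) (b Y X)) (add (b X Y) (b Y Y))"
    using XY by (simp add: l r add)
  then have "zero = add (add zero (b Y X)) (add (b X Y) zero)" using XY s add by simp
  then have "\<epsilon> zero = \<epsilon> (add (add zero (b Y X)) (add (b X Y) zero))" by simp
  then show ?thesis using XY \<open>zero \<in> \<Gamma>\<close> by (simp add: \<epsilon> add c z)
qed

text \<open>The cyclic identity takes the derivation form after two uses of skew symmetry, one of
  them for the additive functional A \<mapsto> \<epsilon>(b Y A).\<close>

lemma lie_bracket_on_jacobi: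
  fixes \<epsilon> :: "'s \<Rightarrow> real"
  assumes L: "lie_bracket_on \<Gamma> add sm zero b"
    and add: "\<And>X Y. X \<in> \<Gamma> \<Longrightarrow> Y \<in> \<Gamma> \<Longrightarrow> add X Y \<in> \<Gamma>" and zz: "add zero zero = zero"
    and \<epsilon>: "\<And>X Y. X \<in> \<Gamma> \<Longrightarrow> Y \<in> \<Gamma> \<Longrightarrow> \<epsilon> (add X Y) = \<epsilon> X + \<epsilon> Y"
    and X: "X \<in> \<Gamma>" and Y: "Y \<in> \<Gamma>" and Z: "Z \<in> \<Gamma>"
  shows "\<epsilon> (b X (b Y Z)) = \<epsilon> (b (b X Y) Z) + \<epsilon> (b Y (b X Z))"
proof -
  have c: "\<And>X Y. X \<in> \<Gamma> \<Longrightarrow> Y \<in> \<Gamma> \<Longrightarrow> b X Y \<in> \<Gamma>" and s: "\<And>X. X \<in> \<Gamma> \<Longrightarrow> b X X = zero"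
    and r: "\<And>X Y Z. X \<in> \<Gamma> \<Longrightarrow> Y \<in> \<Gamma> \<Longrightarrow> Z \<in> \<Gamma> \<Longrightarrow> b X (add Y Z) = add (b X Y) (b X Z)"
    and j: "\<And>X Y Z. X \<in> \<Gamma> \<Longrightarrow> Y \<in> \<Gamma> \<Longrightarrow> Z \<in> \<Gamma> \<Longrightarrow> add (b X (b Y Z)) (add (b Y (b Z X)) (b Z (b X Y))) = zero"
    using L unfolding lie_bracket_on_def by blast+
  note skew = lie_bracket_on_skew[OF L add zz]
  have "zero \<in> \<Gamma>" using c[OF X X] s[OF X] by simp
  then have z: "\<epsilon> zero = 0" using \<epsilon>[of zero zero] zz by simp
  have "\<epsilon> (b X (b Y Z)) + (\<epsilon> (b Y (b Z X)) + \<epsilon> (b Z (b X Y))) = 0"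
    using X Y Z z by (simp add: add c flip: \<epsilon> j[OF X Y Z])
  moreover have "\<epsilon> (b Y (b Z X)) = - \<epsilon> (b Y (b X Z))"
    by (rule skew[of "\<lambda>A. \<epsilon> (b Y A)" Z X]) (simp_all add: X Y Z r \<epsilon> c)
  moreover have "\<epsilon> (b Z (b X Y)) = - \<epsilon> (b (b X Y) Z)"
    by (rule skew[of \<epsilon>]) (simp_all add: X Y Z \<epsilon> c)
  ultimately show ?thesis by simp
qed

context algebroid
begin

abbreviation "bG \<equiv> bracket G"

lemma bracket_lie: "lie_bracket_on sec (sadd G) (smul G) (szero G) bG"
  and bracket_leibniz: "leibniz_on CM sec (sadd G) (smul G) (\<lambda>s. vf_act (anchor G \<circ> s)) bG"
  using alg by (simp_all add: lie_algebroid_def)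

lemma bracket_sec: "s \<in> sec \<Longrightarrow> t \<in> sec \<Longrightarrow> bG s t \<in> sec"
  using bracket_lie by (simp add: lie_bracket_on_def)

lemma sadd_szero: "sadd G (szero G) (szero G) = szero G"
  by (rule section_eqI) (simp_all add: sadd_section szero_section dhat_sadd dhat_szero)

lemma dhat_bracket_sadd: "\<theta> \<in> dual \<Longrightarrow> r \<in> sec \<Longrightarrow> s \<in> sec \<Longrightarrow> t \<in> sec \<Longrightarrow>
    dhat \<theta> (bG r (sadd G s t) p) = dhat \<theta> (bG r s p) + dhat \<theta> (bG r t p)"
  using bracket_lie by (simp add: lie_bracket_on_def dhat_sadd)

lemma dhat_bracket_smul: "\<theta> \<in> dual \<Longrightarrow> r \<in> sec \<Longrightarrow> s \<in> sec \<Longrightarrow> g \<in> CM \<Longrightarrow>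
    dhat \<theta> (bG r (smul G g s) p) = g p * dhat \<theta> (bG r s p) + \<rho> (r p) g * dhat \<theta> (s p)"
proof -
  assume a: "\<theta> \<in> dual" "r \<in> sec" "s \<in> sec" "g \<in> CM"
  have "bG r (smul G g s) = sadd G (smul G g (bG r s)) (smul G (vf_act (anchor G \<circ> r) g) s)"
    using bracket_leibniz a by (simp add: leibniz_on_def)
  moreover have "dhat \<theta> (sadd G x y p) = dhat \<theta> (x p) + dhat \<theta> (y p)" if "\<pi> (x p) = p" "\<pi> (y p) = p" for x y
    using a(1) that by (simp add: sadd_def dual_hat_fadd)
  ultimately show ?thesis using a
    by (simp add: smul_def section_proj bracket_sec dual_hat_fscale vf_act_def)
qed

lemma dhat_bracket_skew: "\<theta> \<in> dual \<Longrightarrow> s \<in> sec \<Longrightarrow> t \<in> sec \<Longrightarrow> dhat \<theta> (bG s t p) = - dhat \<theta> (bG t s p)"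
  by (rule lie_bracket_on_skew[OF bracket_lie sadd_section sadd_szero, where \<epsilon> = "\<lambda>s. dhat \<theta> (s p)"])
     (simp_all add: dhat_sadd)

lemma dhat_bracket_jacobi: "\<theta> \<in> dual \<Longrightarrow> r \<in> sec \<Longrightarrow> s \<in> sec \<Longrightarrow> t \<in> sec \<Longrightarrow>
    dhat \<theta> (bG r (bG s t) p) = dhat \<theta> (bG (bG r s) t p) + dhat \<theta> (bG s (bG r t) p)"
  by (rule lie_bracket_on_jacobi[OF bracket_lie sadd_section sadd_szero, where \<epsilon> = "\<lambda>s. dhat \<theta> (s p)"])
     (simp_all add: dhat_sadd)

lemma dhat_bracket_szero: "\<theta> \<in> dual \<Longrightarrow> s \<in> sec \<Longrightarrow> dhat \<theta> (bG s (szero G) p) = 0"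
  using dhat_bracket_sadd[of \<theta> s "szero G" "szero G" p] by (simp add: szero_section sadd_szero)

lemma anchor_section_smooth:
  assumes "s \<in> sec" "g \<in> CM"
  shows "(\<lambda>p. \<rho> (s p) g) \<in> CM"
  using Cinf_compose[OF atlM atlE _ anchor_smooth[OF assms(2)], of s] assms(1) by (simp add: sections_def)

lemmas anchor_derivation = tangent_derivation(3-5)[OF anchor_tangent]

text \<open>In \<rho>(\<eta>)(\<theta>(s)) - \<theta>([\<eta>, s]) each term contributes
  (\<rho>(\<eta>) g) \<theta>(s) when s is multiplied by g, and these cancel. The expression is thus
  tensorial in s: \<open>dual_from_form\<close> gives existence and \<open>dual_eqI\<close>
  uniqueness for the definite description.\<close>

lemma lie_dual_facts:
  assumes \<eta>: "\<eta> \<in> sec" and \<theta>: "\<theta> \<in> dual"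
  shows lie_dual_dual: "LD \<eta> \<theta> \<in> dual"
    and dhat_lie_dual: "s \<in> sec \<Longrightarrow> dhat (LD \<eta> \<theta>) (s p) =
      \<rho> (\<eta> p) (\<lambda>q. dhat \<theta> (s q)) - dhat \<theta> (bG \<eta> s p)"
proof -
  let ?P = "\<lambda>s p. \<rho> (\<eta> p) (\<lambda>q. dhat \<theta> (s q)) - dhat \<theta> (bG \<eta> s p)"
  have "sec_linear ?P"
    using \<eta> \<theta>
    by (simp add: sec_linear_def dhat_sadd dhat_smul dhat_bracket_sadd dhat_bracket_smul
        anchor_derivation section_smooth section_proj algebra_simps)
  moreover have "?P s \<in> CM" if "s \<in> sec" for s
    using that \<eta> \<theta> by (intro Cinf_diff atlM anchor_section_smooth section_smooth bracket_sec)
  ultimately obtain \<tau> where \<tau>: "\<tau> \<in> dual" "\<forall>s\<in>sec. dual_pair \<tau> s = ?P s"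
    using dual_from_form by blast
  have P: "?P s = (\<lambda>p. vf_act (anchor G \<circ> \<eta>) (dual_pair \<theta> s) p - dual_pair \<theta> (bG \<eta> s) p)"
    if "s \<in> sec" for s
    using that bracket_sec[OF \<eta> that] by (simp add: fun_eq_iff vf_act_def dhat_section)
  have "LD \<eta> \<theta> = \<tau>"
    unfolding lie_dual_def by (rule the_equality) (use \<tau> P dual_eqI in auto)
  then show "LD \<eta> \<theta> \<in> dual"
    "s \<in> sec \<Longrightarrow> dhat (LD \<eta> \<theta>) (s p) = ?P s p"
    using \<tau> by (auto simp: dhat_section)
qed

lemma dhat_lie_dual_add:
  assumes "\<eta> \<in> sec" "\<theta> \<in> dual" "\<tau> \<in> dual"
  shows "dhat (LD \<eta> (\<lambda>p u. \<theta> p u + \<tau> p u)) v = dhat (LD \<eta> \<theta>) v + dhat (LD \<eta> \<tau>) v"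
proof -
  obtain s where s: "s \<in> sec" "s (\<pi> v) = v" using section_through by blast
  have d: "dhat (\<lambda>p u. \<theta> p u + \<tau> p u) w = dhat \<theta> w + dhat \<tau> w" for w by (simp add: dual_hat_def)
  show ?thesis
    using dhat_lie_dual[OF assms(1) dual_add[OF assms(2,3)] s(1), of "\<pi> v"]
      dhat_lie_dual[OF assms(1,2) s(1), of "\<pi> v"] dhat_lie_dual[OF assms(1,3) s(1), of "\<pi> v"] assms s
    by (simp add: d anchor_derivation section_smooth)
qed

lemma dhat_lie_dual_scale:
  assumes "\<eta> \<in> sec" "\<theta> \<in> dual" "g \<in> CM"
  shows "dhat (LD \<eta> (\<lambda>p u. g p * \<theta> p u)) v =
    g (\<pi> v) * dhat (LD \<eta> \<theta>) v + \<rho> (\<eta> (\<pi> v)) g * dhat \<theta> v"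
proof -
  obtain s where s: "s \<in> sec" "s (\<pi> v) = v" using section_through by blast
  have d: "dhat (\<lambda>p u. g p * \<theta> p u) w = g (\<pi> w) * dhat \<theta> w" for w by (simp add: dual_hat_def)
  have "dhat (LD \<eta> (\<lambda>p u. g p * \<theta> p u)) v =
      \<rho> (\<eta> (\<pi> v)) (\<lambda>q. g q * dhat \<theta> (s q)) - g (\<pi> v) * dhat \<theta> (bG \<eta> s (\<pi> v))"
    using dhat_lie_dual[OF assms(1) dual_scale[OF assms(3,2)] s(1), of "\<pi> v"] assms s
    by (simp add: d section_proj bracket_sec)
  moreover have "dhat (LD \<eta> \<theta>) v =
      \<rho> (\<eta> (\<pi> v)) (\<lambda>q. dhat \<theta> (s q)) - dhat \<theta> (bG \<eta> s (\<pi> v))"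
    using dhat_lie_dual[OF assms(1,2) s(1), of "\<pi> v"] s by simp
  ultimately show ?thesis
    using assms s by (simp only: anchor_derivation section_smooth section_proj) (simp add: algebra_simps)
qed

lemma dhat_lie_dual_szero:
  assumes "\<theta> \<in> dual"
  shows "dhat (LD (szero G) \<theta>) v = 0"
proof -
  obtain s where s: "s \<in> sec" "s (\<pi> v) = v" using section_through by blast
  show ?thesis
    using dhat_lie_dual[OF szero_section assms s(1), of "\<pi> v"] s
      dhat_bracket_skew[OF assms szero_section s(1), of "\<pi> v"] dhat_bracket_szero[OF assms s(1)]
    by (simp add: szero_def anchor_fzero)
qed

section \<open>The bracket of the prolongation\<close>

lemma br_lie: "lie_bracket_on pr (ladd G) (lmul G) (lzero G) br"
  and br_leibniz: "leibniz_on CE pr (ladd G) (lmul G) lact br"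
  using pbr by (simp_all add: prolongation_bracket_def)

lemma br_pr: "\<zeta> \<in> pr \<Longrightarrow> \<omega> \<in> pr \<Longrightarrow> br \<zeta> \<omega> \<in> pr"
  and br_ladd: "\<zeta> \<in> pr \<Longrightarrow> \<omega> \<in> pr \<Longrightarrow> \<kappa> \<in> pr \<Longrightarrow> br \<zeta> (ladd G \<omega> \<kappa>) = ladd G (br \<zeta> \<omega>) (br \<zeta> \<kappa>)"
  and br_lconst: "\<zeta> \<in> pr \<Longrightarrow> \<omega> \<in> pr \<Longrightarrow> br \<zeta> (lmul G (\<lambda>_. c) \<omega>) = lmul G (\<lambda>_. c) (br \<zeta> \<omega>)"
  using br_lie by (simp_all add: lie_bracket_on_def)

lemma br_lmul: "\<zeta> \<in> pr \<Longrightarrow> \<omega> \<in> pr \<Longrightarrow> g \<in> CE \<Longrightarrow>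
    br \<zeta> (lmul G g \<omega>) = ladd G (lmul G g (br \<zeta> \<omega>)) (lmul G (lact \<zeta> g) \<omega>)"
  using br_leibniz by (simp add: leibniz_on_def)

lemma ladd_lzero: "ladd G (lzero G) (lzero G) = lzero G"
  by (rule pr_eqI) (simp_all add: ladd_pr lzero_pr lact_ladd lact_lzero jv_ladd jv_lzero)

lemmas br_skew_eval = lie_bracket_on_skew[OF br_lie ladd_pr ladd_lzero]
lemmas br_jacobi_eval = lie_bracket_on_jacobi[OF br_lie ladd_pr ladd_lzero]

lemma br_jacobi:
  assumes "\<zeta> \<in> pr" "\<omega> \<in> pr" "\<kappa> \<in> pr"
  shows "br \<zeta> (br \<omega> \<kappa>) = ladd G (br (br \<zeta> \<omega>) \<kappa>) (br \<omega> (br \<zeta> \<kappa>))"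
proof (rule pr_eqI)
  show "jv \<theta> (br \<zeta> (br \<omega> \<kappa>)) u = jv \<theta> (ladd G (br (br \<zeta> \<omega>) \<kappa>) (br \<omega> (br \<zeta> \<kappa>))) u" if "\<theta> \<in> dual" for \<theta> u
  proof -
    have "jv \<theta> (br \<zeta> (br \<omega> \<kappa>)) u = jv \<theta> (br (br \<zeta> \<omega>) \<kappa>) u + jv \<theta> (br \<omega> (br \<zeta> \<kappa>)) u"
      by (rule br_jacobi_eval[where \<epsilon> = "\<lambda>\<zeta>. jv \<theta> \<zeta> u"]) (simp_all add: that assms jv_ladd)
    then show ?thesis by (simp add: jv_ladd br_pr that assms)
  qed
  show "lact (br \<zeta> (br \<omega> \<kappa>)) F u = lact (ladd G (br (br \<zeta> \<omega>) \<kappa>) (br \<omega> (br \<zeta> \<kappa>))) F u" for F u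
  proof -
    have "lact (br \<zeta> (br \<omega> \<kappa>)) F u = lact (br (br \<zeta> \<omega>) \<kappa>) F u + lact (br \<omega> (br \<zeta> \<kappa>)) F u"
      by (rule br_jacobi_eval[where \<epsilon> = "\<lambda>\<zeta>. lact \<zeta> F u"]) (simp_all add: assms lact_ladd)
    then show ?thesis by (simp add: lact_ladd)
  qed
qed (simp_all add: br_pr ladd_pr assms)

lemma br_skew:
  assumes "\<zeta> \<in> pr" "\<omega> \<in> pr"
  shows "br \<zeta> \<omega> = lmul G (\<lambda>_. -1) (br \<omega> \<zeta>)"
proof (rule pr_eqI)
  show "jv \<theta> (br \<zeta> \<omega>) u = jv \<theta> (lmul G (\<lambda>_. -1) (br \<omega> \<zeta>)) u" if "\<theta> \<in> dual" for \<theta> u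
  proof -
    have "jv \<theta> (br \<zeta> \<omega>) u = - jv \<theta> (br \<omega> \<zeta>) u"
      by (rule br_skew_eval[where \<epsilon> = "\<lambda>\<zeta>. jv \<theta> \<zeta> u"]) (simp_all add: that assms jv_ladd)
    then show ?thesis by (simp add: jv_lmul that)
  qed
  show "lact (br \<zeta> \<omega>) F u = lact (lmul G (\<lambda>_. -1) (br \<omega> \<zeta>)) F u" for F u
  proof -
    have "lact (br \<zeta> \<omega>) F u = - lact (br \<omega> \<zeta>) F u"
      by (rule br_skew_eval[where \<epsilon> = "\<lambda>\<zeta>. lact \<zeta> F u"]) (simp_all add: assms lact_ladd)
    then show ?thesis by (simp add: lact_lmul)
  qed
qed (simp_all add: br_pr lmul_pr assms Cinf_const[OF atlE])

text \<open>Unlike \<open>projectable\<close>, it names the section of the bundle below, which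
  enters the bracket formulas.\<close>

definition projects_to where
  "projects_to \<zeta> s \<longleftrightarrow> \<zeta> \<in> pr \<and> s \<in> sec \<and> (\<forall>v. fst (\<zeta> v) = s (\<pi> v))"

lemma projects_toD: "projects_to \<zeta> s \<Longrightarrow> \<zeta> \<in> pr" "projects_to \<zeta> s \<Longrightarrow> s \<in> sec"
    "projects_to \<zeta> s \<Longrightarrow> fst (\<zeta> v) = s (\<pi> v)"
  by (simp_all add: projects_to_def)

text \<open>Writing \<zeta> and \<omega> by their two components exposes the form in which the
  bracket of the prolongation is prescribed.\<close>

lemma br_projectable:
  assumes "projects_to \<zeta> s" "projects_to \<omega> t"
  shows "projects_to (br \<zeta> \<omega>) (bG s t)"
    and "F \<in> CE \<Longrightarrow> lact (br \<zeta> \<omega>) F v = lact \<zeta> (lact \<omega> F) v - lact \<omega> (lact \<zeta> F) v"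
proof -
  note z = projects_toD[OF assms(1)] and w = projects_toD[OF assms(2)]
  have "related_to_anchor G (snd \<circ> \<zeta>) s" "related_to_anchor G (snd \<circ> \<omega>) t"
    using pr_related[OF z(1)] pr_related[OF w(1)] z(3) w(3) by (simp_all add: related_to_anchor_def)
  then have "br (\<lambda>v. (s (\<pi> v), (snd \<circ> \<zeta>) v)) (\<lambda>v. (t (\<pi> v), (snd \<circ> \<omega>) v)) =
      (\<lambda>v. (bG s t (\<pi> v), vf_bracket EA (snd \<circ> \<zeta>) (snd \<circ> \<omega>) v))"
    using pbr z w pr_vector_field[OF z(1)] pr_vector_field[OF w(1)]
    unfolding prolongation_bracket_def by blast
  moreover have "(\<lambda>v. (s (\<pi> v), (snd \<circ> \<zeta>) v)) = \<zeta>" "(\<lambda>v. (t (\<pi> v), (snd \<circ> \<omega>) v)) = \<omega>"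
    using z(3) w(3) by (simp_all add: fun_eq_iff prod_eq_iff)
  ultimately have b: "br \<zeta> \<omega> = (\<lambda>v. (bG s t (\<pi> v), vf_bracket EA (snd \<circ> \<zeta>) (snd \<circ> \<omega>) v))"
    by simp
  then show "projects_to (br \<zeta> \<omega>) (bG s t)"
    using br_pr[OF z(1) w(1)] bracket_sec[OF z(2) w(2)] by (simp add: projects_to_def)
  show "F \<in> CE \<Longrightarrow> lact (br \<zeta> \<omega>) F v = lact \<zeta> (lact \<omega> F) v - lact \<omega> (lact \<zeta> F) v"
    by (simp add: b lact_apply vf_bracket_def) (simp add: lact_def)
qed

lemma im_projects: "X \<in> pb \<Longrightarrow> projects_to (im X) (szero G)"
  by (simp add: projects_to_def im_pr szero_section fst_im)

lemma projects_act_base: "projects_to \<zeta> s \<Longrightarrow> g \<in> CM \<Longrightarrow> lact \<zeta> (\<lambda>u. g (\<pi> u)) v = \<rho> (s (\<pi> v)) g"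
  using pr_act_base[of \<zeta> g v] by (simp add: projects_to_def)

end

section \<open>The splitting defined by an Ehresmann connection\<close>

locale connection = algebroid G br
  for G :: "('m::{t2_space, second_countable_topology}, 'a::finite_dim_inner,
    'e::{t2_space, second_countable_topology}, 'f::finite_dim_inner) algebroid_data" and br +
  fixes S :: "'e \<Rightarrow> 'e \<times> 'e tvec"
    and H :: "('e \<Rightarrow> 'e \<times> 'e) \<Rightarrow> ('e \<Rightarrow> 'e \<times> 'e tvec)"
    and V :: "('e \<Rightarrow> 'e \<times> 'e tvec) \<Rightarrow> ('e \<Rightarrow> 'e \<times> 'e)"
  assumes semi: "semispray G S" and conn: "ehresmann_connection G H" and vert: "vertical_map G H V"
begin

lemma H_pr: "X \<in> pb \<Longrightarrow> H X \<in> pr"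
  and H_padd: "X \<in> pb \<Longrightarrow> Y \<in> pb \<Longrightarrow> H (padd G X Y) = ladd G (H X) (H Y)"
  and H_pmul: "g \<in> CE \<Longrightarrow> X \<in> pb \<Longrightarrow> H (pmul G g X) = lmul G g (H X)"
  and jmap_H: "X \<in> pb \<Longrightarrow> jmap \<circ> H X = X"
  using conn by (simp_all add: ehresmann_connection_def module_linear_def)

lemma V_pb: "\<sigma> \<in> pr \<Longrightarrow> V \<sigma> \<in> pb"
  and V_ladd: "\<sigma> \<in> pr \<Longrightarrow> \<tau> \<in> pr \<Longrightarrow> V (ladd G \<sigma> \<tau>) = padd G (V \<sigma>) (V \<tau>)"
  and V_lmul: "g \<in> CE \<Longrightarrow> \<sigma> \<in> pr \<Longrightarrow> V (lmul G g \<sigma>) = pmul G g (V \<sigma>)"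
  and V_im: "X \<in> pb \<Longrightarrow> V (im X) = X"
  and V_kernel: "{\<zeta> \<in> pr. V \<zeta> = pzero G} = H ` pb"
  using vert by (simp_all add: vertical_map_def module_linear_def)

lemma V_H: "X \<in> pb \<Longrightarrow> V (H X) = pzero G"
  using V_kernel by blast

lemma fst_H: "X \<in> pb \<Longrightarrow> fst (H X u) = snd (X u)"
  using fun_cong[OF jmap_H, of X u] by (metis comp_apply ev_jmap)

lemma H_hat_projects: "s \<in> sec \<Longrightarrow> projects_to (H (hat G s)) s"
  by (simp add: projects_to_def H_pr hat_pb fst_H) (simp add: hat_def)

text \<open>The difference of \<sigma> and its vertical part is annihilated by V, hence equals some
  H X; applying j, which kills vertical sections, identifies X with j \<sigma>.\<close>

lemma splitting:
  assumes s: "\<sigma> \<in> pr"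
  shows "\<sigma> = ladd G (im (V \<sigma>)) (H (jmap \<circ> \<sigma>))"
proof -
  have c: "(\<lambda>_. -1) \<in> CE" by (rule Cinf_const[OF atlE])
  note Vs = V_pb[OF s]
  let ?t = "ladd G \<sigma> (lmul G (\<lambda>_. -1) (im (V \<sigma>)))"
  have t: "?t \<in> pr" using s Vs c by (simp add: ladd_pr lmul_pr im_pr)
  have "V ?t = padd G (V \<sigma>) (pmul G (\<lambda>_. -1) (V \<sigma>))"
    using s Vs c by (simp add: V_ladd V_lmul V_im lmul_pr im_pr)
  also have "\<dots> = pzero G"
    using Vs c by (intro pb_eqI) (simp_all add: padd_pb pmul_pb pzero_pb ev_padd ev_pmul ev_pzero)
  finally have "?t \<in> H ` pb" using t V_kernel by blast
  then obtain X where X: "X \<in> pb" "?t = H X" by blast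
  have "jv \<theta> ?t u = jv \<theta> \<sigma> u" if "\<theta> \<in> dual" for \<theta> u
    using that s Vs c by (simp add: jv_ladd jv_lmul lmul_pr im_pr jv_im)
  then have "X = jmap \<circ> \<sigma>"
    using X s by (intro pb_eqI) (simp_all add: jmap_pb flip: fst_H)
  then have "?t = H (jmap \<circ> \<sigma>)" using X by simp
  then have e: "ladd G (im (V \<sigma>)) (H (jmap \<circ> \<sigma>)) = ladd G (im (V \<sigma>)) ?t" by simp
  show ?thesis
    unfolding e using s Vs c t
    by (intro pr_eqI) (simp_all add: ladd_pr im_pr lmul_pr jv_ladd jv_lmul lact_ladd lact_lmul)
qed

definition pr_linear :: "(('e \<Rightarrow> 'e \<times> 'e tvec) \<Rightarrow> 'e \<Rightarrow> real) \<Rightarrow> bool" where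
  "pr_linear T \<longleftrightarrow> (\<forall>\<sigma>\<in>pr. \<forall>\<tau>\<in>pr. \<forall>u. T (ladd G \<sigma> \<tau>) u = T \<sigma> u + T \<tau> u) \<and>
     (\<forall>g\<in>CE. \<forall>\<sigma>\<in>pr. \<forall>u. T (lmul G g \<sigma>) u = g u * T \<sigma> u)"

text \<open>The splitting leaves vertical and horizontal sections, and the horizontal ones reduce to
  lifts of basic sections by \<open>pb_linear_eq_0\<close>. All these test sections are projectable,
  so brackets with them are explicit.\<close>

lemma pr_linear_eq_0:
  assumes T: "pr_linear T" and i: "\<And>X u. X \<in> pb \<Longrightarrow> T (im X) u = 0"
    and h: "\<And>s u. s \<in> sec \<Longrightarrow> T (H (hat G s)) u = 0" and s: "\<sigma> \<in> pr"
  shows "T \<sigma> u = 0"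
proof -
  have l: "pb_linear (\<lambda>X. T (H X))"
    using T by (simp add: pb_linear_def pr_linear_def H_padd H_pmul H_pr)
  have "T (H X) u = 0" if "X \<in> pb" for X by (rule pb_linear_eq_0[OF l h that])
  moreover have "T \<sigma> u = T (im (V \<sigma>)) u + T (H (jmap \<circ> \<sigma>)) u"
    by (subst splitting[OF s]) (use T s in \<open>simp add: pr_linear_def im_pr V_pb H_pr jmap_pb\<close>)
  ultimately show ?thesis using i s by (simp add: V_pb jmap_pb)
qed

text \<open>Here H (j \<sigma>) is H of the zero section, so only the vertical part of the splitting
  survives. This is the inclusion of ker j in the image of i.\<close>

lemma vertical_section:
  assumes s: "\<sigma> \<in> pr" and j: "\<And>\<theta> u. \<theta> \<in> dual \<Longrightarrow> jv \<theta> \<sigma> u = 0"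
  shows "\<sigma> = im (V \<sigma>)"
proof -
  have c: "(\<lambda>_. 0) \<in> CE" by (rule Cinf_const[OF atlE])
  have "jmap \<circ> \<sigma> = pzero G" using s j by (intro pb_eqI) (simp_all add: jmap_pb pzero_pb ev_pzero)
  \<comment> \<open>Writing the zero section as 0 times itself lets linearity of H over functions
    produce the factor 0.\<close>
  also have "\<dots> = pmul G (\<lambda>_. 0) (pzero G)"
    by (rule pb_eqI) (simp_all add: pzero_pb pmul_pb c ev_pmul ev_pzero)
  finally have "H (jmap \<circ> \<sigma>) = lmul G (\<lambda>_. 0) (H (pzero G))" by (simp add: H_pmul c pzero_pb)
  then have e: "\<sigma> = ladd G (im (V \<sigma>)) (lmul G (\<lambda>_. 0) (H (pzero G)))" using splitting[OF s] by simp
  show ?thesis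
  proof (rule pr_eqI)
    show "jv \<theta> \<sigma> u = jv \<theta> (im (V \<sigma>)) u" if "\<theta> \<in> dual" for \<theta> u
      using j[OF that] that s by (simp add: jv_im V_pb)
    show "lact \<sigma> F u = lact (im (V \<sigma>)) F u" for F u
      using arg_cong[OF e, of "\<lambda>\<tau>. lact \<tau> F u"] by (simp add: lact_ladd lact_lmul)
  qed (simp_all add: s im_pr V_pb)
qed

section \<open>The semispray, and brackets evaluated by dual sections\<close>

lemma S_pr: "S \<in> pr"
  using semi by (simp add: semispray_def)

lemma fst_S: "fst (S u) = u"
proof -
  have "im (jmap \<circ> S) = im delta"
    using semi by (simp add: semispray_def Jmap_def liouville_def comp_assoc)
  then have "jmap \<circ> S = delta" by (rule im_inj[OF jmap_pb[OF S_pr] delta_pb])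
  then have "jmap (S u) = delta u" by (metis comp_apply)
  then show ?thesis by (metis ev_jmap delta_def snd_conv)
qed

text \<open>
  Both sides differ by a tensorial expression in \<open>\<sigma>\<close>, so that it suffices to test vertical
  sections and the projectable sections \<open>H (hat G t)\<close>.
\<close>

lemma jv_br_projectable:
  assumes z: "projects_to \<zeta> s" and \<theta>: "\<theta> \<in> dual" and \<sigma>: "\<sigma> \<in> pr"
  shows "jv \<theta> (br \<zeta> \<sigma>) u = lact \<zeta> (\<lambda>v. jv \<theta> \<sigma> v) u - dhat (LD s \<theta>) (fst (\<sigma> u))"
proof -
  note zp = projects_toD[OF z]
  note ld = lie_dual_dual[OF zp(2) \<theta>]
  let ?T = "\<lambda>\<sigma> u. jv \<theta> (br \<zeta> \<sigma>) u - lact \<zeta> (\<lambda>v. jv \<theta> \<sigma> v) u + dhat (LD s \<theta>) (fst (\<sigma> u))"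
  have "pr_linear ?T"
    unfolding pr_linear_def
  proof (intro conjI ballI allI)
    fix \<sigma> \<tau> u assume st: "\<sigma> \<in> pr" "\<tau> \<in> pr"
    have "jv \<theta> (br \<zeta> (ladd G \<sigma> \<tau>)) u = jv \<theta> (br \<zeta> \<sigma>) u + jv \<theta> (br \<zeta> \<tau>) u"
      using st zp \<theta> by (simp add: br_ladd jv_ladd br_pr)
    moreover have "lact \<zeta> (\<lambda>v. jv \<theta> (ladd G \<sigma> \<tau>) v) u = lact \<zeta> (\<lambda>v. jv \<theta> \<sigma> v) u + lact \<zeta> (\<lambda>v. jv \<theta> \<tau> v) u"
      using st zp \<theta> by (simp add: jv_ladd lact_add pr_jv_smooth)
    ultimately show "?T (ladd G \<sigma> \<tau>) u = ?T \<sigma> u + ?T \<tau> u"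
      using st ld by (simp add: jv_ladd)
  next
    fix g \<sigma> u assume st: "g \<in> CE" "\<sigma> \<in> pr"
    have "jv \<theta> (br \<zeta> (lmul G g \<sigma>)) u = g u * jv \<theta> (br \<zeta> \<sigma>) u + lact \<zeta> g u * jv \<theta> \<sigma> u"
      using st zp \<theta> by (simp add: br_lmul jv_ladd jv_lmul br_pr lmul_pr pr_act_smooth)
    moreover have "lact \<zeta> (\<lambda>v. jv \<theta> (lmul G g \<sigma>) v) u = g u * lact \<zeta> (\<lambda>v. jv \<theta> \<sigma> v) u + jv \<theta> \<sigma> u * lact \<zeta> g u"
      using st zp \<theta> by (simp add: jv_lmul lact_mult pr_jv_smooth)
    ultimately show "?T (lmul G g \<sigma>) u = g u * ?T \<sigma> u"
      using st ld by (simp add: jv_lmul algebra_simps)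
  qed
  moreover have "?T (im X) u = 0" if X: "X \<in> pb" for X u
  proof -
    \<comment> \<open>A vertical section projects to the zero section, so its bracket with \<zeta>
      projects to [s, 0] = 0.\<close>
    have "fst (br \<zeta> (im X) u) = bG s (szero G) (\<pi> u)"
      using br_projectable(1)[OF z im_projects[OF X]] by (rule projects_toD)
    then have "jv \<theta> (br \<zeta> (im X)) u = 0" by (simp add: dhat_bracket_szero \<theta> zp)
    moreover have "dhat (LD s \<theta>) (fst (im X u)) = 0" using jv_im[OF X ld] by simp
    moreover have "lact \<zeta> (\<lambda>v. jv \<theta> (im X) v) u = 0" by (simp add: jv_im X \<theta> lact_const zp)
    ultimately show ?thesis by simp
  qed
  moreover have "?T (H (hat G t)) u = 0" if t: "t \<in> sec" for t u
  proof -
    note h = H_hat_projects[OF t]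
    have "fst (br \<zeta> (H (hat G t)) u) = bG s t (\<pi> u)"
      using br_projectable(1)[OF z h] by (rule projects_toD)
    moreover have "lact \<zeta> (\<lambda>v. jv \<theta> (H (hat G t)) v) u = \<rho> (s (\<pi> u)) (\<lambda>q. dhat \<theta> (t q))"
      using projects_act_base[OF z section_smooth[OF t \<theta>]] by (simp add: projects_toD(3)[OF h])
    ultimately show ?thesis
      by (simp add: projects_toD(3)[OF h] dhat_lie_dual[OF zp(2) \<theta> t])
  qed
  ultimately have "?T \<sigma> u = 0" by (rule pr_linear_eq_0[OF _ _ _ \<sigma>])
  then show ?thesis by simp
qed

lemma jv_br_im:
  assumes "X \<in> pb" "\<theta> \<in> dual" "\<sigma> \<in> pr"
  shows "jv \<theta> (br (im X) \<sigma>) u = lact (im X) (\<lambda>v. jv \<theta> \<sigma> v) u"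
  using jv_br_projectable[OF im_projects[OF assms(1)] assms(2,3)] by (simp add: dhat_lie_dual_szero assms(2))

text \<open>\<open>nabla_v\<close> picks an arbitrary lift \<sigma> of Y, and H Y shows that one
  exists. By \<open>jv_br_im\<close> the result depends on \<sigma> only through j \<sigma> = Y, so
  every choice gives the same section.\<close>

lemma nabla_v_facts:
  assumes X: "X \<in> pb" and Y: "Y \<in> pb"
  shows nabla_v_pb: "nv X Y \<in> pb"
    and ev_nabla_v: "\<theta> \<in> dual \<Longrightarrow> ev \<theta> (nv X Y) u = lact (im X) (\<lambda>v. ev \<theta> Y v) u"
proof -
  define \<sigma> where "\<sigma> = (SOME \<sigma>. \<sigma> \<in> pr \<and> jmap \<circ> \<sigma> = Y)"
  have "\<exists>\<sigma>. \<sigma> \<in> pr \<and> jmap \<circ> \<sigma> = Y" using H_pr[OF Y] jmap_H[OF Y] by blast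
  from someI_ex[OF this] have s: "\<sigma> \<in> pr" "jmap \<circ> \<sigma> = Y" by (auto simp flip: \<sigma>_def)
  have e: "snd (Y v) = fst (\<sigma> v)" for v using fun_cong[OF s(2), of v] by (metis comp_apply ev_jmap)
  have n: "nv X Y = jmap \<circ> br (im X) \<sigma>" by (simp add: nabla_v_def \<sigma>_def)
  show "\<theta> \<in> dual \<Longrightarrow> ev \<theta> (nv X Y) u = lact (im X) (\<lambda>v. ev \<theta> Y v) u"
    using jv_br_im[OF X _ s(1), of \<theta> u] by (simp add: n e)
  show "nv X Y \<in> pb"
    unfolding n using s X by (intro jmap_pb br_pr im_pr)
qed

text \<open>Equal first components make the difference vertical, say iX, and X is recovered from the
  action on the functions \<open>dhat \<theta>\<close>. Agreement on every smooth F follows without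
  a coordinate expansion of F.\<close>

lemma pr_eqI_dual:
  assumes z: "\<zeta> \<in> pr" and w: "\<omega> \<in> pr" and j: "\<And>\<theta> u. \<theta> \<in> dual \<Longrightarrow> jv \<theta> \<zeta> u = jv \<theta> \<omega> u"
    and d: "\<And>\<theta> u. \<theta> \<in> dual \<Longrightarrow> lact \<zeta> (dhat \<theta>) u = lact \<omega> (dhat \<theta>) u"
  shows "\<zeta> = \<omega>"
proof (rule pr_eqI[OF z w j])
  fix F u assume F: "F \<in> CE"
  have c: "(\<lambda>_. c) \<in> CE" for c by (rule Cinf_const[OF atlE])
  let ?t = "ladd G \<zeta> (lmul G (\<lambda>_. -1) \<omega>)"
  have t: "?t \<in> pr" by (intro ladd_pr lmul_pr z w c)
  have vt: "?t = im (V ?t)"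
    by (rule vertical_section[OF t]) (simp add: jv_ladd jv_lmul z w lmul_pr c j)
  note Vt = V_pb[OF t]
  have "V ?t = pmul G (\<lambda>_. 0) (pzero G)"
  proof (rule pb_eqI)
    fix \<theta> u assume \<theta>: "\<theta> \<in> dual"
    have "ev \<theta> (V ?t) u = lact ?t (dhat \<theta>) u"
      using lact_im_dual[OF Vt \<theta>, of u] vt by simp
    then show "ev \<theta> (V ?t) u = ev \<theta> (pmul G (\<lambda>_. 0) (pzero G)) u"
      using d[OF \<theta>] by (simp add: lact_ladd lact_lmul ev_pmul \<theta>)
  qed (simp_all add: Vt pmul_pb c pzero_pb)
  then have "lact ?t F u = 0" using vt lact_im_pmul[OF pzero_pb c F, of 0 u] by simp
  then show "lact \<zeta> F u = lact \<omega> F u" by (simp add: lact_ladd lact_lmul)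
qed

text \<open>
  The bracket of the vertical lift of \<open>\<eta>\<close> with \<open>S\<close> projects to \<open>\<eta>\<close>; its action on fibrewise linear
  functions is corrected by a vertical section.
\<close>

lemma complete_lift_exists:
  assumes \<eta>: "\<eta> \<in> sec"
  shows "\<exists>\<zeta>. projects_to \<zeta> \<eta> \<and> (\<forall>\<theta>\<in>dual. \<forall>u. lact \<zeta> (dhat \<theta>) u = dhat (LD \<eta> \<theta>) u)"
proof -
  note h = hat_pb[OF \<eta>]
  let ?W = "br (im (hat G \<eta>)) S"
  have W: "?W \<in> pr" by (intro br_pr im_pr h S_pr)
  have jW: "jv \<theta> ?W u = dhat \<theta> (\<eta> (\<pi> u))" if "\<theta> \<in> dual" for \<theta> u
    using jv_br_im[OF h that S_pr, of u] lact_im_dual[OF h that, of u] by (simp add: fst_S ev_hat)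
  have fW: "fst (?W u) = \<eta> (\<pi> u)" for u
    by (rule fibre_eqI) (simp_all add: pr_proj[OF W] section_proj \<eta> jW)
  let ?K = "\<lambda>\<theta> u. dhat (LD \<eta> \<theta>) u - lact ?W (dhat \<theta>) u"
  have "\<exists>X\<in>pb. \<forall>\<theta>\<in>dual. \<forall>v. ev \<theta> X v = ?K \<theta> v"
  proof (rule pb_from_dual)
    fix \<theta> \<tau> v assume d: "\<theta> \<in> dual" "\<tau> \<in> dual"
    have "dhat (\<lambda>p u. \<theta> p u + \<tau> p u) = (\<lambda>w. dhat \<theta> w + dhat \<tau> w)" by (simp add: fun_eq_iff dual_hat_def)
    then show "?K (\<lambda>p u. \<theta> p u + \<tau> p u) v = ?K \<theta> v + ?K \<tau> v"
      using d by (simp add: dhat_lie_dual_add \<eta> lact_add W dual_hat_smooth)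
  next
    fix g \<theta> v assume d: "g \<in> CM" "\<theta> \<in> dual"
    have "dhat (\<lambda>p u. g p * \<theta> p u) = (\<lambda>w. g (\<pi> w) * dhat \<theta> w)" by (simp add: fun_eq_iff dual_hat_def)
    \<comment> \<open>The terms (\<rho>(\<eta>) g) \<open>dhat \<theta>\<close> from
      \<open>dhat_lie_dual_scale\<close> and from the derivation by \<open>?W\<close> agree because
      \<open>?W\<close> projects to \<eta>; they cancel, and linearity over base functions
      remains.\<close>
    then show "?K (\<lambda>p u. g p * \<theta> p u) v = g (\<pi> v) * ?K \<theta> v"
      using d by (simp add: dhat_lie_dual_scale \<eta> lact_mult W dual_hat_smooth Cinf_proj
          pr_act_base fW algebra_simps)
  next
    fix \<theta> assume d: "\<theta> \<in> dual"
    show "?K \<theta> \<in> CE"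
      by (intro Cinf_diff atlE dual_hat_smooth lie_dual_dual \<eta> d pr_act_smooth W)
  qed
  then obtain k where k: "k \<in> pb" "\<forall>\<theta>\<in>dual. \<forall>v. ev \<theta> k v = ?K \<theta> v" by blast
  let ?Z = "ladd G ?W (im k)"
  have Z: "?Z \<in> pr" by (intro ladd_pr W im_pr k)
  have "fst (?Z u) = \<eta> (\<pi> u)" for u
  proof (rule fibre_eqI)
    show "dhat \<theta> (fst (?Z u)) = dhat \<theta> (\<eta> (\<pi> u))" if "\<theta> \<in> dual" for \<theta>
      using jv_ladd[OF that W im_pr[OF k(1)], of u] jv_im[OF k(1) that, of u] jW[OF that, of u] by simp
  qed (simp add: pr_proj[OF Z] section_proj \<eta>)
  then have "projects_to ?Z \<eta>" using Z \<eta> by (simp add: projects_to_def)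
  moreover have "lact ?Z (dhat \<theta>) u = dhat (LD \<eta> \<theta>) u" if "\<theta> \<in> dual" for \<theta> u
    using that k by (simp add: lact_ladd lact_im_dual)
  ultimately show ?thesis by blast
qed

text \<open>The vector field of a solution from \<open>complete_lift_exists\<close> meets the
  description. A competitor Y, paired with \<eta> along the projection, is a section of the
  prolongation, and \<open>pr_eqI_dual\<close> identifies it with that solution.\<close>

lemma complete_lift_facts:
  assumes \<eta>: "\<eta> \<in> sec"
  shows clift_projects: "projects_to (clift \<eta>) \<eta>"
    and lact_clift_dual: "\<theta> \<in> dual \<Longrightarrow> lact (clift \<eta>) (dhat \<theta>) u = dhat (LD \<eta> \<theta>) u"
proof -
  obtain \<zeta> where z: "projects_to \<zeta> \<eta>" and l: "\<And>\<theta> u. \<theta> \<in> dual \<Longrightarrow> lact \<zeta> (dhat \<theta>) u = dhat (LD \<eta> \<theta>) u"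
    using complete_lift_exists[OF \<eta>] by blast
  note zp = projects_toD[OF z]
  have "complete_lift_vf G \<eta> = snd \<circ> \<zeta>"
    unfolding complete_lift_vf_def
  proof (rule the_equality)
    show "snd \<circ> \<zeta> \<in> vector_fields EA \<and> related_to_anchor G (snd \<circ> \<zeta>) \<eta> \<and>
        (\<forall>\<theta>\<in>dual. vf_act (snd \<circ> \<zeta>) (dhat \<theta>) = dhat (LD \<eta> \<theta>))"
      using pr_vector_field[OF zp(1)] pr_related[OF zp(1)] zp(3) l
      by (simp add: related_to_anchor_def lact_def fun_eq_iff)
  next
    fix Y assume Y: "Y \<in> vector_fields EA \<and> related_to_anchor G Y \<eta> \<and>
        (\<forall>\<theta>\<in>dual. vf_act Y (dhat \<theta>) = dhat (LD \<eta> \<theta>))"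
    let ?\<omega> = "\<lambda>v. (\<eta> (\<pi> v), Y v)"
    have Yt: "Y v \<in> tangent_space EA v" for v using Y by (simp add: vector_fields_def)
    have "?\<omega> \<in> pr"
    proof (rule prI)
      show "lact ?\<omega> (\<lambda>u. g (\<pi> u)) v = \<rho> (fst (?\<omega> v)) g" if "g \<in> CM" for g v
      proof -
        have "anchor G (\<eta> (\<pi> v)) = pushforward EA \<pi> MA (Y v)"
          using Y by (simp add: related_to_anchor_def)
        then show ?thesis using that pushforward_iff[OF Yt, of "\<eta> (\<pi> v)"] by (simp add: lact_apply)
      qed
      show "lact ?\<omega> F \<in> CE" if "F \<in> CE" for F
        using Y that by (simp add: vector_fields_def lact_def o_def)
      show "(\<lambda>u. jv \<theta> ?\<omega> u) \<in> CE" if "\<theta> \<in> dual" for \<theta>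
        using Cinf_proj[OF section_smooth[OF \<eta> that]] by simp
    qed (simp_all add: Yt section_proj \<eta>)
    then have "?\<omega> = \<zeta>"
    proof (rule pr_eqI_dual[OF _ zp(1)])
      show "lact ?\<omega> (dhat \<theta>) u = lact \<zeta> (dhat \<theta>) u" if "\<theta> \<in> dual" for \<theta> u
        using Y that l[OF that] by (simp add: lact_def o_def)
    qed (simp add: zp(3))
    then have "snd (?\<omega> v) = snd (\<zeta> v)" for v by (rule arg_cong)
    then show "Y = snd \<circ> \<zeta>" by (simp add: fun_eq_iff)
  qed
  then have "clift \<eta> = \<zeta>"
    by (simp add: complete_lift_def fun_eq_iff prod_eq_iff zp(3))
  then show "projects_to (clift \<eta>) \<eta>"
    "\<theta> \<in> dual \<Longrightarrow> lact (clift \<eta>) (dhat \<theta>) u = dhat (LD \<eta> \<theta>) u"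
    using z l by auto
qed

text \<open>A vertical section projects to 0, so its bracket with \<zeta> has zero first component
  and is again vertical. Hence \<open>imap_inv\<close> is applied to an element of the image of i,
  where V computes it.\<close>

lemma lie_der_facts:
  assumes z: "projects_to \<zeta> s" and Y: "Y \<in> pb"
  shows lie_der_pb: "lie_der G br \<zeta> Y \<in> pb" and im_lie_der: "im (lie_der G br \<zeta> Y) = br \<zeta> (im Y)"
    and lie_der_V: "lie_der G br \<zeta> Y = V (br \<zeta> (im Y))"
proof -
  note zp = projects_toD[OF z]
  have b: "br \<zeta> (im Y) \<in> pr" by (intro br_pr zp im_pr Y)
  have "jv \<theta> (br \<zeta> (im Y)) u = 0" if "\<theta> \<in> dual" for \<theta> u
    using projects_toD(3)[OF br_projectable(1)[OF z im_projects[OF Y]]]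
    by (simp add: dhat_bracket_szero that zp)
  then have i: "br \<zeta> (im Y) = im (V (br \<zeta> (im Y)))" by (rule vertical_section[OF b])
  then show "lie_der G br \<zeta> Y = V (br \<zeta> (im Y))"
    unfolding lie_der_def by (metis imap_inv_im V_pb[OF b])
  then show "lie_der G br \<zeta> Y \<in> pb" "im (lie_der G br \<zeta> Y) = br \<zeta> (im Y)"
    using V_pb[OF b] i by auto
qed

text \<open>The bracket of two horizontal lifts acts as a commutator, and on functions lifted from
  the base each lift acts through the anchor of its projection. So the anchor inherits compatibility
  with brackets from the prolongation.\<close>

lemma anchor_bracket:
  assumes s: "s \<in> sec" and t: "t \<in> sec" and g: "g \<in> CM"
  shows "\<rho> (bG s t p) g =
    \<rho> (s p) (\<lambda>q. \<rho> (t q) g) - \<rho> (t p) (\<lambda>q. \<rho> (s q) g)"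
proof -
  note zs = H_hat_projects[OF s] and zt = H_hat_projects[OF t]
  \<comment> \<open>Some point over p, used to return from functions on E to the base.\<close>
  let ?u = "fzero G p"
  have a: "lact (H (hat G r)) (\<lambda>u. h (\<pi> u)) = (\<lambda>u. \<rho> (r (\<pi> u)) h)" if "r \<in> sec" "h \<in> CM" for r h
    using projects_act_base[OF H_hat_projects[OF that(1)] that(2)] by (simp add: fun_eq_iff)
  show ?thesis
    using br_projectable(2)[OF zs zt Cinf_proj[OF g], of ?u]
      projects_act_base[OF br_projectable(1)[OF zs zt] g, of ?u]
      fun_cong[OF a[OF s anchor_section_smooth[OF t g]], of ?u]
      fun_cong[OF a[OF t anchor_section_smooth[OF s g]], of ?u]
    by (simp add: a s t g)
qed

text \<open>Antisymmetrizing the iterated derivative in s and t cancels the mixed terms. What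
  remains is \<open>anchor_bracket\<close> and the Jacobi identity of sections of E, evaluated along
  a section r through u.\<close>

lemma dhat_lie_dual_bracket:
  assumes s: "s \<in> sec" and t: "t \<in> sec" and \<theta>: "\<theta> \<in> dual"
  shows "dhat (LD (bG s t) \<theta>) u =
    dhat (LD s (LD t \<theta>)) u - dhat (LD t (LD s \<theta>)) u"
proof -
  obtain r where r: "r \<in> sec" "r (\<pi> u) = u" using section_through by blast
  have iter: "dhat (LD a (LD b \<theta>)) (r p) =
      \<rho> (a p) (\<lambda>q. \<rho> (b q) (\<lambda>q. dhat \<theta> (r q))) -
      \<rho> (a p) (\<lambda>q. dhat \<theta> (bG b r q)) - \<rho> (b p) (\<lambda>q. dhat \<theta> (bG a r q)) +
      dhat \<theta> (bG b (bG a r) p)" if a: "a \<in> sec" and b: "b \<in> sec" for a b p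
  proof -
    have 1: "(\<lambda>q. \<rho> (b q) (\<lambda>q. dhat \<theta> (r q))) \<in> CM" "(\<lambda>q. dhat \<theta> (bG b r q)) \<in> CM"
      using a b r \<theta> by (simp_all add: anchor_section_smooth section_smooth bracket_sec)
    have "\<rho> (a p) (\<lambda>q. \<rho> (b q) (\<lambda>q. dhat \<theta> (r q)) + (-1) * dhat \<theta> (bG b r q)) =
        \<rho> (a p) (\<lambda>q. \<rho> (b q) (\<lambda>q. dhat \<theta> (r q))) +
        (-1) * \<rho> (a p) (\<lambda>q. dhat \<theta> (bG b r q))"
      using 1 by (simp only: anchor_derivation Cinf_cmult[OF atlM])
    then show ?thesis
      using a b r \<theta> by (simp add: dhat_lie_dual lie_dual_dual bracket_sec)
  qed
  show ?thesis
    using iter[OF s t, of "\<pi> u"] iter[OF t s, of "\<pi> u"]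
      dhat_lie_dual[OF bracket_sec[OF s t] \<theta> r(1), of "\<pi> u"]
      dhat_bracket_jacobi[OF \<theta> s t r(1), of "\<pi> u"]
      anchor_bracket[OF s t section_smooth[OF r(1) \<theta>], of "\<pi> u"] r(2)
    by simp
qed

text \<open>By \<open>pr_eqI_dual\<close> it is enough to compare projections and the action on
  \<open>dhat \<theta>\<close>, where a commutator of complete lifts acts as the commutator of Lie
  derivatives of dual sections.\<close>

lemma br_complete_lift:
  assumes s: "s \<in> sec" and t: "t \<in> sec"
  shows "br (clift s) (clift t) = clift (bG s t)"
proof (rule pr_eqI_dual)
  note zs = clift_projects[OF s] and zt = clift_projects[OF t] and zb = clift_projects[OF bracket_sec[OF s t]]
  note b = br_projectable[OF zs zt]
  show "br (clift s) (clift t) \<in> pr" "clift (bG s t) \<in> pr"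
    using projects_toD(1)[OF b(1)] projects_toD(1)[OF zb] by auto
  show "jv \<theta> (br (clift s) (clift t)) u = jv \<theta> (clift (bG s t)) u" for \<theta> u
    using projects_toD(3)[OF b(1)] projects_toD(3)[OF zb] by simp
  fix \<theta> u assume \<theta>: "\<theta> \<in> dual"
  have a: "lact (clift r) (dhat \<tau>) = dhat (LD r \<tau>)" if "r \<in> sec" "\<tau> \<in> dual" for r \<tau>
    using lact_clift_dual[OF that] by (simp add: fun_eq_iff)
  show "lact (br (clift s) (clift t)) (dhat \<theta>) u = lact (clift (bG s t)) (dhat \<theta>) u"
    using b(2)[OF dual_hat_smooth[OF \<theta>], of u]
    by (simp add: a s t \<theta> lie_dual_dual bracket_sec dhat_lie_dual_bracket)
qed

end

section \<open>Lie derivation along a complete lift\<close>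

locale complete_lift_derivation = connection G br S H V
  for G :: "('m::{t2_space, second_countable_topology}, 'a::finite_dim_inner,
    'e::{t2_space, second_countable_topology}, 'f::finite_dim_inner) algebroid_data"
    and br S H V +
  fixes \<eta>
  assumes \<eta>: "\<eta> \<in> sections G"
begin

abbreviation "\<zeta> \<equiv> complete_lift G \<eta>"
abbreviation "L \<equiv> lie_der G br \<zeta>"

lemmas \<zeta>_projects = clift_projects[OF \<eta>]
lemmas \<zeta>_pr = projects_toD(1)[OF \<zeta>_projects]
lemmas L_pb = lie_der_pb[OF \<zeta>_projects]
lemmas im_L = im_lie_der[OF \<zeta>_projects]
lemmas L_V = lie_der_V[OF \<zeta>_projects]
lemmas lie_dual_\<eta> = lie_dual_dual[OF \<eta>]

lemma lact_br_im: "X \<in> pb \<Longrightarrow> F \<in> CE \<Longrightarrow>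
    lact (im (L X)) F u = lact \<zeta> (lact (im X) F) u - lact (im X) (lact \<zeta> F) u"
  using br_projectable(2)[OF \<zeta>_projects im_projects] by (simp add: im_L)

text \<open>The commutator \<open>lact_br_im\<close> is applied to the function
  \<open>dhat \<theta>\<close>: iX turns it into \<theta>(X), and the complete lift turns it into
  the function of the Lie derivative of \<theta>.\<close>

lemma ev_L:
  assumes X: "X \<in> pb" and \<theta>: "\<theta> \<in> dual"
  shows "ev \<theta> (L X) u = lact \<zeta> (\<lambda>v. ev \<theta> X v) u - ev (LD \<eta> \<theta>) X u"
proof -
  have "lact (im X) (dhat \<theta>) = (\<lambda>v. ev \<theta> X v)" "lact \<zeta> (dhat \<theta>) = dhat (LD \<eta> \<theta>)"
    using lact_im_dual[OF X \<theta>] lact_clift_dual[OF \<eta> \<theta>] by (simp_all add: fun_eq_iff)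
  then show ?thesis
    using lact_br_im[OF X dual_hat_smooth[OF \<theta>], of u] lact_im_dual[OF L_pb[OF X] \<theta>, of u]
      lact_im_dual[OF X lie_dual_\<eta>[OF \<theta>], of u] by simp
qed

lemma L_padd: "X \<in> pb \<Longrightarrow> Y \<in> pb \<Longrightarrow> L (padd G X Y) = padd G (L X) (L Y)"
  by (rule pb_eqI) (simp_all add: L_pb padd_pb ev_L ev_padd lact_add \<zeta>_pr pb_smooth lie_dual_\<eta>)

lemma L_pmul: "X \<in> pb \<Longrightarrow> g \<in> CE \<Longrightarrow> L (pmul G g X) = padd G (pmul G g (L X)) (pmul G (lact \<zeta> g) X)"
  by (rule pb_eqI)
     (simp_all add: L_pb padd_pb pmul_pb ev_L ev_padd ev_pmul lact_mult \<zeta>_pr pb_smooth lie_dual_\<eta>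
        pr_act_smooth algebra_simps)

lemma L_hat:
  assumes s: "s \<in> sec"
  shows "L (hat G s) = hat G (bG \<eta> s)"
proof (rule pb_eqI)
  fix \<theta> u assume \<theta>: "\<theta> \<in> dual"
  show "ev \<theta> (L (hat G s)) u = ev \<theta> (hat G (bG \<eta> s)) u"
    using projects_act_base[OF \<zeta>_projects section_smooth[OF s \<theta>], of u]
    by (simp add: ev_L hat_pb s \<theta> ev_hat dhat_lie_dual \<eta>)
qed (simp_all add: L_pb hat_pb s bracket_sec \<eta>)

text \<open>\<theta>(\<delta>) is \<open>dhat \<theta>\<close> itself, so both terms of
  \<open>ev_L\<close> are the function of the Lie derivative of \<theta>.\<close>

lemma L_delta: "L delta = pzero G"
  by (rule pb_eqI)
     (simp_all add: L_pb delta_pb pzero_pb ev_L ev_delta ev_pzero lact_clift_dual \<eta>)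

text \<open>Paired with \<theta>, the claim becomes the identity i(L X) = [\<zeta>, iX] of
  derivations applied to \<theta>(Y), which is \<open>lact_br_im\<close>; the terms with the Lie
  derivative of \<theta> agree on both sides.\<close>

lemma L_nabla_v:
  assumes X: "X \<in> pb" and Y: "Y \<in> pb"
  shows "L (nv X Y) = padd G (nv (L X) Y) (nv X (L Y))"
proof (rule pb_eqI)
  fix \<theta> u assume \<theta>: "\<theta> \<in> dual"
  note lt = lie_dual_\<eta>[OF \<theta>]
  have e: "(\<lambda>v. ev \<theta> (L Y) v) = (\<lambda>v. lact \<zeta> (\<lambda>v. ev \<theta> Y v) v - ev (LD \<eta> \<theta>) Y v)"
    by (simp add: ev_L Y \<theta>)
  have n: "(\<lambda>v. ev \<theta> (nv X Y) v) = lact (im X) (\<lambda>v. ev \<theta> Y v)"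
    by (simp add: fun_eq_iff ev_nabla_v X Y \<theta>)
  have "ev \<theta> (nv X (L Y)) u =
      lact (im X) (lact \<zeta> (\<lambda>v. ev \<theta> Y v)) u - lact (im X) (\<lambda>v. ev (LD \<eta> \<theta>) Y v) u"
    by (subst ev_nabla_v[OF X L_pb[OF Y] \<theta>], subst e)
       (rule lact_diff[OF im_pr[OF X] pr_act_smooth[OF \<zeta>_pr pb_smooth[OF Y \<theta>]] pb_smooth[OF Y lt]])
  moreover have "ev \<theta> (L (nv X Y)) u =
      lact \<zeta> (lact (im X) (\<lambda>v. ev \<theta> Y v)) u - lact (im X) (\<lambda>v. ev (LD \<eta> \<theta>) Y v) u"
    by (simp add: ev_L[OF nabla_v_pb[OF X Y] \<theta>] n ev_nabla_v[OF X Y lt])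
  ultimately show "ev \<theta> (L (nv X Y)) u = ev \<theta> (padd G (nv (L X) Y) (nv X (L Y))) u"
    using lact_br_im[OF X pb_smooth[OF Y \<theta>], of u]
    by (simp add: ev_padd nabla_v_pb L_pb X Y \<theta> ev_nabla_v[OF L_pb[OF X] Y \<theta>])
qed (simp_all add: L_pb nabla_v_pb padd_pb X Y)

end

section \<open>Traces\<close>

text \<open>Expand f T b by the given decomposition in each term of the trace and exchange the sums;
  the sum over b then rebuilds v_k. The family v_k only has to decompose f times the identity, so it
  may degenerate where f vanishes.\<close>

lemma lin_trace_decomposition:
  fixes T :: "'f::finite_dim_inner \<Rightarrow> 'f"
  assumes T: "linear T" and \<phi>: "\<And>k. k \<in> I \<Longrightarrow> linear (\<phi> k)" and I: "finite I"
    and dec: "\<And>y. f *\<^sub>R y = (\<Sum>k\<in>I. \<phi> k y *\<^sub>R v k)"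
  shows "f * lin_trace T = (\<Sum>k\<in>I. \<phi> k (T (v k)))"
proof -
  define B :: "'f set" where "B = (SOME B. independent B \<and> span B = UNIV)"
  obtain B' :: "'f set" where "independent B'" "UNIV \<subseteq> span B'"
    by (rule basis_exists[of "UNIV :: 'f set"])
  then have "independent B' \<and> span B' = UNIV" by auto
  then have "independent B \<and> span B = UNIV" unfolding B_def by (rule someI)
  then have iB: "independent B" and sB: "span B = UNIV" by auto
  have fB: "finite B" using independent_span_bound[OF finite_onb iB] by simp
  have lin: "linear (\<lambda>y. representation B y b)" for b
    by (intro linearI) (simp_all add: representation_add representation_scale iB sB)
  have rep: "(\<Sum>b\<in>B. representation B y b *\<^sub>R b) = y" for y
    by (rule sum_representation_eq[OF iB]) (simp_all add: sB fB)
  have "f * lin_trace T = (\<Sum>b\<in>B. representation B (f *\<^sub>R T b) b)"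
    by (simp add: lin_trace_def B_def[symmetric] sum_distrib_left linear_scale[OF lin])
  also have "\<dots> = (\<Sum>b\<in>B. \<Sum>k\<in>I. \<phi> k (T b) * representation B (v k) b)"
    by (simp add: dec linear_sum[OF lin] linear_scale[OF lin])
  also have "\<dots> = (\<Sum>k\<in>I. \<Sum>b\<in>B. representation B (v k) b * \<phi> k (T b))"
    by (subst sum.swap) (simp add: mult.commute)
  also have "\<dots> = (\<Sum>k\<in>I. \<phi> k (T (\<Sum>b\<in>B. representation B (v k) b *\<^sub>R b)))"
    using \<phi> by (intro sum.cong) (simp_all add: linear_sum linear_scale T)
  finally show ?thesis by (simp add: rep)
qed

context vbundle
begin

section \<open>Traces of endomorphisms of the pullback bundle\<close>

lemma pb_through: "\<pi> w = \<pi> u \<Longrightarrow> \<exists>X\<in>pb. X u = (u, w)"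
  using section_through[of w] hat_pb by (auto simp: hat_def)

lemma pb_linear_pointwise:
  assumes T: "pb_linear T" and X: "X \<in> pb" "Y \<in> pb" "X u = Y u"
  shows "T X u = T Y u"
proof -
  obtain f e \<theta> where F: "frame_at (\<pi> u) f e \<theta>" by (rule frame_exists)
  show ?thesis
    using pb_expansion[OF F T X(1), of u] pb_expansion[OF F T X(2), of u] X(3) frame_atD(2)[OF F] by simp
qed

definition pb_endo where
  "pb_endo T \<longleftrightarrow> (\<forall>X\<in>pb. T X \<in> pb) \<and> (\<forall>\<theta>\<in>dual. pb_linear (\<lambda>X u. ev \<theta> (T X) u))"

lemma pb_endoD:
  "pb_endo T \<Longrightarrow> X \<in> pb \<Longrightarrow> T X \<in> pb" "pb_endo T \<Longrightarrow> \<theta> \<in> dual \<Longrightarrow> pb_linear (\<lambda>X u. ev \<theta> (T X) u)"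
  by (simp_all add: pb_endo_def)

text \<open>The fibre value uses a chosen section with a prescribed value at u; linearity over
  functions makes all choices agree.\<close>

lemma fibre_value_eq:
  assumes T: "pb_endo T" and X: "X \<in> pb"
  shows "fibre_value G T u (snd (X u)) = snd (T X u)"
proof -
  define Y where "Y = (SOME Y. Y \<in> pb \<and> Y u = (u, snd (X u)))"
  have "\<exists>Y. Y \<in> pb \<and> Y u = (u, snd (X u))" using X pb_fst[OF X, of u] by (metis prod.collapse)
  from someI_ex[OF this] have Y: "Y \<in> pb" "Y u = (u, snd (X u))" unfolding Y_def by auto
  have "Y u = X u" using Y(2) pb_fst[OF X, of u] by (simp add: prod_eq_iff)
  then have "snd (T Y u) = snd (T X u)"
    using pb_linear_pointwise[OF pb_endoD(2)[OF T] Y(1) X]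
    by (intro fibre_eqI) (simp_all add: pb_proj pb_endoD(1)[OF T] X Y(1))
  then show ?thesis by (simp add: fibre_value_def Y_def)
qed

text \<open>The frame decomposes f times the identity of the fibre, so
  \<open>lin_trace_decomposition\<close> applies in whichever trivialization was chosen. The
  right-hand side is free of that choice and smooth in u.\<close>

lemma endo_trace_frame:
  assumes T: "pb_endo T" and F: "frame_at p f e \<theta>"
  shows "f (\<pi> u) * endo_trace G T u = (\<Sum>b\<in>FB. ev (\<theta> b) (T (hat G (e b))) u)"
proof -
  note D = frame_atD[OF F]
  define \<Phi> where "\<Phi> = (SOME \<Phi>. \<exists>V. (V, \<Phi>) \<in> trivs G \<and> \<pi> u \<in> V)"
  have "\<exists>\<Phi>. \<exists>V. (V, \<Phi>) \<in> trivs G \<and> \<pi> u \<in> V" by (metis triv_cover)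
  from someI_ex[OF this] obtain V where V: "(V, \<Phi>) \<in> trivs G" "\<pi> u \<in> V" unfolding \<Phi>_def by auto
  let ?t = "tinv \<Phi> (\<pi> u)" and ?fv = "fibre_value G T u"
  note t = tinv[OF V]
  have fv: "\<pi> (?fv w) = \<pi> u \<and> (\<forall>X\<in>pb. snd (X u) = w \<longrightarrow> ?fv w = snd (T X u))" if w: "\<pi> w = \<pi> u" for w
  proof -
    obtain X where "X \<in> pb" "X u = (u, w)" using pb_through[OF w] by blast
    then show ?thesis
      using fibre_value_eq[OF T] pb_endoD(1)[OF T, of X] by (metis pb_proj snd_conv)
  qed
  have fadd: "?fv (fadd G v w) = fadd G (?fv v) (?fv w)" if vw: "\<pi> v = \<pi> u" "\<pi> w = \<pi> u" for v w
  proof -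
    obtain X where X: "X \<in> pb" "X u = (u, v)" using pb_through[OF vw(1)] by blast
    obtain Y where Y: "Y \<in> pb" "Y u = (u, w)" using pb_through[OF vw(2)] by blast
    have e: "?fv v = snd (T X u)" "?fv w = snd (T Y u)"
      using fibre_value_eq[OF T X(1), of u] fibre_value_eq[OF T Y(1), of u] X Y by auto
    have "?fv (fadd G v w) = snd (T (padd G X Y) u)"
      using fibre_value_eq[OF T padd_pb[OF X(1) Y(1)], of u] X Y by (simp add: padd_def)
    also have "\<dots> = fadd G (snd (T X u)) (snd (T Y u))"
    proof (rule fibre_eqI)
      show "ev \<tau> (T (padd G X Y)) u = dhat \<tau> (fadd G (snd (T X u)) (snd (T Y u)))" if "\<tau> \<in> dual" for \<tau>
        using pb_endoD(2)[OF T that] X Y that pb_endoD(1)[OF T]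
        by (simp add: dual_hat_fadd pb_proj pb_linear_def)
    qed (use X Y pb_endoD(1)[OF T] in \<open>simp add: pb_proj padd_pb proj_fadd\<close>)
    finally show ?thesis by (simp add: e)
  qed
  have fscale: "?fv (fscale G c w) = fscale G c (?fv w)" if w: "\<pi> w = \<pi> u" for c w
  proof -
    obtain X where X: "X \<in> pb" "X u = (u, w)" using pb_through[OF w] by blast
    have c: "(\<lambda>_. c) \<in> CE" by (rule Cinf_const[OF atlE])
    have e: "?fv w = snd (T X u)" using fibre_value_eq[OF T X(1), of u] X by auto
    have "?fv (fscale G c w) = snd (T (pmul G (\<lambda>_. c) X) u)"
      using fibre_value_eq[OF T pmul_pb[OF c X(1)], of u] X by (simp add: pmul_def)
    also have "\<dots> = fscale G c (snd (T X u))"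
    proof (rule fibre_eqI)
      show "ev \<tau> (T (pmul G (\<lambda>_. c) X)) u = dhat \<tau> (fscale G c (snd (T X u)))" if "\<tau> \<in> dual" for \<tau>
        using pb_endoD(2)[OF T that] X that c by (simp add: dual_hat_fscale pb_linear_def)
    qed (use X pb_endoD(1)[OF T] c in \<open>simp add: pb_proj pmul_pb\<close>)
    finally show ?thesis by (simp add: e)
  qed
  let ?A = "\<lambda>y. \<Phi> (?fv (?t y))"
  have A: "linear ?A"
  proof (rule linearI)
    show "?A (x + y) = ?A x + ?A y" for x y
      using fv[OF t(1)] by (simp add: tinv_add[OF V] fadd t triv_fibre(3)[OF V])
    show "?A (c *\<^sub>R x) = c *\<^sub>R ?A x" for c x
      using fv[OF t(1)] by (simp add: tinv_scale[OF V] fscale t triv_fibre(4)[OF V])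
  qed
  have "f (\<pi> u) * lin_trace ?A = (\<Sum>b\<in>FB. dhat (\<theta> b) (?t (?A (\<Phi> (e b (\<pi> u))))))"
  proof (rule lin_trace_decomposition[OF A _ finite_onb])
    show "linear (\<lambda>y. dhat (\<theta> b) (?t y))" if "b \<in> onb" for b
      using D(4)[OF that] V by (rule linear_dual_tinv)
    fix y
    \<comment> \<open>The decomposition is checked in the fibre, where dual sections separate
      vectors, and carried back to the model space by \<Phi>.\<close>
    have "?t (f (\<pi> u) *\<^sub>R y) = ?t (\<Sum>b\<in>onb. dhat (\<theta> b) (?t y) *\<^sub>R \<Phi> (e b (\<pi> u)))"
    proof (rule fibre_eqI)
      fix \<tau> assume \<tau>: "\<tau> \<in> dual"
      note l = linear_dual_tinv[OF \<tau> V]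
      have e: "?t (\<Phi> (e b (\<pi> u))) = e b (\<pi> u)" if "b \<in> onb" for b
        by (rule t(3)) (simp add: section_proj D(3)[OF that])
      show "dhat \<tau> (?t (f (\<pi> u) *\<^sub>R y)) = dhat \<tau> (?t (\<Sum>b\<in>onb. dhat (\<theta> b) (?t y) *\<^sub>R \<Phi> (e b (\<pi> u))))"
        using D(6)[OF \<tau>, of "?t y"] by (simp add: linear_sum[OF l] linear_scale[OF l] t(1) e)
    qed (simp add: t)
    from arg_cong[OF this, of \<Phi>]
    show "f (\<pi> u) *\<^sub>R y = (\<Sum>b\<in>onb. dhat (\<theta> b) (?t y) *\<^sub>R \<Phi> (e b (\<pi> u)))"
      by (simp only: t(2))
  qed
  moreover have "?t (?A (\<Phi> (e b (\<pi> u)))) = snd (T (hat G (e b)) u)" if b: "b \<in> onb" for b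
  proof -
    have p: "\<pi> (e b (\<pi> u)) = \<pi> u" by (simp add: section_proj D(3)[OF b])
    have "?fv (e b (\<pi> u)) = snd (T (hat G (e b)) u)"
      using fv[OF p] hat_pb[OF D(3)[OF b]] by (simp add: hat_def)
    then show ?thesis using fv[OF p] by (simp add: t(3)[OF p] t(3))
  qed
  moreover have "endo_trace G T u = lin_trace ?A"
    by (simp add: endo_trace_def \<Phi>_def[symmetric])
  ultimately show ?thesis by simp
qed

lemma endo_trace_smooth:
  assumes T: "pb_endo T"
  shows "(\<lambda>u. endo_trace G T u) \<in> CE"
proof (rule Cinf_by_multiples[OF atlE])
  fix u
  obtain f e \<theta> where F: "frame_at (\<pi> u) f e \<theta>" by (rule frame_exists)
  note D = frame_atD[OF F]
  have "(\<lambda>v. \<Sum>b\<in>FB. ev (\<theta> b) (T (hat G (e b))) v) \<in> CE"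
    using D pb_endoD(1)[OF T] by (intro Cinf_sum atlE finite_onb pb_smooth) (simp_all add: hat_pb)
  then show "\<exists>g\<in>CE. g u \<noteq> 0 \<and> (\<lambda>y. g y * endo_trace G T y) \<in> CE"
    using D(1,2) by (intro bexI[of _ "\<lambda>v. f (\<pi> v)"] Cinf_proj) (simp_all add: endo_trace_frame[OF T F])
qed

lemma endo_trace_add:
  assumes "pb_endo T" "pb_endo T'" "pb_endo T''"
    and "\<And>X \<theta>. X \<in> pb \<Longrightarrow> \<theta> \<in> dual \<Longrightarrow> ev \<theta> (T'' X) u = ev \<theta> (T X) u + ev \<theta> (T' X) u"
  shows "endo_trace G T'' u = endo_trace G T u + endo_trace G T' u"
proof -
  obtain f e \<theta> where F: "frame_at (\<pi> u) f e \<theta>" by (rule frame_exists)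
  note D = frame_atD[OF F]
  show ?thesis
    using endo_trace_frame[OF assms(1) F, of u] endo_trace_frame[OF assms(2) F, of u]
      endo_trace_frame[OF assms(3) F, of u] assms(4) D(2,3,4)
    by (simp add: hat_pb sum.distrib)
qed

end

context complete_lift_derivation
begin

text \<open>
  In a frame \<open>f id = \<Sum> \<theta>\<^sub>b \<otimes> e\<^sub>b\<close> the terms in which \<open>L\<close> hits \<open>\<theta>\<^sub>b\<close> and \<open>e\<^sub>b\<close> add up to the derivative
  of \<open>f\<close>.
\<close>

lemma lact_endo_trace:
  assumes T: "pb_endo T" and T': "pb_endo T'"
    and LT: "\<And>X. X \<in> pb \<Longrightarrow> L (T X) = padd G (T (L X)) (T' X)"
  shows "lact \<zeta> (endo_trace G T) u = endo_trace G T' u"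
proof -
  obtain f e \<theta> where F: "frame_at (\<pi> u) f e \<theta>" by (rule frame_exists)
  note D = frame_atD[OF F]
  let ?B = "onb :: 'f set" and ?e = "\<lambda>b. hat G (e b)" and ?f = "\<lambda>u. f (\<pi> u)" and ?tr = "endo_trace G T"
  note TX = pb_endoD(1)[OF T]
  have e: "?e b \<in> pb" if "b \<in> ?B" for b using hat_pb[OF D(3)[OF that]] .
  have f: "?f \<in> CE" by (rule Cinf_proj[OF D(1)])
  have tr: "?tr \<in> CE" using endo_trace_smooth[OF T] by simp
  have lin: "pb_linear (\<lambda>X u. ev \<tau> X u)" if "\<tau> \<in> dual" for \<tau>
    using that by (simp add: pb_linear_def ev_padd ev_pmul)
  have ev_e: "ev (\<theta> b) (?e c) = (if b = c then ?f else (\<lambda>_. 0))" if "b \<in> ?B" "c \<in> ?B" for b c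
    using D(7)[OF that] by (simp add: fun_eq_iff ev_hat)
  \<comment> \<open>The pairing of \<theta>_b with e_c is f or 0, so the derivative of the pairing
    is known; \<open>ev_L\<close> distributes it over the two factors.\<close>
  have cross: "ev (LD \<eta> (\<theta> b)) (?e c) u + ev (\<theta> b) (L (?e c)) u = (if b = c then lact \<zeta> ?f u else 0)"
    if "b \<in> ?B" "c \<in> ?B" for b c
  proof -
    have "ev (\<theta> b) (L (?e c)) u = lact \<zeta> (ev (\<theta> b) (?e c)) u - ev (LD \<eta> (\<theta> b)) (?e c) u"
      by (rule ev_L) (use that e D(4) in auto)
    then show ?thesis using lact_const[OF \<zeta>_pr, of 0 u] by (simp add: ev_e[OF that])
  qed
  have "endo_trace G T' u = (\<Sum>b\<in>?B. ev (\<theta> b) (T' (?e b)) u)"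
    using endo_trace_frame[OF T' F, of u] D(2) by simp
  also have "\<dots> = (\<Sum>b\<in>?B. lact \<zeta> (\<lambda>v. ev (\<theta> b) (T (?e b)) v) u -
      (ev (LD \<eta> (\<theta> b)) (T (?e b)) u + ev (\<theta> b) (T (L (?e b))) u))"
  proof (rule sum.cong[OF refl])
    fix b assume b: "b \<in> ?B"
    have "ev (\<theta> b) (L (T (?e b))) u = ev (\<theta> b) (T (L (?e b))) u + ev (\<theta> b) (T' (?e b)) u"
      using LT[OF e[OF b]] D(4)[OF b] e[OF b] by (simp add: ev_padd TX L_pb pb_endoD(1)[OF T'])
    then show "ev (\<theta> b) (T' (?e b)) u = lact \<zeta> (\<lambda>v. ev (\<theta> b) (T (?e b)) v) u -
        (ev (LD \<eta> (\<theta> b)) (T (?e b)) u + ev (\<theta> b) (T (L (?e b))) u)"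
      using ev_L[OF TX[OF e[OF b]] D(4)[OF b], of u] by simp
  qed
  also have "\<dots> = lact \<zeta> (\<lambda>v. \<Sum>b\<in>?B. ev (\<theta> b) (T (?e b)) v) u -
      ((\<Sum>b\<in>?B. ev (LD \<eta> (\<theta> b)) (T (?e b)) u) + (\<Sum>b\<in>?B. ev (\<theta> b) (T (L (?e b))) u))"
    by (subst lact_sum[OF \<zeta>_pr finite_onb])
       (simp_all add: sum_subtractf sum.distrib pb_smooth TX e D(4))
  also have "(\<lambda>v. \<Sum>b\<in>?B. ev (\<theta> b) (T (?e b)) v) = (\<lambda>v. ?f v * ?tr v)"
    by (simp add: endo_trace_frame[OF T F])
  also have "lact \<zeta> (\<lambda>v. ?f v * ?tr v) u = lact \<zeta> ?tr u + ?tr u * lact \<zeta> ?f u"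
    using D(2) by (simp add: lact_mult \<zeta>_pr f tr)
  \<comment> \<open>At u, where f = 1, T e_b is expanded in the frame, and below so is L e_c. Both
    double sums then carry the coefficients \<theta>_c(T e_b) and can be merged through
    \<open>cross\<close>.\<close>
  also have "(\<Sum>b\<in>?B. ev (LD \<eta> (\<theta> b)) (T (?e b)) u) =
      (\<Sum>b\<in>?B. \<Sum>c\<in>?B. ev (\<theta> c) (T (?e b)) u * ev (LD \<eta> (\<theta> b)) (?e c) u)"
  proof (rule sum.cong[OF refl])
    fix b assume b: "b \<in> ?B"
    show "ev (LD \<eta> (\<theta> b)) (T (?e b)) u =
        (\<Sum>c\<in>?B. ev (\<theta> c) (T (?e b)) u * ev (LD \<eta> (\<theta> b)) (?e c) u)"
      using pb_expansion[OF F lin[OF lie_dual_\<eta>[OF D(4)[OF b]]] TX[OF e[OF b]], of u] D(2) by simp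
  qed
  also have "(\<Sum>b\<in>?B. ev (\<theta> b) (T (L (?e b))) u) =
      (\<Sum>c\<in>?B. \<Sum>b\<in>?B. ev (\<theta> b) (L (?e c)) u * ev (\<theta> c) (T (?e b)) u)"
  proof (rule sum.cong[OF refl])
    fix c assume c: "c \<in> ?B"
    show "ev (\<theta> c) (T (L (?e c))) u = (\<Sum>b\<in>?B. ev (\<theta> b) (L (?e c)) u * ev (\<theta> c) (T (?e b)) u)"
      using pb_expansion[OF F pb_endoD(2)[OF T D(4)[OF c]] L_pb[OF e[OF c]], of u] D(2) by simp
  qed
  also have "\<dots> = (\<Sum>b\<in>?B. \<Sum>c\<in>?B. ev (\<theta> c) (T (?e b)) u * ev (\<theta> b) (L (?e c)) u)"
    by (subst sum.swap) (simp add: mult.commute)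
  also have "(\<Sum>b\<in>?B. \<Sum>c\<in>?B. ev (\<theta> c) (T (?e b)) u * ev (LD \<eta> (\<theta> b)) (?e c) u) + \<dots> =
      (\<Sum>b\<in>?B. \<Sum>c\<in>?B. ev (\<theta> c) (T (?e b)) u * (if b = c then lact \<zeta> ?f u else 0))"
    by (simp only: cross[symmetric] distrib_left sum.distrib cong: sum.cong)
  \<comment> \<open>What remains is the trace times the derivative of f, which cancels the second
    term of the product rule for f times the trace.\<close>
  also have "\<dots> = (\<Sum>b\<in>?B. ev (\<theta> b) (T (?e b)) u) * lact \<zeta> ?f u"
    by (simp add: if_distrib sum.delta sum_distrib_right cong: if_cong)
  also have "(\<Sum>b\<in>?B. ev (\<theta> b) (T (?e b)) u) = ?tr u"
    using endo_trace_frame[OF T F, of u] D(2) by simp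
  finally show ?thesis by simp
qed

end

section \<open>Lie symmetries and the Douglas curvature\<close>

locale berwald_symmetry = complete_lift_derivation G br S H V \<eta>
  for G br S H V \<eta> +
  fixes B
  assumes bw: "berwald_connection G br S H" and curv: "berwald_curvature G br H V B"
    and sym: "lie_symmetry G br S \<eta>"
begin

abbreviation "nh \<equiv> nabla_h G br H V"

section \<open>Invariance of the Berwald connection under the symmetry\<close>

lemma H_hat: "s \<in> sec \<Longrightarrow> H (hat G s) =
    lmul G (\<lambda>_. 1/2) (ladd G (clift s) (br (im (hat G s)) S))"
  using bw by (simp add: berwald_connection_def vertical_lift_def)

lemma br_\<zeta>_S: "br \<zeta> S = lzero G"
proof -
  have "br S \<zeta> = lzero G" using sym by (simp add: lie_symmetry_def)
  then show ?thesis
    using br_skew[OF \<zeta>_pr S_pr]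
    by (auto intro!: pr_eqI simp: lzero_pr lmul_pr Cinf_const[OF atlE] jv_lmul jv_lzero lact_lmul lact_lzero)
qed

lemma br_lzero:
  assumes z: "\<omega> \<in> pr"
  shows "br \<omega> (lzero G) = lzero G"
proof -
  have c: "(\<lambda>_. 0) \<in> CE" by (rule Cinf_const[OF atlE])
  have "lzero G = lmul G (\<lambda>_. 0) (lzero G)"
    by (rule pr_eqI) (simp_all add: lzero_pr lmul_pr c jv_lmul jv_lzero lact_lmul lact_lzero)
  then have "br \<omega> (lzero G) = lmul G (\<lambda>_. 0) (br \<omega> (lzero G))"
    using br_lconst[OF z lzero_pr, of 0] by simp
  also have "\<dots> = lzero G"
    by (rule pr_eqI) (simp_all add: lzero_pr lmul_pr br_pr z c jv_lmul jv_lzero lact_lmul lact_lzero)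
  finally show ?thesis .
qed

text \<open>As [\<zeta>, S] = 0, the Jacobi identity moves \<zeta> past S, and both summands of the
  formula for H on the basic section of s are carried to those for [\<eta>, s].\<close>

lemma br_H_hat:
  assumes s: "s \<in> sec"
  shows "br \<zeta> (H (hat G s)) = H (hat G (bG \<eta> s))"
proof -
  note hs = hat_pb[OF s] and sp = projects_toD(1)[OF clift_projects[OF s]]
  note ehs = bracket_sec[OF \<eta> s]
  have b: "br (im (hat G s)) S \<in> pr" "br (im (hat G (bG \<eta> s))) S \<in> pr"
    by (intro br_pr im_pr hs S_pr hat_pb ehs)+
  have "br \<zeta> (br (im (hat G s)) S) = ladd G (br (br \<zeta> (im (hat G s))) S) (br (im (hat G s)) (br \<zeta> S))"
    by (rule br_jacobi[OF \<zeta>_pr im_pr[OF hs] S_pr])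
  also have "\<dots> = ladd G (br (im (hat G (bG \<eta> s))) S) (lzero G)"
    using im_L[OF hs] by (simp add: L_hat s br_\<zeta>_S br_lzero im_pr hs)
  also have "\<dots> = br (im (hat G (bG \<eta> s))) S"
    by (rule pr_eqI) (simp_all add: ladd_pr b lzero_pr jv_ladd jv_lzero lact_ladd lact_lzero)
  finally show ?thesis
    by (simp add: H_hat s ehs br_lconst br_ladd \<zeta>_pr ladd_pr sp b br_complete_lift \<eta>)
qed

text \<open>The map X \<mapsto> V [\<zeta>, H X] is tensorial: the Leibniz term is a multiple of H
  X, which V annihilates. So basic sections suffice, and for them \<open>br_H_hat\<close> shows the
  bracket to be horizontal.\<close>

lemma V_br_H:
  assumes X: "X \<in> pb"
  shows "V (br \<zeta> (H X)) = pzero G"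
proof (rule pb_eqI)
  fix \<theta> u assume \<theta>: "\<theta> \<in> dual"
  have "pb_linear (\<lambda>X u. ev \<theta> (V (br \<zeta> (H X))) u)"
  proof (rule pb_linearI)
    show "ev \<theta> (V (br \<zeta> (H (padd G X Y)))) u = ev \<theta> (V (br \<zeta> (H X))) u + ev \<theta> (V (br \<zeta> (H Y))) u"
      if "X \<in> pb" "Y \<in> pb" for X Y u
      using that \<theta> by (simp add: H_padd br_ladd \<zeta>_pr H_pr V_ladd br_pr ev_padd V_pb)
    show "ev \<theta> (V (br \<zeta> (H (pmul G g X)))) u = g u * ev \<theta> (V (br \<zeta> (H X))) u"
      if "g \<in> CE" "X \<in> pb" for g X u
      using that \<theta> by (simp add: H_pmul br_lmul \<zeta>_pr H_pr V_ladd V_lmul br_pr lmul_pr pr_act_smooth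
          ev_padd ev_pmul ev_pzero V_pb pmul_pb V_H pzero_pb)
  qed
  moreover have "ev \<theta> (V (br \<zeta> (H (hat G s)))) u = 0" if "s \<in> sec" for s u
    using that \<theta> by (simp add: br_H_hat V_H hat_pb bracket_sec \<eta> ev_pzero)
  ultimately show "ev \<theta> (V (br \<zeta> (H X))) u = ev \<theta> (pzero G) u"
    using pb_linear_eq_0[OF _ _ X, of "\<lambda>X u. ev \<theta> (V (br \<zeta> (H X))) u" u] \<theta> by (simp add: ev_pzero)
qed (simp_all add: V_pb br_pr \<zeta>_pr H_pr X pzero_pb)

text \<open>V is applied to the bracket of \<zeta> with both parts of the splitting; the vertical
  part gives L (V \<sigma>), the horizontal part gives 0.\<close>

lemma L_V_commute:
  assumes s: "\<sigma> \<in> pr"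
  shows "L (V \<sigma>) = V (br \<zeta> \<sigma>)"
proof -
  note Vs = V_pb[OF s] and js = jmap_pb[OF s]
  have "br \<zeta> \<sigma> = ladd G (br \<zeta> (im (V \<sigma>))) (br \<zeta> (H (jmap \<circ> \<sigma>)))"
    by (subst splitting[OF s]) (rule br_ladd[OF \<zeta>_pr im_pr[OF Vs] H_pr[OF js]])
  then have "V (br \<zeta> \<sigma>) = padd G (L (V \<sigma>)) (pzero G)"
    by (simp add: V_ladd br_pr \<zeta>_pr im_pr Vs H_pr js L_V V_br_H)
  also have "\<dots> = L (V \<sigma>)"
    by (rule pb_eqI) (simp_all add: padd_pb L_pb Vs pzero_pb ev_padd ev_pzero)
  finally show ?thesis by simp
qed

lemma nabla_h_pb: "X \<in> pb \<Longrightarrow> Y \<in> pb \<Longrightarrow> nh X Y \<in> pb"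
  by (simp add: nabla_h_def V_pb br_pr H_pr im_pr)

text \<open>For a basic first argument the bracket of \<zeta> with the horizontal lift is again the
  lift of a known section; the rest is the Jacobi identity and \<open>L_V_commute\<close>.\<close>

lemma L_nabla_h:
  assumes s: "s \<in> sec" and Y: "Y \<in> pb"
  shows "L (nh (hat G s) Y) =
    padd G (nh (hat G (bG \<eta> s)) Y) (nh (hat G s) (L Y))"
proof -
  note h = hat_pb[OF s] hat_pb[OF bracket_sec[OF \<eta> s]]
  have "L (nh (hat G s) Y) = V (br \<zeta> (br (H (hat G s)) (im Y)))"
    by (simp add: nabla_h_def L_V_commute br_pr H_pr im_pr h Y)
  also have "br \<zeta> (br (H (hat G s)) (im Y)) =
      ladd G (br (br \<zeta> (H (hat G s))) (im Y)) (br (H (hat G s)) (br \<zeta> (im Y)))"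
    by (rule br_jacobi[OF \<zeta>_pr H_pr[OF h(1)] im_pr[OF Y]])
  also have "\<dots> = ladd G (br (H (hat G (bG \<eta> s))) (im Y)) (br (H (hat G s)) (im (L Y)))"
    by (simp add: br_H_hat s im_L Y)
  finally show ?thesis by (simp add: nabla_h_def V_ladd br_pr H_pr im_pr h Y L_pb)
qed

section \<open>Lie derivative of the Berwald curvature\<close>

lemma B_tensor:
  assumes "X \<in> pb" "Y \<in> pb"
  shows B_pb: "Z \<in> pb \<Longrightarrow> B X Y Z \<in> pb"
    and "Z \<in> pb \<Longrightarrow> Z' \<in> pb \<Longrightarrow> B (padd G Z Z') X Y = padd G (B Z X Y) (B Z' X Y)"
    and "Z \<in> pb \<Longrightarrow> Z' \<in> pb \<Longrightarrow> B X (padd G Z Z') Y = padd G (B X Z Y) (B X Z' Y)"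
    and "Z \<in> pb \<Longrightarrow> Z' \<in> pb \<Longrightarrow> B X Y (padd G Z Z') = padd G (B X Y Z) (B X Y Z')"
    and "g \<in> CE \<Longrightarrow> Z \<in> pb \<Longrightarrow> B (pmul G g Z) X Y = pmul G g (B Z X Y)"
    and "g \<in> CE \<Longrightarrow> Z \<in> pb \<Longrightarrow> B X (pmul G g Z) Y = pmul G g (B X Z Y)"
    and "g \<in> CE \<Longrightarrow> Z \<in> pb \<Longrightarrow> B X Y (pmul G g Z) = pmul G g (B X Y Z)"
  using curv assms by (simp_all add: berwald_curvature_def tensor_13_def module_linear_def)

lemma B_hat: "r \<in> sec \<Longrightarrow> s \<in> sec \<Longrightarrow> t \<in> sec \<Longrightarrow>
    B (hat G r) (hat G s) (hat G t) = nv (hat G r) (nh (hat G s) (hat G t))"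
  using curv by (simp add: berwald_curvature_def)

lemma nabla_v_padd:
  assumes "X \<in> pb" "Y \<in> pb" "Z \<in> pb"
  shows "nv X (padd G Y Z) = padd G (nv X Y) (nv X Z)"
  by (rule pb_eqI)
     (simp_all add: assms nabla_v_pb padd_pb ev_nabla_v ev_padd lact_add im_pr pb_smooth)

lemma L_B_hat:
  assumes "r \<in> sec" "s \<in> sec" "t \<in> sec"
  shows "L (B (hat G r) (hat G s) (hat G t)) =
    padd G (B (hat G (bG \<eta> r)) (hat G s) (hat G t))
      (padd G (B (hat G r) (hat G (bG \<eta> s)) (hat G t)) (B (hat G r) (hat G s) (hat G (bG \<eta> t))))"
  using assms
  by (simp add: B_hat L_nabla_v nabla_h_pb hat_pb L_nabla_h L_hat bracket_sec \<eta> nabla_v_padd)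

text \<open>This is \<theta> applied to the Lie derivative of B. B is prescribed on basic sections,
  so its invariance has to be extended from there by linearity in each slot.\<close>

definition "L_defect \<theta> X Y Z u =
  ev \<theta> (L (B X Y Z)) u - ev \<theta> (B (L X) Y Z) u - ev \<theta> (B X (L Y) Z) u - ev \<theta> (B X Y (L Z)) u"

text \<open>L is a derivation, so a factor g in any slot creates the term (\<zeta> g) \<theta>(B(X,
  Y, Z)) once with each sign.\<close>

lemma L_defect_linear:
  assumes "\<theta> \<in> dual" "X \<in> pb" "Y \<in> pb"
  shows "pb_linear (\<lambda>Z u. L_defect \<theta> Z X Y u)" "pb_linear (\<lambda>Z u. L_defect \<theta> X Z Y u)"
    "pb_linear (\<lambda>Z u. L_defect \<theta> X Y Z u)"
  using assms
  by (auto intro!: pb_linearI simp: L_defect_def B_tensor L_padd L_pmul L_pb padd_pb pmul_pb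
      ev_padd ev_pmul pr_act_smooth \<zeta>_pr algebra_simps)

lemma L_defect_eq_0:
  assumes \<theta>: "\<theta> \<in> dual" and X: "X \<in> pb" and Y: "Y \<in> pb" and Z: "Z \<in> pb"
  shows "L_defect \<theta> X Y Z u = 0"
proof -
  have "L_defect \<theta> (hat G r) (hat G s) (hat G t) u = 0" if "r \<in> sec" "s \<in> sec" "t \<in> sec" for r s t u
    using that \<theta>
    by (simp add: L_defect_def L_B_hat L_hat B_pb hat_pb bracket_sec \<eta> padd_pb ev_padd)
  \<comment> \<open>Basic sections are replaced by arbitrary ones slot by slot, from the last to the
    first.\<close>
  then have "L_defect \<theta> (hat G r) (hat G s) Z u = 0" if "r \<in> sec" "s \<in> sec" for r s u
    using pb_linear_eq_0[OF L_defect_linear(3)[OF \<theta> hat_pb[OF that(1)] hat_pb[OF that(2)]] _ Z] that by blast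
  then have "L_defect \<theta> (hat G r) Y Z u = 0" if "r \<in> sec" for r u
    using pb_linear_eq_0[OF L_defect_linear(2)[OF \<theta> hat_pb[OF that] Z] _ Y] that by blast
  then show ?thesis
    using pb_linear_eq_0[OF L_defect_linear(1)[OF \<theta> Y Z] _ X] by blast
qed

lemma L_B:
  assumes X: "X \<in> pb" and Y: "Y \<in> pb" and Z: "Z \<in> pb"
  shows "L (B X Y Z) = padd G (B (L X) Y Z) (padd G (B X (L Y) Z) (B X Y (L Z)))"
proof (rule pb_eqI)
  show "ev \<theta> (L (B X Y Z)) u = ev \<theta> (padd G (B (L X) Y Z) (padd G (B X (L Y) Z) (B X Y (L Z)))) u"
    if "\<theta> \<in> dual" for \<theta> u
    using L_defect_eq_0[OF that X Y Z, of u] that X Y Z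
    by (simp add: L_defect_def ev_padd B_pb L_pb padd_pb)
qed (simp_all add: B_pb L_pb padd_pb X Y Z)

section \<open>The trace of the Berwald curvature and its vertical differential\<close>

abbreviation "tB \<equiv> tr_13 G B"

lemma B_endo: "X \<in> pb \<Longrightarrow> Y \<in> pb \<Longrightarrow> pb_endo (\<lambda>Z. B Z X Y)"
  by (simp add: pb_endo_def B_pb pb_linear_def B_tensor ev_padd ev_pmul)

lemma tB_smooth: "X \<in> pb \<Longrightarrow> Y \<in> pb \<Longrightarrow> tB X Y \<in> CE"
  using endo_trace_smooth[OF B_endo] by (simp add: tr_13_def)

lemma tB_padd:
  assumes "X \<in> pb" "Y \<in> pb" "Z \<in> pb"
  shows "tB (padd G X Y) Z u = tB X Z u + tB Y Z u" "tB Z (padd G X Y) u = tB Z X u + tB Z Y u"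
  unfolding tr_13_def using assms
  by (auto intro!: endo_trace_add B_endo padd_pb simp: B_tensor ev_padd)

text \<open>Once L on the traced slot is set apart, \<open>L_B\<close> leaves L acting on one of the
  two free slots; this is the second endomorphism in \<open>lact_endo_trace\<close>, and its trace
  splits into two.\<close>

lemma L_tB:
  assumes X: "X \<in> pb" and Y: "Y \<in> pb"
  shows "lact \<zeta> (tB X Y) u = tB (L X) Y u + tB X (L Y) u"
proof -
  let ?T' = "\<lambda>Z. padd G (B Z (L X) Y) (B Z X (L Y))"
  note LX = L_pb[OF X] and LY = L_pb[OF Y]
  have T': "pb_endo ?T'"
    using X Y LX LY by (simp add: pb_endo_def B_pb padd_pb pmul_pb pb_linear_def B_tensor ev_padd ev_pmul algebra_simps)
  have "lact \<zeta> (endo_trace G (\<lambda>Z. B Z X Y)) u = endo_trace G ?T' u"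
    by (rule lact_endo_trace[OF B_endo[OF X Y] T']) (simp add: L_B X Y)
  also have "\<dots> = tB (L X) Y u + tB X (L Y) u"
    unfolding tr_13_def
    by (rule endo_trace_add[OF B_endo[OF LX Y] B_endo[OF X LY] T']) (simp add: ev_padd B_pb X Y LX LY)
  finally show ?thesis by (simp add: tr_13_def)
qed

abbreviation "DB \<equiv> nabla_v_02 G br tB"

lemma DB_eq: "DB X Y Z u = lact (im X) (tB Y Z) u - tB (nv X Y) Z u - tB Y (nv X Z) u"
  by (simp add: nabla_v_02_def nabla_v_fun_def)

lemma DB_smooth:
  assumes "X \<in> pb" "Y \<in> pb" "Z \<in> pb"
  shows "DB X Y Z \<in> CE"
  unfolding nabla_v_02_def nabla_v_fun_def using assms
  by (intro Cinf_diff atlE) (simp_all add: pr_act_smooth im_pr tB_smooth nabla_v_pb)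

text \<open>The terms containing \<open>nv\<close> follow from \<open>L_tB\<close> and
  \<open>L_nabla_v\<close>. In the second derivative the order of \<zeta> and iX is exchanged at the
  price of i(L X), which is the leading term of the summand with L X.\<close>

lemma L_DB:
  assumes X: "X \<in> pb" and Y: "Y \<in> pb" and Z: "Z \<in> pb"
  shows "lact \<zeta> (DB X Y Z) u = DB (L X) Y Z u + DB X (L Y) Z u + DB X Y (L Z) u"
proof -
  note L = L_pb[OF X] L_pb[OF Y] L_pb[OF Z] and n = nabla_v_pb[OF X Y] nabla_v_pb[OF X Z]
  have s: "lact (im X) (tB Y Z) \<in> CE" "tB (nv X Y) Z \<in> CE" "tB Y (nv X Z) \<in> CE"
    by (simp_all add: pr_act_smooth im_pr tB_smooth n X Y Z)
  have "DB X Y Z = (\<lambda>v. lact (im X) (tB Y Z) v - tB (nv X Y) Z v - tB Y (nv X Z) v)"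
    by (simp add: fun_eq_iff DB_eq)
  then have "lact \<zeta> (DB X Y Z) u = lact \<zeta> (lact (im X) (tB Y Z)) u -
      lact \<zeta> (tB (nv X Y) Z) u - lact \<zeta> (tB Y (nv X Z)) u"
    using s by (simp add: lact_diff \<zeta>_pr Cinf_diff[OF atlE])
  moreover have "lact \<zeta> (tB Y Z) = (\<lambda>v. tB (L Y) Z v + tB Y (L Z) v)"
    by (simp add: fun_eq_iff L_tB Y Z)
  then have "lact (im X) (lact \<zeta> (tB Y Z)) u = lact (im X) (tB (L Y) Z) u + lact (im X) (tB Y (L Z)) u"
    by (simp add: lact_add im_pr X tB_smooth L Y Z)
  ultimately show ?thesis
    using lact_br_im[OF X tB_smooth[OF Y Z], of u]
    by (simp add: DB_eq L_tB n L Y Z X L_nabla_v tB_padd nabla_v_pb)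
qed

section \<open>The Douglas curvature\<close>

abbreviation "D n \<equiv> douglas G n br B"

context
  fixes X Y Z
  assumes XYZ: "X \<in> pb" "Y \<in> pb" "Z \<in> pb"
begin

lemmas douglas_simps = XYZ douglas_def sym_prod_Id_def Cinf_const[OF atlE] tB_smooth DB_smooth B_pb
  delta_pb padd_pb pmul_pb pzero_pb L_pb ev_padd ev_pmul ev_delta ev_pzero

lemma douglas_pb: "D n X Y Z \<in> pb"
  by (simp add: douglas_simps)

lemma ev_douglas: "\<theta> \<in> dual \<Longrightarrow> ev \<theta> (D n X Y Z) u = ev \<theta> (B X Y Z) u - 1 / (real n + 1) *
    (tB X Y u * ev \<theta> Z u + tB Y Z u * ev \<theta> X u + tB Z X u * ev \<theta> Y u + DB X Y Z u * dhat \<theta> u)"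
  by (simp add: douglas_simps)

text \<open>Each correction term is a function times a section, so the product rule applies; by
  \<open>L_delta\<close> the last one is differentiated only in its coefficient.\<close>

lemma ev_L_douglas: "\<theta> \<in> dual \<Longrightarrow> ev \<theta> (L (D n X Y Z)) u = ev \<theta> (L (B X Y Z)) u - 1 / (real n + 1) *
    (tB X Y u * ev \<theta> (L Z) u + lact \<zeta> (tB X Y) u * ev \<theta> Z u +
     (tB Y Z u * ev \<theta> (L X) u + lact \<zeta> (tB Y Z) u * ev \<theta> X u) +
     (tB Z X u * ev \<theta> (L Y) u + lact \<zeta> (tB Z X) u * ev \<theta> Y u) + lact \<zeta> (DB X Y Z) u * dhat \<theta> u)"
  by (simp add: douglas_simps L_padd L_pmul L_delta pr_act_smooth \<zeta>_pr lact_const)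

end

lemma douglas_collineation: "curvature_collineation G br (D n) \<zeta>"
proof -
  have "lie_der_13 G br \<zeta> (D n) X Y Z = pzero G" if X: "X \<in> pb" and Y: "Y \<in> pb" and Z: "Z \<in> pb" for X Y Z
  proof -
    have c: "(\<lambda>_. -1) \<in> CE" by (rule Cinf_const[OF atlE])
    note facts = X Y Z c L_pb douglas_pb padd_pb pmul_pb pzero_pb
    show ?thesis
    proof (rule pb_eqI)
      fix \<theta> u assume \<theta>: "\<theta> \<in> dual"
      \<comment> \<open>After \<open>L_B\<close>, \<open>L_tB\<close> and \<open>L_DB\<close> are
        inserted, both sides contain the same summands and only arithmetic of reals is left.\<close>
      have "ev \<theta> (L (D n X Y Z)) u =
          ev \<theta> (D n (L X) Y Z) u + (ev \<theta> (D n X (L Y) Z) u + ev \<theta> (D n X Y (L Z)) u)"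
        by (simp add: ev_L_douglas ev_douglas facts \<theta> L_B L_tB L_DB ev_padd B_pb)
           (simp add: add_divide_distrib algebra_simps)
      then show "ev \<theta> (lie_der_13 G br \<zeta> (D n) X Y Z) u = ev \<theta> (pzero G) u"
        by (simp add: lie_der_13_def facts \<theta> ev_padd ev_pmul ev_pzero)
    qed (simp_all add: lie_der_13_def facts)
  qed
  moreover have "projectable G \<zeta>"
    using \<zeta>_projects by (auto simp: projectable_def projects_to_def)
  ultimately show ?thesis by (simp add: curvature_collineation_def)
qed

end

theorem theorem4p8:
  fixes G :: "('m::{t2_space, second_countable_topology}, 'a::finite_dim_inner,
               'e::{t2_space, second_countable_topology}, 'f::finite_dim_inner) algebroid_data"
    and n :: nat
    and br :: "('e \<Rightarrow> 'e \<times> 'e tvec) \<Rightarrow> ('e \<Rightarrow> 'e \<times> 'e tvec) \<Rightarrow> ('e \<Rightarrow> 'e \<times> 'e tvec)"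
    and S :: "'e \<Rightarrow> 'e \<times> 'e tvec"
    and H :: "('e \<Rightarrow> 'e \<times> 'e) \<Rightarrow> ('e \<Rightarrow> 'e \<times> 'e tvec)"
    and V :: "('e \<Rightarrow> 'e \<times> 'e tvec) \<Rightarrow> ('e \<Rightarrow> 'e \<times> 'e)"
    and B :: "('e \<Rightarrow> 'e \<times> 'e) \<Rightarrow> ('e \<Rightarrow> 'e \<times> 'e) \<Rightarrow> ('e \<Rightarrow> 'e \<times> 'e) \<Rightarrow> ('e \<Rightarrow> 'e \<times> 'e)"
    and \<eta> :: "'m \<Rightarrow> 'e"
  assumes "lie_algebroid G"
    and "dim (UNIV :: 'a set) = n"
    and "prolongation_bracket G br"
    and "spray G br S"
    and "berwald_connection G br S H"
    and "vertical_map G H V"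
    and "berwald_curvature G br H V B"
    and "lie_symmetry G br S \<eta>"
  shows "curvature_collineation G br (douglas G n br B) (complete_lift G \<eta>)"
proof -
  interpret berwald_symmetry G br S H V \<eta> B
    using assms by unfold_locales (simp_all add: spray_def berwald_connection_def lie_symmetry_def)
  show ?thesis by (rule douglas_collineation)
qed

end
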